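(* Let $(M=M_1\times_{f_1}M_2,\Pi^{\nu_1},\tilde g^{f_1})$ be a contravariant warped product space. Then for non-degenerate independent one-forms $\omega_1,\eta_1\in\Gamma(T^*M_1)$ and $\omega_2,\eta_2\in\Gamma(T^*M_2)$ we have $$\mathcal K^M(\omega_1^h,\eta_1^h)=\mathcal K^{M_1}(\omega_1,\eta_1)^h,$$ $$\mathcal K^M(\omega_1^h,\eta_2^v)=-\left(\frac{\tilde g_1(\mathcal D^{M_1}_{\omega_1}J_1df_1,\omega_1)}{f_1\,\tilde g_1(\omega_1,\omega_1)}\right)^h-\frac{2\,|\tilde g_1(J_1df_1,\omega_1)^h|^2}{(f_1^h)^2\,\tilde g_1(\omega_1,\omega_1)^h}+\frac{\tilde g_2(J_2\eta_2,J_2\eta_2)^v\,\big|\big(f_1^2\,\tilde g_1(d\nu_1,\omega_1)\big)^h\big|^2}{4\,\tilde g_1(\omega_1,\omega_1)^h\,\tilde g_2(\eta_2,\eta_2)^v},$$ $$\mathcal K^M(\omega_2^v,\eta_2^v)=(\nu_1^h)^2(f_1^h)^2\,\mathcal K^{M_2}(\omega_2,\eta_2)^v-\frac{(\|J_1df_1\|_1^2)^h}{(f_1^h)^2}-\frac{(3f_1^4\|d\nu_1\|_1^2)^h\,|\tilde g_2(J_2\omega_2,\eta_2)^v|^2+4\big(f_1\,\tilde g_1(d\nu_1,J_1df_1)\big)^h\,\tilde g_2(\omega_2,\eta_2)^v\,\tilde g_2(J_2\omega_2,\eta_2)^v}{4\left(\tilde g_2(\omega_2,\omega_2)^v\,\tilde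 g_2(\eta_2,\eta_2)^v-|\tilde g_2(\omega_2,\eta_2)^v|^2\right)},$$ where $\mathcal K^M,\mathcal K^{M_1},\mathcal K^{M_2}$ are the sectional curvatures of $M$, $M_1$ and $M_2$ respectively.
   Context: Everything is smooth. For a bivector field $\Pi$ on a manifold $N$, the sharp map $\sharp_\Pi:T^*N\to TN$ is defined by $\eta(\sharp_\Pi(\omega))=\Pi(\omega,\eta)$, and the bracket on one-forms is $[\omega,\eta]_\Pi=\mathcal L_{\sharp_\Pi(\omega)}\eta-\mathcal L_{\sharp_\Pi(\eta)}\omega-d(\Pi(\omega,\eta))$. $(N,\Pi)$ is a Poisson manifold if the Schouten bracket $[\Pi,\Pi]_S$ vanishes. For a semi-Riemannian metric $\bar g$ on $N$, its cometric $\tilde g$ is the induced metric on $T^*N$. The endomorphism $J$ of $T^*N$ is defined by $\Pi(\omega,\eta)=\tilde g(J\omega,\eta)=-\tilde g(\omega,J\eta)$. A contravariant connection $\mathcal D$ is an $\mathbb R$-bilinear map on one-forms with $\mathcal D_{f\omega}\eta=f\mathcal D_\omega\eta$ and $\mathcal D_\omega(f\eta)=f\mathcal D_\omega\eta+\sharp_\Pi(\omega)(f)\eta$. The contravariant Levi-Civita connection of $(\tilde g,\Pi)$ is the unique one satisfying $\mathcal D_\omega\eta-\mathcal D_\eta\omega=[\omega,\eta]_\Pi$ and $\sharp_\Pi(\omega)\tilde g(\eta,\gamma)=\tilde g(\mathcal D_\omega\eta,\gamma)+\tilde g(\eta,\mathcal D_\omega\gamma)$. Its curvature is $\mathcal R(\omega,\eta)\gamma=\mathcal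 D_\omega\mathcal D_\eta\gamma-\mathcal D_\eta\mathcal D_\omega\gamma-\mathcal D_{[\omega,\eta]_\Pi}\gamma$, and the sectional curvature is $$\mathcal K(\omega,\eta)=\frac{\tilde g(\mathcal R(\omega,\eta)\eta,\omega)}{\tilde g(\omega,\omega)\tilde g(\eta,\eta)-\tilde g(\omega,\eta)^2}.$$ Contravariant warped product space: for $i=1,2$ let $(M_i,\Pi_i)$ be a Poisson manifold with semi-Riemannian metric $\bar g_i$, cometric $\tilde g_i$, endomorphism $J_i$ and contravariant Levi-Civita connection $\mathcal D^{M_i}$ of $(\tilde g_i,\Pi_i)$. Let $f_1$ be a positive smooth function and $\nu_1$ a smooth function on $M_1$. Put $M=M_1\times M_2$ with projections $\pi_1,\pi_2$. The superscript $h$ denotes horizontal lift (pull-back by $\pi_1$ of functions and forms from $M_1$) and $v$ denotes vertical lift (pull-back by $\pi_2$ from $M_2$). $M$ carries the warped metric $\bar g^{f_1}=\pi_1^*\bar g_1+(f_1^h)^2\pi_2^*\bar g_2$, whose cometric is $\tilde g^{f_1}=\tilde g_1^h+\frac1{(f_1^h)^2}\tilde g_2^v$, and the bivector field $\Pi^{\nu_1}=\Pi_1+\nu_1\Pi_2$, i.e. $\Pi^{\nu_1}(\omega_1^h+\omega_2^v,\gamma_1^h+\gamma_2^v)=\Pi_1(\omega_1,\gamma_1)^h+\nu_1^h\Pi_2(\omega_2,\gamma_2)^v$. $\mathcal D,\mathcal R,\mathcal K^M$ denote the contravariant Levi-Civita connection, curvature and sectional curvature of $(\tilde g^{f_1},\Pi^{\nu_1})$.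 Notation: $\|\alpha\|_1^2=\tilde g_1(\alpha,\alpha)$. "Non-degenerate independent" means linearly independent with all the sectional curvatures involved defined (the denominators occurring are nonzero). *)

theory Defs
  imports "HOL-Analysis.Analysis"
begin

section \<open>Smooth manifolds\<close>

text \<open>A manifold is a Hausdorff second countable type \<open>'m\<close> together with a smooth atlas
  modelled on a Euclidean space \<open>'e\<close>. A chart is a pair of a domain and a coordinate map;
  only the values of the coordinate map on the domain matter. The atlas need not be maximal.\<close>

type_synonym ('m, 'e) chart = "'m set \<times> ('m \<Rightarrow> 'e)"

text \<open>To be used for open \<open>S\<close> in a finite-dimensional space only, where it is the usual
  notion of a $C^k$ map.\<close>

fun Ck_on :: "nat \<Rightarrow> 'a::real_normed_vector set \<Rightarrow> ('a \<Rightarrow> 'b::real_normed_vector) \<Rightarrow> bool" where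
  "Ck_on 0 S f \<longleftrightarrow> continuous_on S f"
| "Ck_on (Suc k) S f \<longleftrightarrow>
     f differentiable_on S \<and> (\<forall>v. Ck_on k S (\<lambda>x. frechet_derivative f (at x) v))"

definition smooth_on :: "'a::real_normed_vector set \<Rightarrow> ('a \<Rightarrow> 'b::real_normed_vector) \<Rightarrow> bool" where
  "smooth_on S f \<longleftrightarrow> (\<forall>k. Ck_on k S f)"

definition is_chart :: "('m::topological_space, 'e::euclidean_space) chart \<Rightarrow> bool" where
  "is_chart \<kappa> \<longleftrightarrow> (case \<kappa> of (U, \<phi>) \<Rightarrow>
     open U \<and> open (\<phi> ` U) \<and> homeomorphism U (\<phi> ` U) \<phi> (inv_into U \<phi>))"

definition smooth_atlas :: "('m::{t2_space,second_countable_topology}, 'e::euclidean_space) chart set \<Rightarrow> bool" where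
  "smooth_atlas A \<longleftrightarrow>
     (\<forall>\<kappa>\<in>A. is_chart \<kappa>) \<and> (\<Union>\<kappa>\<in>A. fst \<kappa>) = UNIV \<and>
     (\<forall>(U, \<phi>)\<in>A. \<forall>(V, \<psi>)\<in>A. smooth_on (\<phi> ` (U \<inter> V)) (\<psi> \<circ> inv_into U \<phi>))"

definition smooth_funs :: "('m, 'e::euclidean_space) chart set \<Rightarrow> ('m \<Rightarrow> real) set" where
  "smooth_funs A = {f. \<forall>(U, \<phi>)\<in>A. smooth_on (\<phi> ` U) (f \<circ> inv_into U \<phi>)}"

definition product_atlas ::
  "('m, 'e) chart set \<Rightarrow> ('n, 'f) chart set \<Rightarrow> ('m \<times> 'n, 'e \<times> 'f) chart set" where
  "product_atlas A B = {(U \<times> V, map_prod \<phi> \<psi>) |U \<phi> V \<psi>. (U, \<phi>) \<in> A \<and> (V, \<psi>) \<in> B}"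

section \<open>Tangent and cotangent spaces\<close>

text \<open>A tangent vector is the operator \<open>f \<mapsto> (f \<circ> \<gamma>)'(0)\<close> on smooth functions given by a smooth
  curve \<open>\<gamma>\<close>; by convention it vanishes on functions that are not smooth. Vector space
  operations on tangent vectors and covectors are pointwise.\<close>

type_synonym 'm tvec = "('m \<Rightarrow> real) \<Rightarrow> real"
type_synonym 'm covec = "'m tvec \<Rightarrow> real"
type_synonym 'm vfield = "'m \<Rightarrow> 'm tvec"
type_synonym 'm form = "'m \<Rightarrow> 'm covec"
type_synonym 'm bivec = "'m \<Rightarrow> 'm covec \<Rightarrow> 'm covec \<Rightarrow> real"
type_synonym 'm metric = "'m \<Rightarrow> 'm tvec \<Rightarrow> 'm tvec \<Rightarrow> real"

definition smooth_curve ::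
  "('m::topological_space, 'e::euclidean_space) chart set \<Rightarrow> real set \<Rightarrow> (real \<Rightarrow> 'm) \<Rightarrow> bool" where
  "smooth_curve A I \<gamma> \<longleftrightarrow>
     continuous_on I \<gamma> \<and> (\<forall>(U, \<phi>)\<in>A. smooth_on {t\<in>I. \<gamma> t \<in> U} (\<phi> \<circ> \<gamma>))"

definition velocity :: "('m, 'e::euclidean_space) chart set \<Rightarrow> (real \<Rightarrow> 'm) \<Rightarrow> 'm tvec" where
  "velocity A \<gamma> = (\<lambda>f. if f \<in> smooth_funs A then deriv (\<lambda>t. f (\<gamma> t)) 0 else 0)"

definition tangent_space ::
  "('m::topological_space, 'e::euclidean_space) chart set \<Rightarrow> 'm \<Rightarrow> 'm tvec set" where
  "tangent_space A p =
     {velocity A \<gamma> |\<gamma>. \<gamma> 0 = p \<and> (\<exists>\<epsilon>>0. smooth_curve A {-\<epsilon><..<\<epsilon>} \<gamma>)}"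

text \<open>Covectors are extended by zero outside the tangent space, so that equality of covectors
  and of one-forms is equality in HOL.\<close>

definition cotangent_space ::
  "('m::topological_space, 'e::euclidean_space) chart set \<Rightarrow> 'm \<Rightarrow> 'm covec set" where
  "cotangent_space A p = {\<alpha>.
     (\<forall>u\<in>tangent_space A p. \<forall>v\<in>tangent_space A p. \<forall>a b.
        \<alpha> (\<lambda>f. a * u f + b * v f) = a * \<alpha> u + b * \<alpha> v) \<and>
     (\<forall>v. v \<notin> tangent_space A p \<longrightarrow> \<alpha> v = 0)}"

definition pushforward :: "('n, 'f::euclidean_space) chart set \<Rightarrow> ('m \<Rightarrow> 'n) \<Rightarrow> 'm tvec \<Rightarrow> 'n tvec" where
  "pushforward B F v = (\<lambda>f. if f \<in> smooth_funs B then v (f \<circ> F) else 0)"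

definition pullback_covec ::
  "('m::topological_space, 'e::euclidean_space) chart set \<Rightarrow> ('n, 'f::euclidean_space) chart set
     \<Rightarrow> ('m \<Rightarrow> 'n) \<Rightarrow> 'm \<Rightarrow> 'n covec \<Rightarrow> 'm covec" where
  "pullback_covec A B F p \<beta> =
     (\<lambda>v. if v \<in> tangent_space A p then \<beta> (pushforward B F v) else 0)"

section \<open>Vector fields and one-forms\<close>

definition vector_fields ::
  "('m::topological_space, 'e::euclidean_space) chart set \<Rightarrow> 'm vfield set" where
  "vector_fields A = {X. (\<forall>p. X p \<in> tangent_space A p) \<and>
     (\<forall>f\<in>smooth_funs A. (\<lambda>p. X p f) \<in> smooth_funs A)}"

definition one_forms ::
  "('m::topological_space, 'e::euclidean_space) chart set \<Rightarrow> 'm form set" where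
  "one_forms A = {\<omega>. (\<forall>p. \<omega> p \<in> cotangent_space A p) \<and>
     (\<forall>X\<in>vector_fields A. (\<lambda>p. \<omega> p (X p)) \<in> smooth_funs A)}"

definition form_add :: "'m form \<Rightarrow> 'm form \<Rightarrow> 'm form" where
  "form_add \<omega> \<eta> = (\<lambda>p v. \<omega> p v + \<eta> p v)"

definition form_diff :: "'m form \<Rightarrow> 'm form \<Rightarrow> 'm form" where
  "form_diff \<omega> \<eta> = (\<lambda>p v. \<omega> p v - \<eta> p v)"

definition form_mult :: "('m \<Rightarrow> real) \<Rightarrow> 'm form \<Rightarrow> 'm form" where
  "form_mult f \<omega> = (\<lambda>p v. f p * \<omega> p v)"

definition pullback_form ::
  "('m::topological_space, 'e::euclidean_space) chart set \<Rightarrow> ('n, 'f::euclidean_space) chart set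
     \<Rightarrow> ('m \<Rightarrow> 'n) \<Rightarrow> 'n form \<Rightarrow> 'm form" where
  "pullback_form A B F \<omega> = (\<lambda>p. pullback_covec A B F p (\<omega> (F p)))"

definition differential ::
  "('m::topological_space, 'e::euclidean_space) chart set \<Rightarrow> ('m \<Rightarrow> real) \<Rightarrow> 'm form" where
  "differential A f = (\<lambda>p v. if v \<in> tangent_space A p then v f else 0)"

definition lie_bracket :: "'m vfield \<Rightarrow> 'm vfield \<Rightarrow> 'm vfield" where
  "lie_bracket X Y = (\<lambda>p f. X p (\<lambda>q. Y q f) - Y p (\<lambda>q. X q f))"

text \<open>The Lie derivative of a one-form, \<open>(\<L>\<^sub>X \<omega>)(Y) = X(\<omega>(Y)) - \<omega>([X,Y])\<close>.\<close>

definition lie_derivative ::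
  "('m::topological_space, 'e::euclidean_space) chart set \<Rightarrow> 'm vfield \<Rightarrow> 'm form \<Rightarrow> 'm form" where
  "lie_derivative A X \<omega> = (THE \<theta>. \<theta> \<in> one_forms A \<and>
     (\<forall>Y\<in>vector_fields A. \<forall>p.
        \<theta> p (Y p) = X p (\<lambda>q. \<omega> q (Y q)) - \<omega> p (lie_bracket X Y p)))"

section \<open>Poisson structures\<close>

definition bivector_field ::
  "('m::topological_space, 'e::euclidean_space) chart set \<Rightarrow> 'm bivec \<Rightarrow> bool" where
  "bivector_field A P \<longleftrightarrow>
     (\<forall>p. \<forall>\<alpha>\<in>cotangent_space A p. \<forall>\<beta>\<in>cotangent_space A p. \<forall>\<gamma>\<in>cotangent_space A p. \<forall>a b.
        P p (\<lambda>v. a * \<alpha> v + b * \<beta> v) \<gamma> = a * P p \<alpha> \<gamma> + b * P p \<beta> \<gamma>) \<and>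
     (\<forall>p. \<forall>\<alpha>\<in>cotangent_space A p. \<forall>\<beta>\<in>cotangent_space A p. P p \<alpha> \<beta> = - P p \<beta> \<alpha>) \<and>
     (\<forall>\<omega>\<in>one_forms A. \<forall>\<eta>\<in>one_forms A. (\<lambda>p. P p (\<omega> p) (\<eta> p)) \<in> smooth_funs A)"

definition coord_vec ::
  "('m, 'e::euclidean_space) chart set \<Rightarrow> ('m, 'e) chart \<Rightarrow> 'e \<Rightarrow> 'm \<Rightarrow> 'm tvec" where
  "coord_vec A \<kappa> b p =
     velocity A (\<lambda>t. inv_into (fst \<kappa>) (snd \<kappa>) (snd \<kappa> p + t *\<^sub>R b))"

definition coord_covec ::
  "('m::topological_space, 'e::euclidean_space) chart set \<Rightarrow> ('m, 'e) chart \<Rightarrow> 'e \<Rightarrow> 'm \<Rightarrow> 'm covec" where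
  "coord_covec A \<kappa> b p = (THE \<alpha>. \<alpha> \<in> cotangent_space A p \<and>
     (\<forall>c\<in>Basis. \<alpha> (coord_vec A \<kappa> c p) = (if c = b then 1 else 0)))"

definition bivec_comp ::
  "('m::topological_space, 'e::euclidean_space) chart set \<Rightarrow> ('m, 'e) chart \<Rightarrow> 'm bivec
     \<Rightarrow> 'e \<Rightarrow> 'e \<Rightarrow> 'e \<Rightarrow> real" where
  "bivec_comp A \<kappa> P a b x = (let p = inv_into (fst \<kappa>) (snd \<kappa>) x in
     P p (coord_covec A \<kappa> a p) (coord_covec A \<kappa> b p))"

text \<open>The component \<open>[P,Q]\<^sub>S(dx\<^sup>a, dx\<^sup>b, dx\<^sup>c)\<close> of the Schouten bracket of two bivector fields,
  as a function of the coordinates of a chart. It results from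
  \<open>P = (1/2) \<Sum> P\<^sup>a\<^sup>b \<partial>\<^sub>a \<and> \<partial>\<^sub>b\<close> (and likewise for \<open>Q\<close>) by bilinearity and
  \<open>[X\<^sub>1 \<and> X\<^sub>2, Y\<^sub>1 \<and> Y\<^sub>2]\<^sub>S = \<Sum> (-1)\<^sup>i\<^sup>+\<^sup>j [X\<^sub>i, Y\<^sub>j] \<and> X\<^sub>3\<^sub>-\<^sub>i \<and> Y\<^sub>3\<^sub>-\<^sub>j\<close>.\<close>

definition schouten_comp ::
  "('m::topological_space, 'e::euclidean_space) chart set \<Rightarrow> ('m, 'e) chart \<Rightarrow> 'm bivec \<Rightarrow> 'm bivec
     \<Rightarrow> 'e \<Rightarrow> 'e \<Rightarrow> 'e \<Rightarrow> 'e \<Rightarrow> real" where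
  "schouten_comp A \<kappa> P Q a b c x =
     (let p = bivec_comp A \<kappa> P; q = bivec_comp A \<kappa> Q;
          dd = (\<lambda>r F. frechet_derivative F (at x) r);
          S = (\<lambda>i j k. \<Sum>r\<in>Basis. p i r x * dd r (q j k) + q i r x * dd r (p j k))
      in S a b c + S b c a + S c a b)"

definition poisson_structure ::
  "('m::topological_space, 'e::euclidean_space) chart set \<Rightarrow> 'm bivec \<Rightarrow> bool" where
  "poisson_structure A P \<longleftrightarrow> bivector_field A P \<and>
     (\<forall>(U, \<phi>)\<in>A. \<forall>x\<in>\<phi> ` U. \<forall>a\<in>Basis. \<forall>b\<in>Basis. \<forall>c\<in>Basis.
        schouten_comp A (U, \<phi>) P P a b c x = 0)"

definition sharp ::
  "('m::topological_space, 'e::euclidean_space) chart set \<Rightarrow> 'm bivec \<Rightarrow> 'm form \<Rightarrow> 'm vfield" where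
  "sharp A P \<omega> p = (THE v. v \<in> tangent_space A p \<and>
     (\<forall>\<eta>\<in>cotangent_space A p. \<eta> v = P p (\<omega> p) \<eta>))"

definition form_bracket ::
  "('m::topological_space, 'e::euclidean_space) chart set \<Rightarrow> 'm bivec \<Rightarrow> 'm form \<Rightarrow> 'm form \<Rightarrow> 'm form" where
  "form_bracket A P \<omega> \<eta> =
     form_diff
       (form_diff (lie_derivative A (sharp A P \<omega>) \<eta>) (lie_derivative A (sharp A P \<eta>) \<omega>))
       (differential A (\<lambda>p. P p (\<omega> p) (\<eta> p)))"

section \<open>Semi-Riemannian metrics\<close>

text \<open>The index is the largest dimension of a subspace of the tangent space on which the metric
  is negative definite; the subspaces are given by bases \<open>u 0, \<dots>, u (k - 1)\<close>, whose linear
  independence is implied by negative definiteness.\<close>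

definition metric_index ::
  "('m::topological_space, 'e::euclidean_space) chart set \<Rightarrow> 'm metric \<Rightarrow> 'm \<Rightarrow> nat" where
  "metric_index A g p = Max {k. \<exists>u. (\<forall>i<k. u i \<in> tangent_space A p) \<and>
     (\<forall>c. (\<exists>i<k. c i \<noteq> 0) \<longrightarrow>
        (let w = (\<lambda>f. \<Sum>i<k. c i * u i f) in g p w w < 0))}"

definition semi_riemannian_metric ::
  "('m::topological_space, 'e::euclidean_space) chart set \<Rightarrow> 'm metric \<Rightarrow> bool" where
  "semi_riemannian_metric A g \<longleftrightarrow>
     (\<forall>p. \<forall>u\<in>tangent_space A p. \<forall>v\<in>tangent_space A p. \<forall>w\<in>tangent_space A p. \<forall>a b.
        g p (\<lambda>f. a * u f + b * v f) w = a * g p u w + b * g p v w) \<and>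
     (\<forall>p. \<forall>u\<in>tangent_space A p. \<forall>v\<in>tangent_space A p. g p u v = g p v u) \<and>
     (\<forall>p. \<forall>u\<in>tangent_space A p. (\<forall>v\<in>tangent_space A p. g p u v = 0) \<longrightarrow> u = (\<lambda>f. 0)) \<and>
     (\<forall>X\<in>vector_fields A. \<forall>Y\<in>vector_fields A. (\<lambda>p. g p (X p) (Y p)) \<in> smooth_funs A) \<and>
     (\<exists>\<nu>. \<forall>p. metric_index A g p = \<nu>)"

definition metric_sharp ::
  "('m::topological_space, 'e::euclidean_space) chart set \<Rightarrow> 'm metric \<Rightarrow> 'm \<Rightarrow> 'm covec \<Rightarrow> 'm tvec" where
  "metric_sharp A g p \<alpha> = (THE u. u \<in> tangent_space A p \<and>
     (\<forall>v\<in>tangent_space A p. g p u v = \<alpha> v))"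

definition cometric ::
  "('m::topological_space, 'e::euclidean_space) chart set \<Rightarrow> 'm metric \<Rightarrow> 'm bivec" where
  "cometric A g p \<alpha> \<beta> = g p (metric_sharp A g p \<alpha>) (metric_sharp A g p \<beta>)"

definition form_inner ::
  "('m::topological_space, 'e::euclidean_space) chart set \<Rightarrow> 'm metric \<Rightarrow> 'm form \<Rightarrow> 'm form \<Rightarrow> 'm \<Rightarrow> real" where
  "form_inner A g \<omega> \<eta> p = cometric A g p (\<omega> p) (\<eta> p)"

text \<open>The endomorphism \<open>J\<close> of the cotangent bundle.\<close>

definition endo_J ::
  "('m::topological_space, 'e::euclidean_space) chart set \<Rightarrow> 'm metric \<Rightarrow> 'm bivec \<Rightarrow> 'm form \<Rightarrow> 'm form" where
  "endo_J A g P \<omega> p = (THE \<beta>. \<beta> \<in> cotangent_space A p \<and>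
     (\<forall>\<eta>\<in>cotangent_space A p. P p (\<omega> p) \<eta> = cometric A g p \<beta> \<eta>))"

section \<open>Contravariant connections\<close>

definition contravariant_connection ::
  "('m::topological_space, 'e::euclidean_space) chart set \<Rightarrow> 'm bivec
     \<Rightarrow> ('m form \<Rightarrow> 'm form \<Rightarrow> 'm form) \<Rightarrow> bool" where
  "contravariant_connection A P D \<longleftrightarrow>
     (\<forall>\<omega>\<in>one_forms A. \<forall>\<eta>\<in>one_forms A. D \<omega> \<eta> \<in> one_forms A) \<and>
     (\<forall>\<omega>\<in>one_forms A. \<forall>\<eta>\<in>one_forms A. \<forall>\<theta>\<in>one_forms A.
        D (form_add \<omega> \<eta>) \<theta> = form_add (D \<omega> \<theta>) (D \<eta> \<theta>) \<and>
        D \<theta> (form_add \<omega> \<eta>) = form_add (D \<theta> \<omega>) (D \<theta> \<eta>)) \<and>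
     (\<forall>\<omega>\<in>one_forms A. \<forall>\<eta>\<in>one_forms A. \<forall>c::real.
        D (form_mult (\<lambda>_. c) \<omega>) \<eta> = form_mult (\<lambda>_. c) (D \<omega> \<eta>) \<and>
        D \<omega> (form_mult (\<lambda>_. c) \<eta>) = form_mult (\<lambda>_. c) (D \<omega> \<eta>)) \<and>
     (\<forall>f\<in>smooth_funs A. \<forall>\<omega>\<in>one_forms A. \<forall>\<eta>\<in>one_forms A.
        D (form_mult f \<omega>) \<eta> = form_mult f (D \<omega> \<eta>) \<and>
        D \<omega> (form_mult f \<eta>) =
          form_add (form_mult f (D \<omega> \<eta>)) (form_mult (\<lambda>p. sharp A P \<omega> p f) \<eta>))"

definition contravariant_levi_civita ::
  "('m::topological_space, 'e::euclidean_space) chart set \<Rightarrow> 'm metric \<Rightarrow> 'm bivec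
     \<Rightarrow> ('m form \<Rightarrow> 'm form \<Rightarrow> 'm form) \<Rightarrow> bool" where
  "contravariant_levi_civita A g P D \<longleftrightarrow>
     contravariant_connection A P D \<and>
     (\<forall>\<omega>\<in>one_forms A. \<forall>\<eta>\<in>one_forms A.
        form_diff (D \<omega> \<eta>) (D \<eta> \<omega>) = form_bracket A P \<omega> \<eta>) \<and>
     (\<forall>\<omega>\<in>one_forms A. \<forall>\<eta>\<in>one_forms A. \<forall>\<gamma>\<in>one_forms A. \<forall>p.
        sharp A P \<omega> p (form_inner A g \<eta> \<gamma>) =
          form_inner A g (D \<omega> \<eta>) \<gamma> p + form_inner A g \<eta> (D \<omega> \<gamma>) p)"

definition contravariant_curvature ::
  "('m::topological_space, 'e::euclidean_space) chart set \<Rightarrow> 'm bivec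
     \<Rightarrow> ('m form \<Rightarrow> 'm form \<Rightarrow> 'm form) \<Rightarrow> 'm form \<Rightarrow> 'm form \<Rightarrow> 'm form \<Rightarrow> 'm form" where
  "contravariant_curvature A P D \<omega> \<eta> \<gamma> =
     form_diff (form_diff (D \<omega> (D \<eta> \<gamma>)) (D \<eta> (D \<omega> \<gamma>))) (D (form_bracket A P \<omega> \<eta>) \<gamma>)"

definition gram_det ::
  "('m::topological_space, 'e::euclidean_space) chart set \<Rightarrow> 'm metric \<Rightarrow> 'm form \<Rightarrow> 'm form \<Rightarrow> 'm \<Rightarrow> real" where
  "gram_det A g \<omega> \<eta> p =
     form_inner A g \<omega> \<omega> p * form_inner A g \<eta> \<eta> p - (form_inner A g \<omega> \<eta> p)\<^sup>2"

definition sectional_curvature ::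
  "('m::topological_space, 'e::euclidean_space) chart set \<Rightarrow> 'm metric \<Rightarrow> 'm bivec
     \<Rightarrow> ('m form \<Rightarrow> 'm form \<Rightarrow> 'm form) \<Rightarrow> 'm form \<Rightarrow> 'm form \<Rightarrow> 'm \<Rightarrow> real" where
  "sectional_curvature A g P D \<omega> \<eta> p =
     form_inner A g (contravariant_curvature A P D \<omega> \<eta> \<eta>) \<omega> p / gram_det A g \<omega> \<eta> p"

definition nondegenerate_independent ::
  "('m::topological_space, 'e::euclidean_space) chart set \<Rightarrow> 'm metric \<Rightarrow> 'm form \<Rightarrow> 'm form \<Rightarrow> 'm \<Rightarrow> bool" where
  "nondegenerate_independent A g \<omega> \<eta> p \<longleftrightarrow>
     (\<forall>a b::real. (\<forall>v\<in>tangent_space A p. a * \<omega> p v + b * \<eta> p v = 0) \<longrightarrow> a = 0 \<and> b = 0) \<and>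
     gram_det A g \<omega> \<eta> p \<noteq> 0"

section \<open>Contravariant warped products\<close>

definition horizontal_lift ::
  "('m::topological_space, 'e::euclidean_space) chart set
     \<Rightarrow> ('n::topological_space, 'f::euclidean_space) chart set \<Rightarrow> 'm form \<Rightarrow> ('m \<times> 'n) form" where
  "horizontal_lift A B = pullback_form (product_atlas A B) A fst"

definition vertical_lift ::
  "('m::topological_space, 'e::euclidean_space) chart set
     \<Rightarrow> ('n::topological_space, 'f::euclidean_space) chart set \<Rightarrow> 'n form \<Rightarrow> ('m \<times> 'n) form" where
  "vertical_lift A B = pullback_form (product_atlas A B) B snd"

definition warped_metric ::
  "('m::topological_space, 'e::euclidean_space) chart set
     \<Rightarrow> ('n::topological_space, 'f::euclidean_space) chart set
     \<Rightarrow> ('m \<Rightarrow> real) \<Rightarrow> 'm metric \<Rightarrow> 'n metric \<Rightarrow> ('m \<times> 'n) metric" where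
  "warped_metric A B f g h = (\<lambda>(p, q) u v.
     g p (pushforward A fst u) (pushforward A fst v) +
     (f p)\<^sup>2 * h q (pushforward B snd u) (pushforward B snd v))"

text \<open>A covector \<open>\<alpha>\<close> of the product at \<open>(p, q)\<close> is the sum of the pull-backs under the two
  projections of its restrictions to the slices \<open>M\<^sub>1 \<times> {q}\<close> and \<open>{p} \<times> M\<^sub>2\<close>. These
  restrictions are therefore the \<open>\<omega>\<^sub>1\<close> and \<open>\<omega>\<^sub>2\<close> in \<open>\<alpha> = \<omega>\<^sub>1\<^sup>h + \<omega>\<^sub>2\<^sup>v\<close>.\<close>

definition warped_bivector ::
  "('m::topological_space, 'e::euclidean_space) chart set
     \<Rightarrow> ('n::topological_space, 'f::euclidean_space) chart set
     \<Rightarrow> ('m \<Rightarrow> real) \<Rightarrow> 'm bivec \<Rightarrow> 'n bivec \<Rightarrow> ('m \<times> 'n) bivec" where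
  "warped_bivector A B \<nu> P Q = (\<lambda>(p, q) \<alpha> \<beta>.
     (let h = pullback_covec A (product_atlas A B) (\<lambda>x. (x, q)) p;
          v = pullback_covec B (product_atlas A B) (\<lambda>y. (p, y)) q
      in P p (h \<alpha>) (h \<beta>) + \<nu> p * Q q (v \<alpha>) (v \<beta>)))"

end

theory Submission
  imports Defs
begin

text \<open>The Levi-Civita connection of the warped product is determined by the contravariant Koszul
formula (\<open>koszul\<close>), so it can be computed from the metric, the sharp map and the bracket of
one-forms. On lifts these are simple: the sharp map sends \<open>\<omega>\<^sup>h\<close> to the horizontal lift of
\<open>\<sharp>\<omega>\<close> and \<open>\<omega>\<^sup>v\<close> to \<open>\<nu>\<close> times the vertical lift of \<open>\<sharp>\<omega>\<close>, and
\<open>[\<omega>\<^sup>h, \<eta>\<^sup>h] = [\<omega>, \<eta>]\<^sup>h\<close>, \<open>[\<omega>\<^sup>h, \<eta>\<^sup>v] = 0\<close>,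
\<open>[\<omega>\<^sup>v, \<eta>\<^sup>v] = \<nu> [\<omega>, \<eta>]\<^sup>v + \<Pi>\<^sub>2(\<omega>, \<eta>) (d\<nu>)\<^sup>h\<close>
(\<open>bracket_HH\<close>, \<open>bracket_HV\<close>, \<open>bracket_VV\<close>). Every covector of the product is a sum of
lifts, so a covector is known once its inner products with lifts are known
(\<open>covec_eq_on_lifts\<close>). With \<open>j = J\<^sub>1 df\<close> this gives

  \<open>D \<omega>\<^sup>h \<eta>\<^sup>h = (D\<^sub>1 \<omega> \<eta>)\<^sup>h\<close>,

  \<open>D \<omega>\<^sup>h \<eta>\<^sup>v = D \<eta>\<^sup>v \<omega>\<^sup>h = (g\<^sub>1(j, \<omega>) / f) \<eta>\<^sup>v - (f\<^sup>2 g\<^sub>1(d\<nu>, \<omega>) / 2) (J\<^sub>2 \<eta>)\<^sup>v\<close>,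

  \<open>D \<omega>\<^sup>v \<eta>\<^sup>v = - (g\<^sub>2(\<omega>, \<eta>) / f\<^sup>3) j\<^sup>h + (\<Pi>\<^sub>2(\<omega>, \<eta>) / 2) (d\<nu>)\<^sup>h + \<nu> (D\<^sub>2 \<omega> \<eta>)\<^sup>v\<close>

(\<open>D_HH\<close>, \<open>D_HV\<close>, \<open>D_VV\<close>). The numerator \<open>g(R(\<omega>, \<eta>)\<eta>, \<omega>)\<close> of the sectional curvature
needs no second application of \<open>D\<close> to these right-hand sides: by metric compatibility it is a
combination of inner products of the covectors above and of derivatives of such inner products
(\<open>curvature_pairing\<close>). Applied to the product and to the second factor, this yields the two
formulas that involve vertical forms. Among horizontal lifts, connection, bracket and metric are
lifted from the first factor, and hence so is the curvature.

The calculation rests on facts about manifolds that have to be established for the given notions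
of tangent vector, vector field and one-form. A bracket of one-forms consists of Lie derivatives,
and a Lie derivative is the unique one-form with a prescribed value on every vector field, so
its existence must be proved. Bump functions turn the coordinates and the coordinate fields of a
chart into globally defined smooth functions \<open>x\<^sub>i\<close> and vector fields \<open>E\<^sub>i\<close> that form a frame
near a given point (\<open>frame_at_chart\<close>). Near that point a one-form is a sum of terms
\<open>h\<^sub>i dx\<^sub>i\<close>, and then \<open>(L\<^sub>X \<eta>)(v) = \<Sum> X(h\<^sub>i) v(x\<^sub>i) + h\<^sub>i v(X(x\<^sub>i))\<close>
(\<open>lie_derivative_local\<close>). This formula shows that \<open>L\<^sub>X \<eta>\<close> is defined pointwise, and it behaves
well under pull-back along a smooth map (\<open>lie_derivative_pull\<close>), which is how the brackets of lifts
are found. Frames also give the smoothness of the inner product of two one-forms, by solving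
a linear system with smooth coefficients (\<open>linear_system_germs\<close>).\<close>

section \<open>Smooth maps between open subsets of Euclidean spaces\<close>

lemma Ck_on_imp_continuous_on: "Ck_on k S f \<Longrightarrow> continuous_on S f"
  by (cases k) (auto intro: differentiable_imp_continuous_on)

lemma Ck_on_cong:
  assumes "open S" "Ck_on k S f" "\<And>x. x \<in> S \<Longrightarrow> f x = g x"
  shows "Ck_on k S g"
  using assms(2,3)
proof (induction k arbitrary: f g)
  case 0
  then show ?case by (metis Ck_on.simps(1) continuous_on_cong)
next
  case (Suc k)
  have d: "f differentiable at x" if "x \<in> S" for x
    using Suc.prems(1) that assms(1) by (simp add: differentiable_on_eq_differentiable_at)
  have "(g has_derivative frechet_derivative f (at x)) (at x)" if "x \<in> S" for x
    using has_derivative_transform_within_open[OF _ assms(1) that] d[OF that] Suc.prems(2)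
      frechet_derivative_works by blast
  then have *: "g differentiable at x" "frechet_derivative g (at x) = frechet_derivative f (at x)"
    if "x \<in> S" for x
    using that frechet_derivative_at[symmetric] by (auto simp: differentiable_def)
  show ?case
    using Suc.IH[of "\<lambda>x. frechet_derivative f (at x) v" "\<lambda>x. frechet_derivative g (at x) v" for v]
      Suc.prems(1) * assms(1)
    by (simp add: differentiable_on_eq_differentiable_at)
qed

lemma Ck_on_Suc_intro:
  assumes "open S" "\<And>x. x \<in> S \<Longrightarrow> (f has_derivative f' x) (at x)" "\<And>v. Ck_on k S (\<lambda>x. f' x v)"
  shows "Ck_on (Suc k) S f"
proof -
  have "f differentiable_on S"
    using assms(1,2) by (auto simp: differentiable_on_eq_differentiable_at differentiable_def)
  moreover have "frechet_derivative f (at x) v = f' x v" if "x \<in> S" for x v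
    using assms(2)[OF that] frechet_derivative_at by metis
  ultimately show ?thesis
    using Ck_on_cong[OF assms(1,3)] by simp
qed

lemma Ck_on_Suc_has_derivative:
  assumes "open S" "Ck_on (Suc k) S f" "x \<in> S"
  shows "(f has_derivative frechet_derivative f (at x)) (at x)"
  using assms by (simp add: differentiable_on_eq_differentiable_at frechet_derivative_works[symmetric])

lemma Ck_on_Suc_imp: "Ck_on (Suc k) S f \<Longrightarrow> Ck_on k S f"
proof (induction k arbitrary: f)
  case 0
  then show ?case by (auto intro: differentiable_imp_continuous_on)
next
  case (Suc k)
  then show ?case by (metis Ck_on.simps(2))
qed

lemma Ck_on_subset: "Ck_on k S f \<Longrightarrow> T \<subseteq> S \<Longrightarrow> Ck_on k T f"
  by (induction k arbitrary: f) (auto intro: continuous_on_subset differentiable_on_subset)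

text \<open>The derivative at a point depends on the function near the point only, so being of class
\<open>C\<^sup>k\<close> is a local property.\<close>

lemma Ck_on_local:
  assumes "open S" "\<And>x. x \<in> S \<Longrightarrow> \<exists>T. open T \<and> x \<in> T \<and> T \<subseteq> S \<and> Ck_on k T f"
  shows "Ck_on k S f"
  using assms(2)
proof (induction k arbitrary: f)
  case 0
  have "continuous (at x) f" if "x \<in> S" for x
    using 0[OF that] by (auto simp: continuous_on_eq_continuous_at)
  then show ?case by (simp add: continuous_at_imp_continuous_on)
next
  case (Suc k)
  have "f differentiable at x" if "x \<in> S" for x
    using Suc.prems[OF that] by (auto simp: differentiable_on_eq_differentiable_at)
  moreover have "Ck_on k S (\<lambda>x. frechet_derivative f (at x) v)" for v
    by (rule Suc.IH) (use Suc.prems in fastforce)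
  ultimately show ?case by (simp add: assms(1) differentiable_on_eq_differentiable_at)
qed

lemma Ck_on_const: "open S \<Longrightarrow> Ck_on k S (\<lambda>x. c)"
  by (induction k arbitrary: c) auto

lemma Ck_on_linear:
  assumes "open S" "bounded_linear L"
  shows "Ck_on k S L"
proof (cases k)
  case 0
  then show ?thesis by (simp add: assms(2) linear_continuous_on)
next
  case (Suc j)
  show ?thesis unfolding Suc
    by (rule Ck_on_Suc_intro[OF assms(1), where f' = "\<lambda>x. L"])
      (auto simp: Ck_on_const assms intro: bounded_linear_imp_has_derivative)
qed

lemma Ck_on_add:
  assumes "open S" "Ck_on k S f" "Ck_on k S g"
  shows "Ck_on k S (\<lambda>x. f x + g x)"
  using assms(2,3)
proof (induction k arbitrary: f g)
  case 0
  then show ?case by (simp add: continuous_on_add)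
next
  case (Suc k)
  show ?case
    by (rule Ck_on_Suc_intro[OF assms(1)],
        rule has_derivative_add[OF Ck_on_Suc_has_derivative Ck_on_Suc_has_derivative])
      (use Suc in \<open>auto simp: assms(1)\<close>)
qed

lemma Ck_on_sum:
  assumes "open S" "\<And>i. i \<in> I \<Longrightarrow> Ck_on k S (f i)"
  shows "Ck_on k S (\<lambda>x. \<Sum>i\<in>I. f i x)"
  using assms(2) by (induction I rule: infinite_finite_induct) (auto simp: Ck_on_const Ck_on_add assms(1))

lemma Ck_on_scaleR:
  fixes f :: "'a::real_normed_vector \<Rightarrow> real"
  assumes "open S" "Ck_on k S f" "Ck_on k S g"
  shows "Ck_on k S (\<lambda>x. f x *\<^sub>R g x)"
  using assms(2,3)
proof (induction k arbitrary: f g)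
  case 0
  then show ?case by (simp add: continuous_on_scaleR)
next
  case (Suc k)
  note lower = Suc.prems[THEN Ck_on_Suc_imp]
  show ?case
    by (rule Ck_on_Suc_intro[OF assms(1)],
        rule has_derivative_scaleR[OF Ck_on_Suc_has_derivative Ck_on_Suc_has_derivative])
      (use Suc lower in \<open>auto intro!: Ck_on_add simp: assms(1)\<close>)
qed

lemma Ck_on_bounded_linear:
  assumes "open S" "bounded_linear L" "Ck_on k S f"
  shows "Ck_on k S (\<lambda>x. L (f x))"
  using assms(3)
proof (induction k arbitrary: f)
  case 0
  then show ?case using assms(2) by (simp add: bounded_linear.continuous_on)
next
  case (Suc k)
  show ?case
    by (rule Ck_on_Suc_intro[OF assms(1)],
        rule bounded_linear.has_derivative[OF assms(2) Ck_on_Suc_has_derivative])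
      (use Suc in \<open>auto simp: assms(1)\<close>)
qed

text \<open>By the chain rule, a directional derivative of \<open>f \<circ> g\<close> is the sum over the basis of products
of a component of a derivative of \<open>g\<close> and a partial derivative of \<open>f\<close> along \<open>g\<close>. The partial
derivatives are composites of class one less, to which the induction hypothesis applies.\<close>

lemma Ck_on_compose:
  fixes g :: "'a::real_normed_vector \<Rightarrow> 'b::euclidean_space"
  assumes "open S" "open T" "g ` S \<subseteq> T" "Ck_on k S g" "Ck_on k T f"
  shows "Ck_on k S (\<lambda>x. f (g x))"
  using assms(4,5)
proof (induction k arbitrary: f)
  case 0
  then show ?case using assms(3) continuous_on_compose2 by auto
next
  case (Suc k)
  have "Ck_on k S (\<lambda>x. \<Sum>b\<in>Basis. (frechet_derivative g (at x) v \<bullet> b) *\<^sub>R frechet_derivative f (at (g x)) b)" for v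
    by (intro Ck_on_sum Ck_on_scaleR Suc.IH assms(1)
          Ck_on_bounded_linear[OF assms(1) bounded_linear_inner_left])
      (use Suc.prems in \<open>auto intro: Ck_on_Suc_imp\<close>)
  moreover have "(\<Sum>b\<in>Basis. (frechet_derivative g (at x) v \<bullet> b) *\<^sub>R frechet_derivative f (at (g x)) b)
      = frechet_derivative f (at (g x)) (frechet_derivative g (at x) v)" if "x \<in> S" for x v
  proof -
    have "linear (frechet_derivative f (at (g x)))"
      using Ck_on_Suc_has_derivative[OF assms(2) Suc.prems(2)] assms(3) that has_derivative_linear by blast
    then show ?thesis
      by (subst (2) euclidean_representation[symmetric]) (simp add: linear_sum linear_cmul)
  qed
  ultimately have "Ck_on k S (\<lambda>x. frechet_derivative f (at (g x)) (frechet_derivative g (at x) v))" for v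
    using Ck_on_cong[OF assms(1)] by fastforce
  moreover have "((\<lambda>x. f (g x)) has_derivative
      (\<lambda>v. frechet_derivative f (at (g x)) (frechet_derivative g (at x) v))) (at x)" if "x \<in> S" for x
    using diff_chain_at[OF Ck_on_Suc_has_derivative[OF assms(1) Suc.prems(1) that]
        Ck_on_Suc_has_derivative[OF assms(2) Suc.prems(2)]] assms(3) that
    by (auto simp: o_def)
  ultimately show ?case
    by (intro Ck_on_Suc_intro[OF assms(1)])
qed

lemma Ck_on_inverse:
  fixes f :: "'a::real_normed_vector \<Rightarrow> real"
  assumes "open S" "Ck_on k S f" "\<And>x. x \<in> S \<Longrightarrow> f x \<noteq> 0"
  shows "Ck_on k S (\<lambda>x. inverse (f x))"
  using assms(2)
proof (induction k)
  case 0
  then show ?case using assms by (simp add: continuous_on_inverse)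
next
  case (Suc k)
  have i: "Ck_on k S (\<lambda>x. inverse (f x))"
    using Suc Ck_on_Suc_imp by blast
  have "Ck_on k S (\<lambda>x. (- 1) *\<^sub>R (inverse (f x) *\<^sub>R (frechet_derivative f (at x) v *\<^sub>R inverse (f x))))" for v
    by (intro Ck_on_scaleR i Ck_on_const assms(1)) (use Suc.prems in auto)
  then have "Ck_on k S (\<lambda>x. - (inverse (f x) * frechet_derivative f (at x) v * inverse (f x)))" for v
    by (simp add: mult.assoc)
  moreover have "((\<lambda>x. inverse (f x)) has_derivative
      (\<lambda>v. - (inverse (f x) * frechet_derivative f (at x) v * inverse (f x)))) (at x)" if "x \<in> S" for x
    using Deriv.has_derivative_inverse[OF assms(3)[OF that] Ck_on_Suc_has_derivative[OF assms(1) Suc.prems that]] .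
  ultimately show ?case
    by (intro Ck_on_Suc_intro[OF assms(1)])
qed

lemma smooth_on_cong:
  "open S \<Longrightarrow> smooth_on S f \<Longrightarrow> (\<And>x. x \<in> S \<Longrightarrow> f x = g x) \<Longrightarrow> smooth_on S g"
  unfolding smooth_on_def using Ck_on_cong by blast

lemma smooth_on_subset: "smooth_on S f \<Longrightarrow> T \<subseteq> S \<Longrightarrow> smooth_on T f"
  unfolding smooth_on_def using Ck_on_subset by blast

lemma smooth_on_local:
  assumes "open S" "\<And>x. x \<in> S \<Longrightarrow> \<exists>T. open T \<and> x \<in> T \<and> T \<subseteq> S \<and> smooth_on T f"
  shows "smooth_on S f"
  unfolding smooth_on_def
proof
  fix k show "Ck_on k S f"
    by (rule Ck_on_local[OF assms(1)]) (use assms(2) in \<open>metis smooth_on_def\<close>)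
qed

lemma smooth_on_const: "open S \<Longrightarrow> smooth_on S (\<lambda>x. c)"
  unfolding smooth_on_def using Ck_on_const by blast

lemma smooth_on_linear: "open S \<Longrightarrow> bounded_linear L \<Longrightarrow> smooth_on S L"
  unfolding smooth_on_def using Ck_on_linear by blast

lemma smooth_on_add:
  "open S \<Longrightarrow> smooth_on S f \<Longrightarrow> smooth_on S g \<Longrightarrow> smooth_on S (\<lambda>x. f x + g x)"
  unfolding smooth_on_def using Ck_on_add by blast

lemma smooth_on_mult:
  fixes f :: "'a::real_normed_vector \<Rightarrow> real"
  shows "open S \<Longrightarrow> smooth_on S f \<Longrightarrow> smooth_on S g \<Longrightarrow> smooth_on S (\<lambda>x. f x * g x)"
  unfolding smooth_on_def using Ck_on_scaleR[of S _ f g] by simp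

lemma smooth_on_bounded_linear:
  "open S \<Longrightarrow> bounded_linear L \<Longrightarrow> smooth_on S f \<Longrightarrow> smooth_on S (\<lambda>x. L (f x))"
  unfolding smooth_on_def using Ck_on_bounded_linear by blast

lemma smooth_on_compose:
  fixes g :: "'a::real_normed_vector \<Rightarrow> 'b::euclidean_space"
  shows "open S \<Longrightarrow> open T \<Longrightarrow> g ` S \<subseteq> T \<Longrightarrow> smooth_on S g \<Longrightarrow> smooth_on T f \<Longrightarrow> smooth_on S (\<lambda>x. f (g x))"
  unfolding smooth_on_def using Ck_on_compose by blast

lemma smooth_on_inverse:
  fixes f :: "'a::real_normed_vector \<Rightarrow> real"
  shows "open S \<Longrightarrow> smooth_on S f \<Longrightarrow> (\<And>x. x \<in> S \<Longrightarrow> f x \<noteq> 0) \<Longrightarrow> smooth_on S (\<lambda>x. inverse (f x))"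
  unfolding smooth_on_def using Ck_on_inverse by blast

lemma smooth_on_has_derivative:
  "open S \<Longrightarrow> smooth_on S f \<Longrightarrow> x \<in> S \<Longrightarrow> (f has_derivative frechet_derivative f (at x)) (at x)"
  unfolding smooth_on_def using Ck_on_Suc_has_derivative by blast

lemma smooth_on_derivative:
  "smooth_on S f \<Longrightarrow> smooth_on S (\<lambda>x. frechet_derivative f (at x) v)"
  unfolding smooth_on_def by (metis Ck_on.simps(2))

lemma smooth_on_imp_continuous_on: "smooth_on S f \<Longrightarrow> continuous_on S f"
  unfolding smooth_on_def using Ck_on_imp_continuous_on by blast

section \<open>Bump functions\<close>

text \<open>The functions \<open>t\<^sup>-\<^sup>n exp (- 1/t)\<close>, extended by zero to the left. The derivative of one of
them is a combination of two others, so the whole family is treated at once.\<close>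

definition flat_exp :: "nat \<Rightarrow> real \<Rightarrow> real" where
  "flat_exp n t = (if t > 0 then inverse t ^ n * exp (- inverse t) else 0)"

lemma flat_exp_tendsto: "((\<lambda>t. flat_exp n t) \<longlongrightarrow> 0) (at 0)"
proof -
  have "((\<lambda>u::real. u ^ n / exp u) \<longlongrightarrow> 0) at_top"
    by (rule tendsto_power_div_exp_0)
  then have "((\<lambda>t::real. inverse t ^ n / exp (inverse t)) \<longlongrightarrow> 0) (at_right 0)"
    by (rule filterlim_compose) (rule filterlim_inverse_at_top_right)
  then have "((\<lambda>t. flat_exp n t) \<longlongrightarrow> 0) (at_right 0)"
    by (rule Lim_transform_eventually)
      (auto simp: flat_exp_def exp_minus divide_inverse eventually_at_right_less eventually_at_filter)
  moreover have "((\<lambda>t. flat_exp n t) \<longlongrightarrow> 0) (at_left 0)"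
    by (rule tendsto_eventually) (auto simp: flat_exp_def eventually_at_filter)
  ultimately show ?thesis by (simp add: filterlim_split_at)
qed

text \<open>At the origin, the difference quotient of one member of the family is the next member, which
tends to zero.\<close>

lemma flat_exp_has_derivative:
  "(flat_exp n has_real_derivative (flat_exp (n + 2) t - n * flat_exp (n + 1) t)) (at t)"
proof -
  consider "t > 0" | "t < 0" | "t = 0" by linarith
  then show ?thesis
  proof cases
    case 1
    have "((\<lambda>t. inverse t ^ n * exp (- inverse t)) has_real_derivative
        (flat_exp (n + 2) t - n * flat_exp (n + 1) t)) (at t)"
    proof -
      have "n * inverse t ^ (n - 1) * (inverse t)\<^sup>2 = n * inverse t ^ (n + 1)"
        by (cases n) (auto simp: power2_eq_square)
      then show ?thesis
        using 1 by (auto intro!: derivative_eq_intros simp: flat_exp_def power2_eq_square algebra_simps)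
    qed
    then show ?thesis
      by (rule has_field_derivative_transform_within_open[of _ _ _ "{0<..}"])
        (use 1 in \<open>auto simp: flat_exp_def\<close>)
  next
    case 2
    have "((\<lambda>t. 0) has_real_derivative (flat_exp (n + 2) t - n * flat_exp (n + 1) t)) (at t)"
      using 2 by (auto simp: flat_exp_def)
    then show ?thesis
      by (rule has_field_derivative_transform_within_open[of _ _ _ "{..<0}"])
        (use 2 in \<open>auto simp: flat_exp_def\<close>)
  next
    case 3
    have "((\<lambda>h. (flat_exp n (0 + h) - flat_exp n 0) / h) \<longlongrightarrow> 0) (at 0)"
      by (rule Lim_transform_eventually[OF flat_exp_tendsto[of "Suc n"]])
        (auto simp: flat_exp_def eventually_at_filter divide_inverse)
    then show ?thesis using 3 by (auto simp: DERIV_def flat_exp_def)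
  qed
qed

lemma smooth_on_flat_exp: "smooth_on UNIV (flat_exp n)"
proof -
  have "Ck_on k UNIV (flat_exp n)" for k
  proof (induction k arbitrary: n)
    case 0
    show ?case
      using DERIV_isCont[OF flat_exp_has_derivative] by (simp add: continuous_on_eq_continuous_at)
  next
    case (Suc k)
    show ?case
    proof (rule Ck_on_Suc_intro)
      show "(flat_exp n has_derivative (*) (flat_exp (n + 2) t - n * flat_exp (n + 1) t)) (at t)" for t
        using flat_exp_has_derivative by (simp add: has_field_derivative_def)
      have "Ck_on k UNIV (\<lambda>x. v *\<^sub>R (flat_exp (n + 2) x + (- real n) *\<^sub>R flat_exp (n + 1) x))" for v
        by (intro Ck_on_scaleR Ck_on_add Suc Ck_on_const open_UNIV)
      then show "Ck_on k UNIV (\<lambda>x. (flat_exp (n + 2) x - n * flat_exp (n + 1) x) * v)" for v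
        by (simp add: mult.commute)
    qed simp
  qed
  then show ?thesis by (simp add: smooth_on_def)
qed

lemma flat_exp_0_pos: "t > 0 \<Longrightarrow> flat_exp 0 t > 0"
  and flat_exp_0_zero: "t \<le> 0 \<Longrightarrow> flat_exp 0 t = 0"
  and flat_exp_0_nonneg: "flat_exp 0 t \<ge> 0"
  by (auto simp: flat_exp_def)

text \<open>The quotient \<open>u / (u + w)\<close>, where \<open>u\<close> is positive exactly inside the ball of radius \<open>r\<close> and
\<open>w\<close> exactly outside the closed ball of radius \<open>r/2\<close>.\<close>

lemma smooth_bump:
  fixes x :: "'a::euclidean_space"
  assumes "r > 0"
  shows "\<exists>b :: 'a \<Rightarrow> real. smooth_on UNIV b \<and> (\<forall>y\<in>ball x (r/2). b y = 1) \<and> (\<forall>y. y \<notin> ball x r \<longrightarrow> b y = 0)"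
proof -
  define d where "d y = (y - x) \<bullet> (y - x)" for y
  have d: "d y = (dist x y)\<^sup>2" for y
    by (simp add: d_def dist_norm norm_minus_commute[of x y] power2_norm_eq_inner)
  have sd: "smooth_on UNIV d"
  proof -
    have "smooth_on UNIV (\<lambda>y. \<Sum>i\<in>Basis. ((y - x) \<bullet> i) * ((y - x) \<bullet> i))"
      unfolding smooth_on_def
    proof (intro allI Ck_on_sum)
      fix k and i :: 'a
      have "Ck_on k UNIV (\<lambda>y. y \<bullet> i + (- (x \<bullet> i)))"
        by (intro Ck_on_add Ck_on_const Ck_on_linear bounded_linear_inner_left open_UNIV)
      then have "Ck_on k UNIV (\<lambda>y. (y - x) \<bullet> i)" by (simp add: inner_diff_left)
      then show "Ck_on k UNIV (\<lambda>y. ((y - x) \<bullet> i) * ((y - x) \<bullet> i))"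
        using Ck_on_scaleR[OF open_UNIV, of k "\<lambda>y. (y - x) \<bullet> i" "\<lambda>y. (y - x) \<bullet> i"] by simp
    qed simp
    moreover have "(\<lambda>y. \<Sum>i\<in>Basis. ((y - x) \<bullet> i) * ((y - x) \<bullet> i)) = d"
      by (rule ext) (simp only: d_def euclidean_inner[symmetric])
    ultimately show ?thesis by simp
  qed
  define u where "u y = flat_exp 0 (r\<^sup>2 + (-1) * d y)" for y
  define w where "w y = flat_exp 0 (d y + (- (r/2)\<^sup>2))" for y
  have su: "smooth_on UNIV u" unfolding u_def[abs_def]
    by (rule smooth_on_compose[OF open_UNIV open_UNIV _ _ smooth_on_flat_exp],
        simp, intro smooth_on_add smooth_on_mult smooth_on_const sd open_UNIV)
  have sw: "smooth_on UNIV w" unfolding w_def[abs_def]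
    by (rule smooth_on_compose[OF open_UNIV open_UNIV _ _ smooth_on_flat_exp],
        simp, intro smooth_on_add smooth_on_mult smooth_on_const sd open_UNIV)
  have pos: "u y + w y > 0" for y
  proof -
    have "(r/2)\<^sup>2 < r\<^sup>2" using assms by (simp add: power_strict_mono)
    then consider "0 < r\<^sup>2 + (-1) * d y" | "0 < d y + (- (r/2)\<^sup>2)" by linarith
    then show ?thesis
    proof cases
      case 1
      from flat_exp_0_pos[OF 1] show ?thesis
        unfolding u_def w_def using flat_exp_0_nonneg by (rule add_pos_nonneg)
    next
      case 2
      from flat_exp_0_pos[OF 2] show ?thesis
        unfolding u_def w_def using flat_exp_0_nonneg by (metis add_nonneg_pos)
    qed
  qed
  define b where "b y = u y * inverse (u y + w y)" for y
  have nz: "u y + w y \<noteq> 0" for y using pos[of y] by simp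
  show ?thesis
  proof (intro exI[of _ b] conjI ballI allI impI)
    show "smooth_on UNIV b" unfolding b_def[abs_def]
      by (rule smooth_on_mult[OF open_UNIV su smooth_on_inverse[OF open_UNIV smooth_on_add[OF open_UNIV su sw] nz]])
    show "b y = 1" if "y \<in> ball x (r/2)" for y
    proof -
      have "d y < (r/2)\<^sup>2" unfolding d using that by (simp add: power_strict_mono)
      then have "w y = 0" by (simp add: w_def flat_exp_0_zero)
      then show ?thesis using pos[of y] by (simp add: b_def)
    qed
    show "b y = 0" if "y \<notin> ball x r" for y
    proof -
      have "r\<^sup>2 \<le> d y" unfolding d using that assms by (intro power_mono) auto
      then show ?thesis by (simp add: b_def u_def flat_exp_0_zero)
    qed
  qed
qed

section \<open>Symmetry of second derivatives\<close>

text \<open>Two applications of the mean value theorem express the second difference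
\<open>f(x + h u + h v) - f(x + h u) - f(x + h v) + f(x)\<close> as \<open>h\<^sup>2\<close> times a mixed derivative at a point
near \<open>x\<close>. The second difference is symmetric in \<open>u\<close> and \<open>v\<close>, and the mixed derivatives are
continuous.\<close>

lemma smooth_on_mixed_derivatives:
  fixes f :: "'a::real_normed_vector \<Rightarrow> real"
  assumes "open S" "smooth_on S f" "x \<in> S"
  shows "frechet_derivative (\<lambda>y. frechet_derivative f (at y) u) (at x) v =
         frechet_derivative (\<lambda>y. frechet_derivative f (at y) v) (at x) u"
proof -
  define d where "d a g y = frechet_derivative g (at y) a" for a and g :: "'a \<Rightarrow> real" and y
  have sd: "smooth_on S (d a g)" if "smooth_on S g" for a g
    unfolding d_def[abs_def] using that by (rule smooth_on_derivative)
  obtain e where e: "e > 0" "ball x e \<subseteq> S"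
    using assms(1,3) open_contains_ball by blast
  have line: "((\<lambda>s. g (z + s *\<^sub>R a)) has_real_derivative d a g (z + s *\<^sub>R a)) (at s)"
    if "smooth_on S g" "z + s *\<^sub>R a \<in> S" for g z a s
  proof -
    have "((\<lambda>s. z + s *\<^sub>R a) has_derivative (\<lambda>t. t *\<^sub>R a)) (at s)"
      by (auto intro!: derivative_eq_intros)
    from diff_chain_at[OF this smooth_on_has_derivative[OF assms(1) that]]
    have "((\<lambda>s. g (z + s *\<^sub>R a)) has_derivative
        (\<lambda>t. frechet_derivative g (at (z + s *\<^sub>R a)) (t *\<^sub>R a))) (at s)"
      by (simp add: o_def)
    moreover have "linear (frechet_derivative g (at (z + s *\<^sub>R a)))"
      using smooth_on_has_derivative[OF assms(1) that] has_derivative_linear by blast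
    ultimately show ?thesis
      by (simp add: has_field_derivative_def d_def linear_cmul mult.commute[of _ "frechet_derivative _ _ _"])
  qed
  have key: "\<exists>y. dist x y < \<epsilon> \<and> f (x + h *\<^sub>R a + h *\<^sub>R c) - f (x + h *\<^sub>R a) - f (x + h *\<^sub>R c) + f x
      = h\<^sup>2 * d c (d a f) y"
    if h: "0 < h" "h * (norm a + norm c) < \<epsilon>" "\<epsilon> \<le> e" for h \<epsilon> a c
  proof -
    have near: "dist x (x + s *\<^sub>R a + t *\<^sub>R c) < \<epsilon>" if "0 \<le> s" "s \<le> h" "0 \<le> t" "t \<le> h" for s t
    proof -
      have "norm (s *\<^sub>R a + t *\<^sub>R c) \<le> s * norm a + t * norm c"
        using that norm_triangle_ineq[of "s *\<^sub>R a" "t *\<^sub>R c"] by simp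
      also have "\<dots> \<le> h * norm a + h * norm c"
        using that by (intro add_mono mult_right_mono) auto
      also have "\<dots> < \<epsilon>" using h by (simp add: distrib_left)
      finally have "norm (s *\<^sub>R a + t *\<^sub>R c) < \<epsilon>" .
      moreover have "x - (x + s *\<^sub>R a + t *\<^sub>R c) = - (s *\<^sub>R a + t *\<^sub>R c)" by simp
      ultimately show ?thesis by (metis dist_norm norm_minus_cancel)
    qed
    have inS: "x + s *\<^sub>R a + t *\<^sub>R c \<in> S" if "0 \<le> s" "s \<le> h" "0 \<le> t" "t \<le> h" for s t
      using near[OF that] e(2) h(3) by (auto simp: subset_iff)
    have inS0: "x + s *\<^sub>R a \<in> S" if "0 \<le> s" "s \<le> h" for s
      using inS[of s 0] that h by simp
    define \<phi> where "\<phi> s = f (x + h *\<^sub>R c + s *\<^sub>R a) - f (x + s *\<^sub>R a)" for s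
    have "(\<phi> has_real_derivative d a f (x + h *\<^sub>R c + s *\<^sub>R a) - d a f (x + s *\<^sub>R a)) (at s)"
      if "0 \<le> s" "s \<le> h" for s
      unfolding \<phi>_def using inS[of s h] inS0[of s] that h
      by (intro DERIV_diff line assms(2)) (auto simp: algebra_simps)
    then obtain s where s: "0 < s" "s < h" "\<phi> h - \<phi> 0 =
        (h - 0) * (d a f (x + h *\<^sub>R c + s *\<^sub>R a) - d a f (x + s *\<^sub>R a))"
      using MVT2[OF h(1), of \<phi> "\<lambda>s. d a f (x + h *\<^sub>R c + s *\<^sub>R a) - d a f (x + s *\<^sub>R a)"] by metis
    have "((\<lambda>t. d a f (x + s *\<^sub>R a + t *\<^sub>R c)) has_real_derivative
        d c (d a f) (x + s *\<^sub>R a + t *\<^sub>R c)) (at t)" if "0 \<le> t" "t \<le> h" for t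
      using inS[of s t] that s by (intro line sd assms(2)) auto
    then obtain t where t: "0 < t" "t < h" "d a f (x + s *\<^sub>R a + h *\<^sub>R c) - d a f (x + s *\<^sub>R a + 0 *\<^sub>R c)
        = (h - 0) * d c (d a f) (x + s *\<^sub>R a + t *\<^sub>R c)"
      using MVT2[OF h(1), of "\<lambda>t. d a f (x + s *\<^sub>R a + t *\<^sub>R c)"
          "\<lambda>t. d c (d a f) (x + s *\<^sub>R a + t *\<^sub>R c)"] by metis
    have "f (x + h *\<^sub>R a + h *\<^sub>R c) - f (x + h *\<^sub>R a) - f (x + h *\<^sub>R c) + f x = \<phi> h - \<phi> 0"
      by (simp add: \<phi>_def algebra_simps)
    also have "\<dots> = h\<^sup>2 * d c (d a f) (x + s *\<^sub>R a + t *\<^sub>R c)"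
      using s(3) t(3) by (simp add: power2_eq_square algebra_simps)
    finally show ?thesis using near[of s t] s t by auto
  qed
  have cont: "continuous (at x) (d c (d a f))" for a c
    using smooth_on_imp_continuous_on[OF sd[OF sd[OF assms(2)]]] assms(1,3)
    by (simp add: continuous_on_eq_continuous_at)
  have "\<bar>d v (d u f) x - d u (d v f) x\<bar> < \<delta>" if "\<delta> > 0" for \<delta>
  proof -
    have "\<delta>/2 > 0" using that by simp
    obtain e1 where e1: "e1 > 0" "\<And>y. dist y x < e1 \<Longrightarrow> dist (d v (d u f) y) (d v (d u f) x) < \<delta>/2"
      using cont[unfolded continuous_at_eps_delta] \<open>\<delta>/2 > 0\<close> by meson
    obtain e2 where e2: "e2 > 0" "\<And>y. dist y x < e2 \<Longrightarrow> dist (d u (d v f) y) (d u (d v f) x) < \<delta>/2"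
      using cont[unfolded continuous_at_eps_delta] \<open>\<delta>/2 > 0\<close> by meson
    define \<epsilon> where "\<epsilon> = min e (min e1 e2)"
    have "\<epsilon> > 0" using e e1 e2 by (simp add: \<epsilon>_def)
    define h where "h = \<epsilon> / (norm u + norm v + 1)"
    have n: "norm u + norm v + 1 > 0" by (smt (verit) norm_ge_zero)
    have h: "h > 0" using \<open>\<epsilon> > 0\<close> n by (simp add: h_def)
    have "h * (norm u + norm v) < \<epsilon>"
    proof -
      have "h * (norm u + norm v) < h * (norm u + norm v + 1)" using h by simp
      also have "\<dots> = \<epsilon>" using n by (simp add: h_def)
      finally show ?thesis .
    qed
    then obtain y z where y: "dist x y < \<epsilon>" "f (x + h *\<^sub>R u + h *\<^sub>R v) - f (x + h *\<^sub>R u) - f (x + h *\<^sub>R v) + f x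
        = h\<^sup>2 * d v (d u f) y"
      and z: "dist x z < \<epsilon>" "f (x + h *\<^sub>R v + h *\<^sub>R u) - f (x + h *\<^sub>R v) - f (x + h *\<^sub>R u) + f x
        = h\<^sup>2 * d u (d v f) z"
      using key[OF h, of u v \<epsilon>] key[OF h, of v u \<epsilon>] by (auto simp: \<epsilon>_def add.commute)
    have "h\<^sup>2 * d v (d u f) y = h\<^sup>2 * d u (d v f) z"
      using y(2) z(2) by (simp add: algebra_simps)
    then have "d v (d u f) y = d u (d v f) z" using h by simp
    moreover have "dist (d v (d u f) y) (d v (d u f) x) < \<delta>/2" "dist (d u (d v f) z) (d u (d v f) x) < \<delta>/2"
      using y(1) z(1) e1(2)[of y] e2(2)[of z] by (simp_all only: \<epsilon>_def dist_commute[of x] min_less_iff_conj)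
    ultimately show ?thesis unfolding dist_real_def by linarith
  qed
  from this[of "\<bar>d v (d u f) x - d u (d v f) x\<bar>"] have "d v (d u f) x = d u (d v f) x"
    by (cases "d v (d u f) x = d u (d v f) x") simp_all
  then show ?thesis by (simp add: d_def[abs_def])
qed

section \<open>Smooth functions on a manifold\<close>

locale smooth_manifold =
  fixes A :: "('m::{t2_space,second_countable_topology}, 'e::euclidean_space) chart set"
  assumes atlas: "smooth_atlas A"
begin

abbreviation "C \<equiv> smooth_funs A"
abbreviation "T \<equiv> tangent_space A"

lemma chart:
  assumes "(U, \<phi>) \<in> A"
  shows "open U" "open (\<phi> ` U)" "homeomorphism U (\<phi> ` U) \<phi> (inv_into U \<phi>)"
    "q \<in> U \<Longrightarrow> inv_into U \<phi> (\<phi> q) = q"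
proof -
  have "is_chart (U, \<phi>)" using atlas assms unfolding smooth_atlas_def by blast
  then show "open U" "open (\<phi> ` U)" and h: "homeomorphism U (\<phi> ` U) \<phi> (inv_into U \<phi>)"
    by (simp_all add: is_chart_def)
  show "q \<in> U \<Longrightarrow> inv_into U \<phi> (\<phi> q) = q"
    using homeomorphism_apply1[OF h] .
qed

lemma chart_at: obtains U \<phi> where "(U, \<phi>) \<in> A" "p \<in> U"
proof -
  have "p \<in> (\<Union>\<kappa>\<in>A. fst \<kappa>)" using atlas by (simp add: smooth_atlas_def)
  then obtain \<kappa> where "\<kappa> \<in> A" "p \<in> fst \<kappa>" by blast
  then show ?thesis using that[of "fst \<kappa>" "snd \<kappa>"] by simp
qed

lemma chart_transition:
  "(U, \<phi>) \<in> A \<Longrightarrow> (V, \<psi>) \<in> A \<Longrightarrow> smooth_on (\<phi> ` (U \<inter> V)) (\<psi> \<circ> inv_into U \<phi>)"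
  using atlas unfolding smooth_atlas_def by fast

lemma chart_image_open:
  assumes "(U, \<phi>) \<in> A" "open W" "W \<subseteq> U"
  shows "open (\<phi> ` W)"
proof -
  have "openin (top_of_set U) W" using assms chart(1) by (simp add: openin_open_eq)
  then have "openin (top_of_set (\<phi> ` U)) (\<phi> ` W)"
    using homeomorphism_imp_open_map[OF chart(3)[OF assms(1)]] by blast
  then show ?thesis using chart(2)[OF assms(1)] openin_open_trans by blast
qed

lemma chart_continuous: "(U, \<phi>) \<in> A \<Longrightarrow> continuous_on U \<phi>"
  and chart_inv_continuous: "(U, \<phi>) \<in> A \<Longrightarrow> continuous_on (\<phi> ` U) (inv_into U \<phi>)"
  using chart(3) by (auto simp: homeomorphism_def)

lemma smooth_funs_chart: "F \<in> C \<Longrightarrow> (U, \<phi>) \<in> A \<Longrightarrow> smooth_on (\<phi> ` U) (F \<circ> inv_into U \<phi>)"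
  unfolding smooth_funs_def by blast

text \<open>Transition maps are smooth, so smoothness near a point needs to be checked in one chart
only, not in every chart of the atlas.\<close>

lemma smooth_funsI_chart_at:
  assumes "\<And>p. \<exists>U \<phi> W. (U, \<phi>) \<in> A \<and> open W \<and> p \<in> W \<and> W \<subseteq> U \<and> smooth_on (\<phi> ` W) (F \<circ> inv_into U \<phi>)"
  shows "F \<in> C"
proof -
  have "smooth_on (\<psi> ` V) (F \<circ> inv_into V \<psi>)" if V: "(V, \<psi>) \<in> A" for V \<psi>
  proof (rule smooth_on_local[OF chart(2)[OF V]])
    fix y assume "y \<in> \<psi> ` V"
    then obtain p where p: "p \<in> V" "y = \<psi> p" by auto
    obtain U \<phi> W where U: "(U, \<phi>) \<in> A" "open W" "p \<in> W" "W \<subseteq> U"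
      and s: "smooth_on (\<phi> ` W) (F \<circ> inv_into U \<phi>)"
      using assms[of p] by auto
    have o: "open (\<psi> ` (V \<inter> W))" "open (\<phi> ` W)"
      using chart_image_open[OF V open_Int[OF chart(1)[OF V] U(2)]] chart_image_open[OF U(1,2,4)] by auto
    have "smooth_on (\<psi> ` (V \<inter> W)) (\<lambda>y. (F \<circ> inv_into U \<phi>) ((\<phi> \<circ> inv_into V \<psi>) y))"
    proof (rule smooth_on_compose[OF o _ _ s])
      show "(\<phi> \<circ> inv_into V \<psi>) ` \<psi> ` (V \<inter> W) \<subseteq> \<phi> ` W"
        using chart(4)[OF V] by auto
      show "smooth_on (\<psi> ` (V \<inter> W)) (\<phi> \<circ> inv_into V \<psi>)"
        using chart_transition[OF V U(1)] by (rule smooth_on_subset) (use U in auto)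
    qed
    then have "smooth_on (\<psi> ` (V \<inter> W)) (F \<circ> inv_into V \<psi>)"
      by (rule smooth_on_cong[OF o(1)]) (use U chart(4)[OF V] chart(4)[OF U(1)] in auto)
    then show "\<exists>T. open T \<and> y \<in> T \<and> T \<subseteq> \<psi> ` V \<and> smooth_on T (F \<circ> inv_into V \<psi>)"
      using o p U by blast
  qed
  then show ?thesis by (auto simp: smooth_funs_def)
qed

lemma smooth_funs_local:
  assumes "\<And>p. \<exists>W G. open W \<and> p \<in> W \<and> G \<in> C \<and> (\<forall>q\<in>W. F q = G q)"
  shows "F \<in> C"
proof (rule smooth_funsI_chart_at)
  fix p
  obtain W G where W: "open W" "p \<in> W" "G \<in> C" "\<And>q. q \<in> W \<Longrightarrow> F q = G q"
    using assms[of p] by auto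
  obtain U \<phi> where U: "(U, \<phi>) \<in> A" "p \<in> U" by (rule chart_at)
  have o: "open (W \<inter> U)" "open (\<phi> ` (W \<inter> U))"
    using chart_image_open[OF U(1) open_Int[OF W(1) chart(1)[OF U(1)]]] open_Int[OF W(1) chart(1)[OF U(1)]]
    by auto
  have "smooth_on (\<phi> ` (W \<inter> U)) (G \<circ> inv_into U \<phi>)"
    using smooth_funs_chart[OF W(3) U(1)] by (rule smooth_on_subset) auto
  then have "smooth_on (\<phi> ` (W \<inter> U)) (F \<circ> inv_into U \<phi>)"
    by (rule smooth_on_cong[OF o(2)]) (use W(4) chart(4)[OF U(1)] in auto)
  then show "\<exists>U \<phi> W. (U, \<phi>) \<in> A \<and> open W \<and> p \<in> W \<and> W \<subseteq> U \<and> smooth_on (\<phi> ` W) (F \<circ> inv_into U \<phi>)"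
    using o U W by blast
qed

lemma smooth_const: "(\<lambda>_. c) \<in> C"
  by (auto simp: smooth_funs_def o_def intro!: smooth_on_const chart(2))

lemma smooth_add: "F \<in> C \<Longrightarrow> G \<in> C \<Longrightarrow> (\<lambda>p. F p + G p) \<in> C"
  using smooth_on_add[OF chart(2)] by (fastforce simp: smooth_funs_def o_def)

lemma smooth_mult: "F \<in> C \<Longrightarrow> G \<in> C \<Longrightarrow> (\<lambda>p. F p * G p) \<in> C"
  using smooth_on_mult[OF chart(2)] by (fastforce simp: smooth_funs_def o_def)

lemma smooth_uminus: "F \<in> C \<Longrightarrow> (\<lambda>p. - F p) \<in> C"
  using smooth_mult[OF smooth_const[of "-1"]] by simp

lemma smooth_diff: "F \<in> C \<Longrightarrow> G \<in> C \<Longrightarrow> (\<lambda>p. F p - G p) \<in> C"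
  using smooth_add[OF _ smooth_uminus] by simp

lemma smooth_sum: "(\<And>i. i \<in> I \<Longrightarrow> F i \<in> C) \<Longrightarrow> (\<lambda>p. \<Sum>i\<in>I. F i p) \<in> C"
  by (induction I rule: infinite_finite_induct) (auto intro: smooth_const smooth_add)

lemma smooth_power: "F \<in> C \<Longrightarrow> (\<lambda>p. F p ^ n) \<in> C"
  by (induction n) (auto intro: smooth_const smooth_mult)

lemma smooth_real_compose:
  fixes h :: "real \<Rightarrow> real"
  assumes "smooth_on UNIV h" "F \<in> C"
  shows "(\<lambda>p. h (F p)) \<in> C"
  using smooth_on_compose[OF chart(2) open_UNIV _ _ assms(1)] assms(2)
  by (fastforce simp: smooth_funs_def o_def)

lemma smooth_inverse:
  assumes "F \<in> C" "\<And>p. F p \<noteq> 0"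
  shows "(\<lambda>p. inverse (F p)) \<in> C"
  using smooth_on_inverse[OF chart(2)] assms by (fastforce simp: smooth_funs_def o_def)

text \<open>The inverse of \<open>F\<close> need not be defined globally. It is obtained as \<open>F / K\<close>, where \<open>K\<close>
agrees with \<open>F\<^sup>2\<close> where \<open>F\<^sup>2\<close> is not small, and is positive everywhere because the flat
function is added where \<open>F\<^sup>2\<close> is small.\<close>

lemma smooth_local_inverse:
  assumes "F \<in> C" "F p \<noteq> 0"
  obtains G where "G \<in> C" "\<forall>\<^sub>F q in nhds p. F q * G q = 1"
proof -
  \<comment> \<open>Any threshold strictly between zero and \<open>(F p)\<^sup>2\<close> would do.\<close>
  define c where "c = (F p)\<^sup>2 / 2"
  have c: "0 < c" "c < (F p)\<^sup>2" using assms(2) by (auto simp: c_def)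
  define K where "K q = (F q)\<^sup>2 + flat_exp 0 (c - (F q)\<^sup>2)" for q
  have sq: "(\<lambda>q. (F q)\<^sup>2) \<in> C" using assms(1) by (rule smooth_power)
  have "K \<in> C" unfolding K_def[abs_def]
    by (intro smooth_add sq smooth_real_compose[OF smooth_on_flat_exp] smooth_diff smooth_const)
  moreover have "K q \<noteq> 0" for q
  proof (cases "F q = 0")
    case True
    then show ?thesis using flat_exp_0_pos[OF c(1)] by (simp add: K_def)
  next
    case False
    then have "(F q)\<^sup>2 > 0" by simp
    then show ?thesis unfolding K_def using flat_exp_0_nonneg by (metis add_pos_nonneg less_irrefl)
  qed
  ultimately have "(\<lambda>q. F q * inverse (K q)) \<in> C"
    using smooth_mult smooth_inverse assms(1) by blast
  moreover have "\<forall>\<^sub>F q in nhds p. F q * (F q * inverse (K q)) = 1"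
  proof -
    obtain U \<phi> where U: "(U, \<phi>) \<in> A" "p \<in> U" by (rule chart_at)
    have "continuous_on U (\<lambda>q. (F q)\<^sup>2)"
    proof -
      have "continuous_on U ((\<lambda>q. (F q)\<^sup>2) \<circ> inv_into U \<phi> \<circ> \<phi>)"
        by (intro continuous_on_compose chart_continuous U(1) smooth_on_imp_continuous_on smooth_funs_chart sq)
      then show ?thesis
        by (rule continuous_on_eq) (use chart(4)[OF U(1)] in auto)
    qed
    then have "isCont (\<lambda>q. (F q)\<^sup>2) p"
      using chart(1)[OF U(1)] U(2) continuous_on_eq_continuous_at by blast
    then have "((\<lambda>q. (F q)\<^sup>2) \<longlongrightarrow> (F p)\<^sup>2) (nhds p)"
      using tendsto_at_iff_tendsto_nhds[of "\<lambda>q. (F q)\<^sup>2" p] by (simp add: isCont_def)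
    from order_tendstoD(1)[OF this c(2)] have "\<forall>\<^sub>F q in nhds p. c < (F q)\<^sup>2" .
    then show ?thesis
    proof eventually_elim
      case (elim q)
      then have "K q = (F q)\<^sup>2" "F q \<noteq> 0"
        using c(1) by (auto simp: K_def flat_exp_0_zero)
      then show ?case by (simp add: power2_eq_square field_simps)
    qed
  qed
  ultimately show ?thesis using that by blast
qed

text \<open>A bump function that is supported in the chart domain extends every smooth function of the
coordinates to the whole manifold. The support is the image of a closed ball, hence compact, and
hence closed as the manifold is Hausdorff; this gives smoothness at the points outside
the chart domain.\<close>

lemma bump_extension:
  assumes U: "(U, \<phi>) \<in> A" "p \<in> U"
  obtains \<beta> W where "\<beta> \<in> C" "open W" "p \<in> W" "W \<subseteq> U" "\<And>q. q \<in> W \<Longrightarrow> \<beta> q = 1" "\<And>q. q \<notin> U \<Longrightarrow> \<beta> q = 0"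
    "\<And>h. smooth_on (\<phi> ` U) h \<Longrightarrow> (\<lambda>q. if q \<in> U then \<beta> q * h (\<phi> q) else 0) \<in> C"
proof -
  obtain r where r: "r > 0" "cball (\<phi> p) r \<subseteq> \<phi> ` U"
    using open_contains_cball chart(2)[OF U(1)] U(2) by blast
  obtain b :: "'e \<Rightarrow> real" where b: "smooth_on UNIV b" "\<And>y. y \<in> ball (\<phi> p) (r/2) \<Longrightarrow> b y = 1"
    "\<And>y. y \<notin> ball (\<phi> p) r \<Longrightarrow> b y = 0"
    using smooth_bump[OF r(1), of "\<phi> p"] by blast
  define \<beta> where "\<beta> q = (if q \<in> U then b (\<phi> q) else 0)" for q
  define K where "K = inv_into U \<phi> ` cball (\<phi> p) r"
  have "compact K"
    unfolding K_def using chart_inv_continuous[OF U(1)] r(2)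
    by (intro compact_continuous_image compact_cball) (rule continuous_on_subset)
  then have K: "closed K" by (rule compact_imp_closed)
  have ext: "(\<lambda>q. if q \<in> U then \<beta> q * h (\<phi> q) else 0) \<in> C" (is "?f \<in> C") if h: "smooth_on (\<phi> ` U) h" for h
  proof (rule smooth_funsI_chart_at)
    fix q
    show "\<exists>V \<psi> W. (V, \<psi>) \<in> A \<and> open W \<and> q \<in> W \<and> W \<subseteq> V \<and> smooth_on (\<psi> ` W) (?f \<circ> inv_into V \<psi>)"
    proof (cases "q \<in> U")
      case True
      have "smooth_on (\<phi> ` U) (\<lambda>y. b y * h y)"
        using b(1) h chart(2)[OF U(1)] by (intro smooth_on_mult) (auto intro: smooth_on_subset)
      then have "smooth_on (\<phi> ` U) (?f \<circ> inv_into U \<phi>)"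
        by (rule smooth_on_cong[OF chart(2)[OF U(1)]]) (use chart(4)[OF U(1)] in \<open>auto simp: \<beta>_def\<close>)
      then show ?thesis using True U chart(1)[OF U(1)] by blast
    next
      case False
      obtain V \<psi> where V: "(V, \<psi>) \<in> A" "q \<in> V" by (rule chart_at)
      have KU: "K \<subseteq> U" using r(2) by (auto simp: K_def intro: inv_into_into)
      have o: "open (V - K)" "open (\<psi> ` (V - K))"
        using chart(1)[OF V(1)] K by (auto intro!: chart_image_open[OF V(1)] open_Diff)
      have zero: "?f z = 0" if "z \<notin> K" for z
      proof (cases "z \<in> U")
        case True
        have "\<phi> z \<notin> cball (\<phi> p) r"
          using that chart(4)[OF U(1) True] unfolding K_def by force
        then show ?thesis using b(3) by (auto simp: \<beta>_def)
      qed auto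
      have "smooth_on (\<psi> ` (V - K)) (?f \<circ> inv_into V \<psi>)"
      proof (rule smooth_on_cong[OF o(2) smooth_on_const[OF o(2)]])
        fix y assume "y \<in> \<psi> ` (V - K)"
        then obtain z where z: "z \<in> V" "z \<notin> K" "y = \<psi> z" by auto
        then show "0 = (?f \<circ> inv_into V \<psi>) y" unfolding o_def using zero[OF z(2)] chart(4)[OF V(1) z(1)] by metis
      qed
      then show ?thesis using V o KU False by blast
    qed
  qed
  define W where "W = U \<inter> \<phi> -` ball (\<phi> p) (r/2)"
  have "open W" unfolding W_def
    using chart_continuous[OF U(1)] chart(1)[OF U(1)] by (metis continuous_on_open_vimage Int_commute open_ball)
  moreover have "\<beta> \<in> C"
  proof -
    have "(\<lambda>q. if q \<in> U then \<beta> q * 1 else 0) = \<beta>" by (auto simp: \<beta>_def)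
    then show ?thesis using ext[OF smooth_on_const[OF chart(2)[OF U(1)]], of 1] by simp
  qed
  moreover have "p \<in> W" using U r by (simp add: W_def)
  ultimately show ?thesis
    using that[of \<beta> W] ext b(2) by (auto simp: W_def \<beta>_def)
qed

section \<open>Tangent vectors and coordinate frames\<close>

text \<open>The tangent vector with coordinates \<open>w\<close> in a chart: the directional derivative along \<open>w\<close>.\<close>

definition chart_vec :: "'m set \<Rightarrow> ('m \<Rightarrow> 'e) \<Rightarrow> 'm \<Rightarrow> 'e \<Rightarrow> 'm tvec" where
  "chart_vec U \<phi> p w = (\<lambda>F. if F \<in> C then frechet_derivative (F \<circ> inv_into U \<phi>) (at (\<phi> p)) w else 0)"

lemma smooth_funs_has_derivative:
  assumes "F \<in> C" "(U, \<phi>) \<in> A" "p \<in> U"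
  shows "((F \<circ> inv_into U \<phi>) has_derivative frechet_derivative (F \<circ> inv_into U \<phi>) (at (\<phi> p))) (at (\<phi> p))"
  using smooth_on_has_derivative[OF chart(2) smooth_funs_chart] assms by blast

text \<open>The velocity of a curve is the directional derivative along the derivative of the curve in
the chart, by the chain rule. Conversely, a directional derivative is the velocity of the curve
that is a straight line in the chart. It follows that tangent spaces are vector spaces.\<close>

lemma tangent_space_chart:
  assumes U: "(U, \<phi>) \<in> A" "p \<in> U"
  shows "T p = range (chart_vec U \<phi> p)"
proof (intro set_eqI iffI)
  fix v assume "v \<in> T p"
  then obtain \<gamma> \<epsilon> where v: "v = velocity A \<gamma>" and g: "\<gamma> 0 = p" "\<epsilon> > 0" "smooth_curve A {-\<epsilon><..<\<epsilon>} \<gamma>"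
    by (auto simp: tangent_space_def)
  define S where "S = {t \<in> {-\<epsilon><..<\<epsilon>}. \<gamma> t \<in> U}"
  have "S = \<gamma> -` U \<inter> {-\<epsilon><..<\<epsilon>}" by (auto simp: S_def)
  moreover have "continuous_on {-\<epsilon><..<\<epsilon>} \<gamma>" using g by (simp add: smooth_curve_def)
  ultimately have S: "open S"
    using chart(1)[OF U(1)] by (metis continuous_on_open_vimage open_greaterThanLessThan)
  have 0: "0 \<in> S" using g U by (simp add: S_def)
  have "smooth_on S (\<phi> \<circ> \<gamma>)"
    using g(3) U(1) by (auto simp: smooth_curve_def S_def)
  from smooth_on_has_derivative[OF S this 0]
  have d: "((\<phi> \<circ> \<gamma>) has_derivative frechet_derivative (\<phi> \<circ> \<gamma>) (at 0)) (at 0)" .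
  define w where "w = frechet_derivative (\<phi> \<circ> \<gamma>) (at 0) 1"
  have w: "frechet_derivative (\<phi> \<circ> \<gamma>) (at 0) t = t *\<^sub>R w" for t
    using linear_cmul[OF has_derivative_linear[OF d], of t 1] by (simp add: w_def)
  have "deriv (\<lambda>t. F (\<gamma> t)) 0 = frechet_derivative (F \<circ> inv_into U \<phi>) (at (\<phi> p)) w" if F: "F \<in> C" for F
  proof -
    let ?D = "frechet_derivative (F \<circ> inv_into U \<phi>) (at (\<phi> p))"
    have D: "((F \<circ> inv_into U \<phi>) has_derivative ?D) (at ((\<phi> \<circ> \<gamma>) 0))"
      using smooth_funs_has_derivative[OF F U] g by simp
    have "((\<lambda>t. (F \<circ> inv_into U \<phi>) ((\<phi> \<circ> \<gamma>) t)) has_derivative (\<lambda>t. ?D (t *\<^sub>R w))) (at 0)"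
      using diff_chain_at[OF d D] w by (simp add: o_def)
    then have "((\<lambda>t. F (\<gamma> t)) has_derivative (\<lambda>t. ?D (t *\<^sub>R w))) (at 0)"
      by (rule has_derivative_transform_within_open[OF _ S 0]) (use chart(4)[OF U(1)] in \<open>auto simp: S_def\<close>)
    moreover have "(\<lambda>t. ?D (t *\<^sub>R w)) = (*) (?D w)"
      using linear_cmul[OF has_derivative_linear[OF D]] by auto
    ultimately show ?thesis by (metis DERIV_imp_deriv has_field_derivative_def)
  qed
  then show "v \<in> range (chart_vec U \<phi> p)" by (auto simp: v velocity_def chart_vec_def fun_eq_iff)
next
  fix v assume "v \<in> range (chart_vec U \<phi> p)"
  then obtain w where v: "v = chart_vec U \<phi> p w" by auto
  obtain r where r: "r > 0" "ball (\<phi> p) r \<subseteq> \<phi> ` U"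
    using open_contains_ball chart(2)[OF U(1)] U(2) by blast
  define \<epsilon> where "\<epsilon> = r / (norm w + 1)"
  have n: "norm w + 1 > 0" by (simp add: add_nonneg_pos)
  have e: "\<epsilon> > 0" using r n by (simp add: \<epsilon>_def)
  define c where "c t = \<phi> p + t *\<^sub>R w" for t
  define I where "I = {-\<epsilon><..<\<epsilon>}"
  have I: "open I" "0 \<in> I" using e by (auto simp: I_def)
  have cU: "c t \<in> \<phi> ` U" if "t \<in> I" for t
  proof -
    have "norm (t *\<^sub>R w) = \<bar>t\<bar> * norm w" by simp
    also have "\<dots> \<le> \<epsilon> * norm w" using that by (intro mult_right_mono) (auto simp: I_def)
    also have "\<dots> < \<epsilon> * (norm w + 1)" using e by simp
    also have "\<dots> = r" using n by (simp add: \<epsilon>_def)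
    finally have "c t \<in> ball (\<phi> p) r" by (simp add: c_def dist_norm)
    then show ?thesis using r by blast
  qed
  have cs: "smooth_on S c" if "open S" for S
    unfolding c_def[abs_def] using that
    by (intro smooth_on_add smooth_on_const smooth_on_linear bounded_linear_scaleR_left)
  define \<gamma> where "\<gamma> t = inv_into U \<phi> (c t)" for t
  have g0: "\<gamma> 0 = p" using chart(4)[OF U] by (simp add: \<gamma>_def c_def)
  have gU: "\<gamma> t \<in> U" "\<phi> (\<gamma> t) = c t" if "t \<in> I" for t
    using cU[OF that] by (auto simp: \<gamma>_def inv_into_into f_inv_into_f)
  have gc: "continuous_on I \<gamma>" unfolding \<gamma>_def[abs_def]
    by (rule continuous_on_compose2[OF chart_inv_continuous[OF U(1)] smooth_on_imp_continuous_on[OF cs[OF I(1)]]])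
      (use cU in blast)
  have "smooth_on {t \<in> I. \<gamma> t \<in> V} (\<psi> \<circ> \<gamma>)" if V: "(V, \<psi>) \<in> A" for V \<psi>
  proof -
    have "{t \<in> I. \<gamma> t \<in> V} = \<gamma> -` V \<inter> I" by auto
    then have o: "open {t \<in> I. \<gamma> t \<in> V}"
      using gc I chart(1)[OF V] by (metis continuous_on_open_vimage)
    have o2: "open (\<phi> ` (U \<inter> V))"
      using chart_image_open[OF U(1) open_Int[OF chart(1)[OF U(1)] chart(1)[OF V]]] by auto
    have "smooth_on {t \<in> I. \<gamma> t \<in> V} (\<lambda>t. (\<psi> \<circ> inv_into U \<phi>) (c t))"
      by (rule smooth_on_compose[OF o o2 _ cs[OF o] chart_transition[OF U(1) V]]) (use gU in force)
    then show ?thesis by (simp add: \<gamma>_def o_def)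
  qed
  then have sc: "smooth_curve A {-\<epsilon><..<\<epsilon>} \<gamma>" using gc by (auto simp: smooth_curve_def I_def)
  have "deriv (\<lambda>t. F (\<gamma> t)) 0 = frechet_derivative (F \<circ> inv_into U \<phi>) (at (\<phi> p)) w" if F: "F \<in> C" for F
  proof -
    let ?D = "frechet_derivative (F \<circ> inv_into U \<phi>) (at (\<phi> p))"
    have D: "((F \<circ> inv_into U \<phi>) has_derivative ?D) (at (c 0))"
      using smooth_funs_has_derivative[OF F U] by (simp add: c_def)
    have "(c has_derivative (\<lambda>t. t *\<^sub>R w)) (at 0)" unfolding c_def[abs_def]
      by (auto intro!: derivative_eq_intros)
    from diff_chain_at[OF this D]
    have "((\<lambda>t. F (\<gamma> t)) has_derivative (\<lambda>t. ?D (t *\<^sub>R w))) (at 0)"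
      by (simp add: o_def \<gamma>_def)
    moreover have "(\<lambda>t. ?D (t *\<^sub>R w)) = (*) (?D w)"
      using linear_cmul[OF has_derivative_linear[OF D]] by auto
    ultimately show ?thesis by (metis DERIV_imp_deriv has_field_derivative_def)
  qed
  then have "v = velocity A \<gamma>" by (auto simp: v velocity_def chart_vec_def fun_eq_iff)
  then show "v \<in> T p" using g0 sc e by (auto simp: tangent_space_def)
qed

lemma tangent_chart_vec:
  assumes "v \<in> T p" "(U, \<phi>) \<in> A" "p \<in> U"
  obtains w where "v = chart_vec U \<phi> p w"
  using assms tangent_space_chart by auto

lemma tangent_lincomb:
  assumes "u \<in> T p" "v \<in> T p"
  shows "(\<lambda>F. a * u F + b * v F) \<in> T p"
proof -
  obtain U \<phi> where U: "(U, \<phi>) \<in> A" "p \<in> U" by (rule chart_at)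
  obtain x y where *: "u = chart_vec U \<phi> p x" "v = chart_vec U \<phi> p y"
    using assms U tangent_chart_vec by metis
  have "(\<lambda>F. a * u F + b * v F) = chart_vec U \<phi> p (a *\<^sub>R x + b *\<^sub>R y)"
    unfolding * chart_vec_def
    using has_derivative_linear[OF smooth_funs_has_derivative[OF _ U]]
    by (auto simp: fun_eq_iff linear_add linear_cmul)
  then show ?thesis using tangent_space_chart[OF U] by auto
qed

lemma tangent_zero: "(\<lambda>F. 0) \<in> T p"
proof -
  obtain U \<phi> where U: "(U, \<phi>) \<in> A" "p \<in> U" by (rule chart_at)
  have "chart_vec U \<phi> p 0 \<in> T p" using tangent_space_chart[OF U] by auto
  from tangent_lincomb[OF this this, of 0 0] show ?thesis by simp
qed

lemma tangent_scale: "u \<in> T p \<Longrightarrow> (\<lambda>F. a * u F) \<in> T p"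
  using tangent_lincomb[of u p u a 0] by simp

lemma tangent_sum: "(\<And>i. i \<in> I \<Longrightarrow> u i \<in> T p) \<Longrightarrow> (\<lambda>F. \<Sum>i\<in>I. c i * u i F) \<in> T p"
proof (induction I rule: infinite_finite_induct)
  case (insert i I)
  then show ?case using tangent_lincomb[of "u i" p "\<lambda>F. \<Sum>i\<in>I. c i * u i F" "c i" 1] by simp
qed (auto intro: tangent_zero)

lemma tangent_nonsmooth: "v \<in> T p \<Longrightarrow> F \<notin> C \<Longrightarrow> v F = 0"
  by (metis chart_at chart_vec_def tangent_chart_vec)

text \<open>Both rules hold for directional derivatives, hence for all tangent vectors.\<close>

lemma tangent_derivation:
  assumes "v \<in> T p" "F \<in> C" "G \<in> C"
  shows "v (\<lambda>q. F q + G q) = v F + v G"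
    and "v (\<lambda>q. F q * G q) = F p * v G + G p * v F"
    and "v (\<lambda>q. c) = 0"
proof -
  obtain U \<phi> where U: "(U, \<phi>) \<in> A" "p \<in> U" by (rule chart_at)
  obtain w where v: "v = chart_vec U \<phi> p w" using assms(1) U tangent_chart_vec by metis
  note d = smooth_funs_has_derivative[OF assms(2) U] smooth_funs_has_derivative[OF assms(3) U]
  note fd = frechet_derivative_at[symmetric, THEN fun_cong, of _ _ _ w]
  have "v F = frechet_derivative (F \<circ> inv_into U \<phi>) (at (\<phi> p)) w"
    "v G = frechet_derivative (G \<circ> inv_into U \<phi>) (at (\<phi> p)) w"
    using assms by (auto simp: v chart_vec_def)
  moreover have "v (\<lambda>q. F q + G q) = frechet_derivative (\<lambda>y. (F \<circ> inv_into U \<phi>) y + (G \<circ> inv_into U \<phi>) y) (at (\<phi> p)) w"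
    "v (\<lambda>q. F q * G q) = frechet_derivative (\<lambda>y. (F \<circ> inv_into U \<phi>) y * (G \<circ> inv_into U \<phi>) y) (at (\<phi> p)) w"
    using assms smooth_add[of F G] smooth_mult[of F G] by (auto simp: v chart_vec_def o_def)
  ultimately show "v (\<lambda>q. F q + G q) = v F + v G" "v (\<lambda>q. F q * G q) = F p * v G + G p * v F"
    using fd[OF has_derivative_add[OF d]] fd[OF has_derivative_mult[OF d]] chart(4)[OF U]
    by simp_all
  show "v (\<lambda>q. c) = 0" by (simp add: v chart_vec_def o_def)
qed

lemma tangent_local:
  assumes "v \<in> T p" "F \<in> C" "G \<in> C" "open W" "p \<in> W" "\<And>q. q \<in> W \<Longrightarrow> F q = G q"
  shows "v F = v G"
proof -
  obtain U \<phi> where U: "(U, \<phi>) \<in> A" "p \<in> U" by (rule chart_at)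
  obtain w where v: "v = chart_vec U \<phi> p w" using assms(1) U tangent_chart_vec by metis
  have "((G \<circ> inv_into U \<phi>) has_derivative frechet_derivative (F \<circ> inv_into U \<phi>) (at (\<phi> p))) (at (\<phi> p))"
    by (rule has_derivative_transform_within_open[OF smooth_funs_has_derivative[OF assms(2) U],
          of "\<phi> ` (U \<inter> W)"])
      (use U assms chart(4)[OF U(1)] chart_image_open[OF U(1), of "U \<inter> W"] chart(1)[OF U(1)] in auto)
  then show ?thesis
    using frechet_derivative_at assms by (metis (no_types, lifting) chart_vec_def v)
qed

lemma tangent_scale_fun: "v \<in> T p \<Longrightarrow> F \<in> C \<Longrightarrow> v (\<lambda>q. c * F q) = c * v F"
  using tangent_derivation(2)[of v p "\<lambda>_. c" F] tangent_derivation(3)[of v p F F c]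
  by (simp add: smooth_const)

lemma tangent_const: "v \<in> T p \<Longrightarrow> v (\<lambda>q. c) = 0"
  using tangent_derivation(3)[OF _ smooth_const smooth_const] by blast

lemma tangent_fun_sum:
  assumes "v \<in> T p" "\<And>i. i \<in> I \<Longrightarrow> F i \<in> C"
  shows "v (\<lambda>q. \<Sum>i\<in>I. F i q) = (\<Sum>i\<in>I. v (F i))"
  using assms(2)
proof (induction I rule: infinite_finite_induct)
  case (insert i I)
  then show ?case
    using tangent_derivation(1)[OF assms(1), of "F i" "\<lambda>q. \<Sum>i\<in>I. F i q"] smooth_sum[of I F] by simp
qed (auto simp: tangent_const[OF assms(1)])

lemma tangent_inverse:
  assumes "v \<in> T p" "F \<in> C" "\<And>q. F q \<noteq> 0"
  shows "v (\<lambda>q. inverse (F q)) = - v F / (F p)\<^sup>2"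
proof -
  have "v (\<lambda>q. F q * inverse (F q)) = F p * v (\<lambda>q. inverse (F q)) + inverse (F p) * v F"
    by (rule tangent_derivation(2)[OF assms(1,2) smooth_inverse[OF assms(2,3)]])
  moreover have "v (\<lambda>q. F q * inverse (F q)) = 0"
    using assms(3) by (simp add: tangent_const[OF assms(1)])
  ultimately show ?thesis
    using assms(3)[of p] by (simp add: field_simps power2_eq_square add_eq_0_iff2)
qed

abbreviation "VF \<equiv> vector_fields A"

text \<open>The global functions \<open>x i\<close> and the global vector fields \<open>E i\<close> behave on the open set \<open>W\<close> like
the coordinates and the coordinate fields of a chart. The last condition says that the fields
commute; it is the only place where second derivatives enter.\<close>

definition frame :: "'m set \<Rightarrow> ('e \<Rightarrow> 'm \<Rightarrow> real) \<Rightarrow> ('e \<Rightarrow> 'm vfield) \<Rightarrow> bool" where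
  "frame W x E \<longleftrightarrow> open W \<and> (\<forall>i. x i \<in> C) \<and> (\<forall>i. E i \<in> VF) \<and>
     (\<forall>q\<in>W. \<forall>v\<in>T q. \<forall>F. v F = (\<Sum>i\<in>Basis. v (x i) * E i q F)) \<and>
     (\<forall>q\<in>W. \<forall>i\<in>Basis. \<forall>j\<in>Basis. E i q (x j) = (if i = j then 1 else 0)) \<and>
     (\<forall>q\<in>W. \<forall>i j. \<forall>F\<in>C. E i q (\<lambda>r. E j r F) = E j q (\<lambda>r. E i r F))"

text \<open>The coordinates and the coordinate fields of the chart, multiplied by a bump function that is
one on \<open>W\<close>. The fields commute there because second derivatives are symmetric.\<close>

lemma frame_at_chart:
  assumes U: "(U, \<phi>) \<in> A" "p \<in> U"
  obtains W x E where "frame W x E" "p \<in> W" "W \<subseteq> U" "\<And>i q. q \<in> W \<Longrightarrow> x i q = \<phi> q \<bullet> i"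
proof -
  obtain \<beta> W where b: "\<beta> \<in> C" "open W" "p \<in> W" "W \<subseteq> U" "\<And>q. q \<in> W \<Longrightarrow> \<beta> q = 1" "\<And>q. q \<notin> U \<Longrightarrow> \<beta> q = 0"
    and ext: "\<And>h. smooth_on (\<phi> ` U) h \<Longrightarrow> (\<lambda>q. if q \<in> U then \<beta> q * h (\<phi> q) else 0) \<in> C"
    by (rule bump_extension[OF U]) (rule that)
  let ?i = "inv_into U \<phi>"
  define x where "x i q = (if q \<in> U then \<beta> q * (\<phi> q \<bullet> i) else 0)" for i q
  define E where "E i q F = (if q \<in> U then \<beta> q * chart_vec U \<phi> q i F else 0)" for i q F
  have xC: "x i \<in> C" for i unfolding x_def[abs_def]
    by (rule ext[of "\<lambda>y. y \<bullet> i"]) (intro smooth_on_linear bounded_linear_inner_left chart(2) U)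
  have oW: "open (\<phi> ` W)" using chart_image_open[OF U(1) b(2,4)] .
  have EC: "(\<lambda>q. E i q F) \<in> C" if "F \<in> C" for i F
  proof -
    have "smooth_on (\<phi> ` U) (\<lambda>y. frechet_derivative (F \<circ> ?i) (at y) i)"
      by (rule smooth_on_derivative[OF smooth_funs_chart[OF that U(1)]])
    from ext[OF this] show ?thesis using that by (simp add: E_def chart_vec_def cong: if_cong)
  qed
  have ET: "E i q \<in> T q" for i q
  proof (cases "q \<in> U")
    case True
    then have "chart_vec U \<phi> q i \<in> T q" using tangent_space_chart[OF U(1)] by auto
    from tangent_scale[OF this] show ?thesis using True by (simp add: E_def[abs_def])
  next
    case False
    then show ?thesis using tangent_zero by (simp add: E_def[abs_def])
  qed
  have EVF: "E i \<in> VF" for i using EC ET by (simp add: vector_fields_def)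
  have EW: "E i q F = chart_vec U \<phi> q i F" if "q \<in> W" for i q F
    using that b by (auto simp: E_def)
  have xW: "x i q = \<phi> q \<bullet> i" if "q \<in> W" for i q using that b by (auto simp: x_def)
  have vx: "chart_vec U \<phi> q w (x i) = w \<bullet> i" if "q \<in> W" for q w i
  proof -
    have "((x i \<circ> ?i) has_derivative (\<lambda>y. y \<bullet> i)) (at (\<phi> q))"
      by (rule has_derivative_transform_within_open[of "\<lambda>y. y \<bullet> i" _ _ _ "\<phi> ` W"])
        (use oW that b(4) chart(4)[OF U(1)] xW
          in \<open>auto intro: bounded_linear_imp_has_derivative bounded_linear_inner_left\<close>)
    then show ?thesis using frechet_derivative_at xC by (metis chart_vec_def)
  qed
  have rep: "v F = (\<Sum>i\<in>Basis. v (x i) * E i q F)" if q: "q \<in> W" and v: "v \<in> T q" for q v F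
  proof (cases "F \<in> C")
    case True
    have qU: "q \<in> U" using q b by blast
    obtain w where w: "v = chart_vec U \<phi> q w" using tangent_chart_vec[OF v U(1) qU] .
    let ?D = "frechet_derivative (F \<circ> ?i) (at (\<phi> q))"
    have l: "linear ?D" using has_derivative_linear[OF smooth_funs_has_derivative[OF True U(1) qU]] .
    have "?D w = ?D (\<Sum>i\<in>Basis. (w \<bullet> i) *\<^sub>R i)" by (simp add: euclidean_representation)
    also have "\<dots> = (\<Sum>i\<in>Basis. (w \<bullet> i) * ?D i)" using l by (simp add: linear_sum linear_cmul)
    finally show ?thesis using True q by (simp add: w vx EW) (simp add: chart_vec_def)
  next
    case False
    then show ?thesis using tangent_nonsmooth[OF v] tangent_nonsmooth[OF ET] by simp
  qed
  have comm: "E i q (\<lambda>r. E j r F) = frechet_derivative (\<lambda>y. frechet_derivative (F \<circ> ?i) (at y) j) (at (\<phi> q)) i"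
    if q: "q \<in> W" and F: "F \<in> C" for q F i j
  proof -
    let ?h = "\<lambda>y. frechet_derivative (F \<circ> ?i) (at y) j"
    have "smooth_on (\<phi> ` U) ?h"
      by (rule smooth_on_derivative[OF smooth_funs_chart[OF F U(1)]])
    then have h: "(?h has_derivative frechet_derivative ?h (at (\<phi> q))) (at (\<phi> q))"
      using smooth_on_has_derivative[OF chart(2)[OF U(1)]] q b by blast
    have "(((\<lambda>r. E j r F) \<circ> ?i) has_derivative frechet_derivative ?h (at (\<phi> q))) (at (\<phi> q))"
      by (rule has_derivative_transform_within_open[OF h oW])
        (use q subsetD[OF b(4)] chart(4)[OF U(1)] F EW in \<open>force simp: chart_vec_def\<close>)+
    then show ?thesis using frechet_derivative_at EC[OF F] EW[OF q] by (metis chart_vec_def)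
  qed
  have "E i q (x j) = (if i = j then 1 else 0)" if "q \<in> W" "i \<in> Basis" "j \<in> Basis" for q i j
    using that by (simp add: EW vx inner_Basis)
  moreover have "E i q (\<lambda>r. E j r F) = E j q (\<lambda>r. E i r F)" if "q \<in> W" "F \<in> C" for q i j F
    unfolding comm[OF that]
    using smooth_on_mixed_derivatives[OF chart(2)[OF U(1)] smooth_funs_chart[OF that(2) U(1)]] that b
    by blast
  ultimately have "frame W x E"
    unfolding frame_def using b(2) xC EVF rep by (intro conjI allI ballI) simp_all
  then show ?thesis using b(3,4) xW by (rule that)
qed

abbreviation "CT \<equiv> cotangent_space A"
abbreviation "\<Omega> \<equiv> one_forms A"
abbreviation "d \<equiv> differential A"

lemma frame_at: obtains W x E where "frame W x E" "p \<in> W"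
  by (metis chart_at frame_at_chart)

section \<open>Vector fields and one-forms\<close>

lemma VF_tangent: "X \<in> VF \<Longrightarrow> X p \<in> T p"
  and VF_smooth: "X \<in> VF \<Longrightarrow> F \<in> C \<Longrightarrow> (\<lambda>q. X q F) \<in> C"
  by (auto simp: vector_fields_def)

lemma form_covec: "\<omega> \<in> \<Omega> \<Longrightarrow> \<omega> p \<in> CT p"
  and form_smooth: "\<omega> \<in> \<Omega> \<Longrightarrow> X \<in> VF \<Longrightarrow> (\<lambda>q. \<omega> q (X q)) \<in> C"
  by (auto simp: one_forms_def)

lemma tangent_eqI: "u \<in> T p \<Longrightarrow> v \<in> T p \<Longrightarrow> (\<And>F. F \<in> C \<Longrightarrow> u F = v F) \<Longrightarrow> u = v"
  using tangent_nonsmooth by (metis ext)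

lemma frame_parts:
  assumes "frame W x E"
  shows "open W" "x i \<in> C" "E i \<in> VF"
  using assms by (simp_all add: frame_def)

lemma frame_subset: "frame W x E \<Longrightarrow> open W' \<Longrightarrow> W' \<subseteq> W \<Longrightarrow> frame W' x E"
  unfolding frame_def by blast

lemma frame_expand:
  assumes "frame W x E" "q \<in> W" "v \<in> T q"
  shows "v = (\<lambda>F. \<Sum>i\<in>Basis. v (x i) * E i q F)"
  by (rule ext) (use assms in \<open>auto simp only: frame_def\<close>)

lemma covec_lincomb:
  "\<alpha> \<in> CT p \<Longrightarrow> u \<in> T p \<Longrightarrow> v \<in> T p \<Longrightarrow> \<alpha> (\<lambda>F. a * u F + b * v F) = a * \<alpha> u + b * \<alpha> v"
  unfolding cotangent_space_def by blast

lemma covec_outside: "\<alpha> \<in> CT p \<Longrightarrow> v \<notin> T p \<Longrightarrow> \<alpha> v = 0"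
  unfolding cotangent_space_def by blast

lemma covec_zero: "\<alpha> \<in> CT p \<Longrightarrow> \<alpha> (\<lambda>F. 0) = 0"
  using covec_lincomb[of \<alpha> p "\<lambda>F. 0" "\<lambda>F. 0" 0 0] tangent_zero by simp

lemma covec_scale: "\<alpha> \<in> CT p \<Longrightarrow> u \<in> T p \<Longrightarrow> \<alpha> (\<lambda>F. a * u F) = a * \<alpha> u"
  using covec_lincomb[of \<alpha> p u u a 0] by simp

lemma covec_sum:
  assumes "\<alpha> \<in> CT p" "\<And>i. i \<in> I \<Longrightarrow> u i \<in> T p"
  shows "\<alpha> (\<lambda>F. \<Sum>i\<in>I. c i * u i F) = (\<Sum>i\<in>I. c i * \<alpha> (u i))"
  using assms(2)
proof (induction I rule: infinite_finite_induct)
  case (insert i I)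
  then show ?case
    using covec_lincomb[OF assms(1), of "u i" "\<lambda>F. \<Sum>i\<in>I. c i * u i F" "c i" 1] tangent_sum[of I u] by simp
qed (auto simp: covec_zero[OF assms(1)])

lemma covec_eqI: "\<alpha> \<in> CT p \<Longrightarrow> \<beta> \<in> CT p \<Longrightarrow> (\<And>v. v \<in> T p \<Longrightarrow> \<alpha> v = \<beta> v) \<Longrightarrow> \<alpha> = \<beta>"
  using covec_outside by (metis ext)

lemma cotI:
  assumes "\<And>u v a b. u \<in> T p \<Longrightarrow> v \<in> T p \<Longrightarrow> \<alpha> (\<lambda>F. a * u F + b * v F) = a * \<alpha> u + b * \<alpha> v"
    "\<And>v. v \<notin> T p \<Longrightarrow> \<alpha> v = 0"
  shows "\<alpha> \<in> CT p"
  using assms unfolding cotangent_space_def by blast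

lemma cot_lincomb: "\<alpha> \<in> CT p \<Longrightarrow> \<beta> \<in> CT p \<Longrightarrow> (\<lambda>v. a * \<alpha> v + b * \<beta> v) \<in> CT p"
  by (rule cotI) (auto simp: covec_lincomb covec_outside algebra_simps)

lemma cot_zero: "(\<lambda>v. 0) \<in> CT p"
  by (rule cotI) auto

lemma cot_scale: "\<alpha> \<in> CT p \<Longrightarrow> (\<lambda>v. a * \<alpha> v) \<in> CT p"
  using cot_lincomb[of \<alpha> p \<alpha> a 0] by simp

lemma cot_add: "\<alpha> \<in> CT p \<Longrightarrow> \<beta> \<in> CT p \<Longrightarrow> (\<lambda>v. \<alpha> v + \<beta> v) \<in> CT p"
  using cot_lincomb[of \<alpha> p \<beta> 1 1] by simp

lemma cot_diff: "\<alpha> \<in> CT p \<Longrightarrow> \<beta> \<in> CT p \<Longrightarrow> (\<lambda>v. \<alpha> v - \<beta> v) \<in> CT p"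
  using cot_lincomb[of \<alpha> p \<beta> 1 "-1"] by simp

lemma cot_sum: "(\<And>i. i \<in> I \<Longrightarrow> \<alpha> i \<in> CT p) \<Longrightarrow> (\<lambda>v. \<Sum>i\<in>I. c i * \<alpha> i v) \<in> CT p"
proof (induction I rule: infinite_finite_induct)
  case (insert i I)
  then show ?case using cot_lincomb[of "\<alpha> i" p "\<lambda>v. \<Sum>i\<in>I. c i * \<alpha> i v" "c i" 1] by simp
qed (auto intro: cot_zero)

lemma differential_apply: "v \<in> T p \<Longrightarrow> d F p v = v F"
  by (simp add: differential_def)

lemma differential_covec: "d F p \<in> CT p"
  by (rule cotI) (auto simp: differential_def tangent_lincomb)

lemma differential_form: "F \<in> C \<Longrightarrow> d F \<in> \<Omega>"
  using differential_covec by (auto simp: one_forms_def differential_apply VF_tangent VF_smooth)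

lemma covec_frame:
  assumes "frame W x E" "q \<in> W" "\<alpha> \<in> CT q" "v \<in> T q"
  shows "\<alpha> v = (\<Sum>i\<in>Basis. v (x i) * \<alpha> (E i q))"
proof -
  have "\<alpha> v = \<alpha> (\<lambda>F. \<Sum>i\<in>Basis. v (x i) * E i q F)"
    using frame_expand[OF assms(1,2,4)] by simp
  also have "\<dots> = (\<Sum>i\<in>Basis. v (x i) * \<alpha> (E i q))"
    using assms by (intro covec_sum) (auto simp: frame_def VF_tangent)
  finally show ?thesis .
qed

text \<open>A linear combination of the coordinates of a frame has the given differential. Consequently
every covector is the value of a global one-form, and tests against covectors at a point may be
replaced by tests against one-forms.\<close>

lemma covec_is_differential:
  assumes "\<alpha> \<in> CT p"
  obtains F where "F \<in> C" "d F p = \<alpha>"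
proof -
  obtain W x E where f: "frame W x E" "p \<in> W" by (rule frame_at)
  define F where "F q = (\<Sum>i\<in>Basis. \<alpha> (E i p) * x i q)" for q
  have xC: "x i \<in> C" for i using f by (simp add: frame_def)
  have FC: "F \<in> C" unfolding F_def[abs_def] by (intro smooth_sum smooth_mult smooth_const xC)
  have "d F p = \<alpha>"
  proof (rule covec_eqI[OF differential_covec assms])
    fix v assume v: "v \<in> T p"
    have "v F = (\<Sum>i\<in>Basis. v (\<lambda>q. \<alpha> (E i p) * x i q))"
      unfolding F_def[abs_def] by (rule tangent_fun_sum[OF v]) (intro smooth_mult smooth_const xC)
    also have "\<dots> = (\<Sum>i\<in>Basis. v (x i) * \<alpha> (E i p))"
      using tangent_scale_fun[OF v xC] by (simp add: mult.commute[of "v _"])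
    finally show "d F p v = \<alpha> v"
      using covec_frame[OF f assms v] by (simp add: differential_apply[OF v])
  qed
  then show ?thesis using that FC by blast
qed

lemma tangent_separated:
  assumes "u \<in> T p" "v \<in> T p" "\<And>\<alpha>. \<alpha> \<in> CT p \<Longrightarrow> \<alpha> u = \<alpha> v"
  shows "u = v"
  by (rule tangent_eqI[OF assms(1,2)])
    (metis assms differential_covec differential_apply)

lemma VF_I: "(\<And>p. X p \<in> T p) \<Longrightarrow> (\<And>F. F \<in> C \<Longrightarrow> (\<lambda>p. X p F) \<in> C) \<Longrightarrow> X \<in> VF"
  by (auto simp: vector_fields_def)

lemma VF_sum:
  assumes "\<And>i. i \<in> I \<Longrightarrow> X i \<in> VF" "\<And>i. i \<in> I \<Longrightarrow> a i \<in> C"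
  shows "(\<lambda>p F. \<Sum>i\<in>I. a i p * X i p F) \<in> VF"
proof (rule VF_I)
  show "(\<lambda>F. \<Sum>i\<in>I. a i p * X i p F) \<in> T p" for p
    using VF_tangent[OF assms(1)] by (rule tangent_sum)
  show "(\<lambda>p. \<Sum>i\<in>I. a i p * X i p F) \<in> C" if "F \<in> C" for F
    using VF_smooth[OF assms(1) that] assms(2) by (intro smooth_sum smooth_mult)
qed

lemma tangent_extension:
  assumes "v \<in> T p"
  obtains Y where "Y \<in> VF" "Y p = v"
proof -
  obtain W x E where f: "frame W x E" "p \<in> W" by (rule frame_at)
  have "(\<lambda>q F. \<Sum>i\<in>Basis. (\<lambda>_. v (x i)) q * E i q F) \<in> VF"
    using f by (intro VF_sum smooth_const) (auto simp: frame_def)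
  then show ?thesis using that frame_expand[OF f assms] by auto
qed

text \<open>In a frame, \<open>X(Y F)\<close> is a first-order expression in \<open>F\<close> plus a second-order expression whose
coefficients are symmetric up to exchanging \<open>X\<close> and \<open>Y\<close>. As the fields of the frame commute, the
second-order parts of \<open>X(Y F)\<close> and \<open>Y(X F)\<close> cancel, and what is left is a combination of
the fields of the frame, hence tangent.\<close>

lemma lie_bracket_VF:
  assumes X: "X \<in> VF" and Y: "Y \<in> VF"
  shows "lie_bracket X Y \<in> VF"
proof (rule VF_I)
  show "(\<lambda>p. lie_bracket X Y p F) \<in> C" if "F \<in> C" for F
    unfolding lie_bracket_def
    by (rule smooth_diff[OF VF_smooth[OF X VF_smooth[OF Y that]] VF_smooth[OF Y VF_smooth[OF X that]]])
  fix p
  obtain W x E where f: "frame W x E" "p \<in> W" by (rule frame_at)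
  have W: "open W" and xC: "\<And>i. x i \<in> C" and E: "\<And>i. E i \<in> VF"
    and comm: "\<And>q i j F. q \<in> W \<Longrightarrow> F \<in> C \<Longrightarrow> E i q (\<lambda>r. E j r F) = E j q (\<lambda>r. E i r F)"
    using f(1) by (auto simp: frame_def)
  have der: "X p (\<lambda>q. Y q F) = (\<Sum>j\<in>Basis. X p (\<lambda>q. Y q (x j)) * E j p F)
      + (\<Sum>j\<in>Basis. \<Sum>i\<in>Basis. Y p (x j) * X p (x i) * E i p (\<lambda>q. E j q F))"
    if X: "X \<in> VF" and Y: "Y \<in> VF" and F: "F \<in> C" for X Y F
  proof -
    note YxC = VF_smooth[OF Y xC] and EFC = VF_smooth[OF E F] and Xp = VF_tangent[OF X, of p]
    have "X p (\<lambda>q. Y q F) = X p (\<lambda>q. \<Sum>j\<in>Basis. Y q (x j) * E j q F)"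
      by (rule tangent_local[OF Xp VF_smooth[OF Y F] smooth_sum[OF smooth_mult[OF YxC EFC]] W f(2)])
        (rule fun_cong[OF frame_expand[OF f(1) _ VF_tangent[OF Y]]])
    also have "\<dots> = (\<Sum>j\<in>Basis. X p (\<lambda>q. Y q (x j) * E j q F))"
      by (rule tangent_fun_sum[OF Xp smooth_mult[OF YxC EFC]])
    also have "\<dots> = (\<Sum>j\<in>Basis. Y p (x j) * X p (\<lambda>q. E j q F) + E j p F * X p (\<lambda>q. Y q (x j)))"
      by (rule sum.cong[OF refl tangent_derivation(2)[OF Xp YxC EFC]])
    also have "\<dots> = (\<Sum>j\<in>Basis. Y p (x j) * (\<Sum>i\<in>Basis. X p (x i) * E i p (\<lambda>q. E j q F))
        + E j p F * X p (\<lambda>q. Y q (x j)))"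
      by (rule sum.cong[OF refl], subst (1) fun_cong[OF frame_expand[OF f VF_tangent[OF X]]], rule refl)
    finally show ?thesis
      by (simp add: sum.distrib sum_distrib_left mult.assoc mult.commute[of "E _ p F"] add.commute)
  qed
  have swap: "(\<Sum>j\<in>Basis. \<Sum>i\<in>Basis. Y p (x j) * X p (x i) * E i p (\<lambda>q. E j q F))
      = (\<Sum>j\<in>Basis. \<Sum>i\<in>Basis. X p (x j) * Y p (x i) * E i p (\<lambda>q. E j q F))" if "F \<in> C" for F
  proof -
    have "(\<Sum>j\<in>Basis. \<Sum>i\<in>Basis. Y p (x j) * X p (x i) * E i p (\<lambda>q. E j q F))
      = (\<Sum>i\<in>Basis. \<Sum>j\<in>Basis. Y p (x j) * X p (x i) * E i p (\<lambda>q. E j q F))"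
      by (rule sum.swap)
    also have "\<dots> = (\<Sum>j\<in>Basis. \<Sum>i\<in>Basis. X p (x j) * Y p (x i) * E i p (\<lambda>q. E j q F))"
      by (intro sum.cong refl) (subst comm[OF f(2) that], simp add: mult.commute)
    finally show ?thesis .
  qed
  have "lie_bracket X Y p F = (\<Sum>j\<in>Basis. (X p (\<lambda>q. Y q (x j)) - Y p (\<lambda>q. X q (x j))) * E j p F)" for F
  proof (cases "F \<in> C")
    case True
    then show ?thesis
      using der[OF X Y True] der[OF Y X True] swap[OF True]
      by (simp add: lie_bracket_def sum_subtractf left_diff_distrib)
  next
    case False
    have [simp]: "X q F = 0" "Y q F = 0" "E i q F = 0" for i q
      using tangent_nonsmooth[OF VF_tangent False] X Y E by auto
    show ?thesis by (simp add: lie_bracket_def tangent_const[OF VF_tangent] X Y)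
  qed
  then have "lie_bracket X Y p = (\<lambda>F. \<Sum>j\<in>Basis. (X p (\<lambda>q. Y q (x j)) - Y p (\<lambda>q. X q (x j))) * E j p F)"
    by blast
  also have "\<dots> \<in> T p" by (intro tangent_sum VF_tangent E)
  finally show "lie_bracket X Y p \<in> T p" .
qed

section \<open>Lie derivatives of one-forms\<close>

lemma form_add_closed: "\<omega> \<in> \<Omega> \<Longrightarrow> \<eta> \<in> \<Omega> \<Longrightarrow> form_add \<omega> \<eta> \<in> \<Omega>"
  by (auto simp: one_forms_def form_add_def intro: cot_add smooth_add)

lemma form_diff_closed: "\<omega> \<in> \<Omega> \<Longrightarrow> \<eta> \<in> \<Omega> \<Longrightarrow> form_diff \<omega> \<eta> \<in> \<Omega>"
  by (auto simp: one_forms_def form_diff_def intro: cot_diff smooth_diff)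

lemma form_mult_closed: "F \<in> C \<Longrightarrow> \<omega> \<in> \<Omega> \<Longrightarrow> form_mult F \<omega> \<in> \<Omega>"
  by (auto simp: one_forms_def form_mult_def intro: cot_scale smooth_mult)

lemma form_zero: "(\<lambda>p v. 0) \<in> \<Omega>"
  by (auto simp: one_forms_def intro: cot_zero smooth_const)

lemma form_local_rep:
  assumes "\<omega> \<in> \<Omega>"
  obtains W h x where "open W" "p \<in> W" "\<And>i. h i \<in> C" "\<And>i. x i \<in> C"
    "\<And>q v. q \<in> W \<Longrightarrow> v \<in> T q \<Longrightarrow> \<omega> q v = (\<Sum>i\<in>(Basis::'e set). h i q * v (x i))"
proof -
  obtain W x E where f: "frame W x E" "p \<in> W" by (rule frame_at)
  show ?thesis
  proof (rule that[of W "\<lambda>i q. \<omega> q (E i q)" x])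
    show "\<omega> q v = (\<Sum>i\<in>Basis. \<omega> q (E i q) * v (x i))" if "q \<in> W" "v \<in> T q" for q v
      using covec_frame[OF f(1) that(1) form_covec[OF assms] that(2)] by (simp add: mult.commute)
  qed (use f assms form_smooth in \<open>auto simp: frame_def\<close>)
qed

text \<open>The left-hand side is what \<open>(L\<^sub>X \<eta>)(Y)\<close> is required to be. The right-hand side
depends on the value of \<open>Y\<close> at \<open>p\<close> only, and does so linearly.\<close>

lemma lie_derivative_formula_local:
  assumes X: "X \<in> VF" and Y: "Y \<in> VF" and \<eta>: "\<eta> \<in> \<Omega>"
    and W: "open W" "p \<in> W" and h: "\<And>i. i \<in> I \<Longrightarrow> h i \<in> C" and x: "\<And>i. i \<in> I \<Longrightarrow> x i \<in> C"
    and rep: "\<And>q v. q \<in> W \<Longrightarrow> v \<in> T q \<Longrightarrow> \<eta> q v = (\<Sum>i\<in>I. h i q * v (x i))"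
  shows "X p (\<lambda>q. \<eta> q (Y q)) - \<eta> p (lie_bracket X Y p)
    = (\<Sum>i\<in>I. X p (h i) * Y p (x i) + h i p * Y p (\<lambda>q. X q (x i)))"
proof -
  note YxC = VF_smooth[OF Y x] and Xp = VF_tangent[OF X, of p]
  have "X p (\<lambda>q. \<eta> q (Y q)) = X p (\<lambda>q. \<Sum>i\<in>I. h i q * Y q (x i))"
    by (rule tangent_local[OF Xp form_smooth[OF \<eta> Y] smooth_sum[OF smooth_mult[OF h YxC]] W])
      (assumption | rule rep[OF _ VF_tangent[OF Y]])+
  also have "\<dots> = (\<Sum>i\<in>I. X p (\<lambda>q. h i q * Y q (x i)))"
    by (rule tangent_fun_sum[OF Xp smooth_mult[OF h YxC]])
  also have "\<dots> = (\<Sum>i\<in>I. h i p * X p (\<lambda>q. Y q (x i)) + Y p (x i) * X p (h i))"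
    by (rule sum.cong[OF refl tangent_derivation(2)[OF Xp h YxC]])
  finally show ?thesis
    using rep[OF W(2) VF_tangent[OF lie_bracket_VF[OF X Y]]]
    by (simp add: lie_bracket_def sum_subtractf[symmetric] algebra_simps)
qed

lemma lie_derivative_exists:
  assumes X: "X \<in> VF" and \<eta>: "\<eta> \<in> \<Omega>"
  shows "\<exists>\<theta>\<in>\<Omega>. \<forall>Y\<in>VF. \<forall>p. \<theta> p (Y p) = X p (\<lambda>q. \<eta> q (Y q)) - \<eta> p (lie_bracket X Y p)"
proof -
  have "\<exists>\<alpha>. \<alpha> \<in> CT p \<and> (\<forall>Y\<in>VF. \<alpha> (Y p) = X p (\<lambda>q. \<eta> q (Y q)) - \<eta> p (lie_bracket X Y p))" for p
  proof -
    obtain W and h x :: "'e \<Rightarrow> 'm \<Rightarrow> real" where W: "open W" "p \<in> W"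
      and h: "\<And>i. h i \<in> C" and x: "\<And>i. x i \<in> C"
      and rep: "\<And>q v. q \<in> W \<Longrightarrow> v \<in> T q \<Longrightarrow> \<eta> q v = (\<Sum>i\<in>(Basis::'e set). h i q * v (x i))"
      by (rule form_local_rep[OF \<eta>]) (rule that)
    define \<alpha> where "\<alpha> v = (\<Sum>i\<in>Basis. X p (h i) * d (x i) p v + h i p * d (\<lambda>q. X q (x i)) p v)" for v
    have "\<alpha> = (\<lambda>v. (\<Sum>i\<in>Basis. X p (h i) * d (x i) p v) + (\<Sum>i\<in>Basis. h i p * d (\<lambda>q. X q (x i)) p v))"
      by (auto simp: \<alpha>_def sum.distrib)
    also have "\<dots> \<in> CT p" by (intro cot_add cot_sum differential_covec)
    finally have "\<alpha> \<in> CT p" .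
    moreover have "\<alpha> (Y p) = X p (\<lambda>q. \<eta> q (Y q)) - \<eta> p (lie_bracket X Y p)" if Y: "Y \<in> VF" for Y
      using lie_derivative_formula_local[OF X Y \<eta> W h x rep] VF_tangent[OF Y]
      by (simp add: \<alpha>_def differential_apply)
    ultimately show ?thesis by blast
  qed
  then obtain \<theta> where \<theta>: "\<And>p. \<theta> p \<in> CT p"
    "\<And>p Y. Y \<in> VF \<Longrightarrow> \<theta> p (Y p) = X p (\<lambda>q. \<eta> q (Y q)) - \<eta> p (lie_bracket X Y p)"
    by metis
  have "\<theta> \<in> \<Omega>"
    using \<theta> smooth_diff[OF VF_smooth[OF X form_smooth[OF \<eta>]] form_smooth[OF \<eta> lie_bracket_VF[OF X]]]
    by (simp add: one_forms_def)
  then show ?thesis using \<theta> by blast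
qed

text \<open>Existence comes from the local formula. Uniqueness holds as every tangent vector is
the value of a vector field.\<close>

lemma lie_derivative:
  assumes X: "X \<in> VF" and \<eta>: "\<eta> \<in> \<Omega>"
  shows "lie_derivative A X \<eta> \<in> \<Omega>"
    "Y \<in> VF \<Longrightarrow> lie_derivative A X \<eta> p (Y p) = X p (\<lambda>q. \<eta> q (Y q)) - \<eta> p (lie_bracket X Y p)"
proof -
  let ?Q = "\<lambda>\<theta>. \<theta> \<in> \<Omega> \<and> (\<forall>Y\<in>VF. \<forall>p. \<theta> p (Y p) = X p (\<lambda>q. \<eta> q (Y q)) - \<eta> p (lie_bracket X Y p))"
  have "\<theta> = \<theta>'" if "?Q \<theta>" "?Q \<theta>'" for \<theta> \<theta>'
  proof
    fix p show "\<theta> p = \<theta>' p"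
    proof (rule covec_eqI)
      fix v assume "v \<in> T p"
      then obtain Y where "Y \<in> VF" "Y p = v" by (rule tangent_extension)
      then show "\<theta> p v = \<theta>' p v" using that by metis
    qed (use that form_covec in auto)
  qed
  then have "\<exists>!\<theta>. ?Q \<theta>" using lie_derivative_exists[OF X \<eta>] by blast
  from theI'[OF this] show "lie_derivative A X \<eta> \<in> \<Omega>"
    "Y \<in> VF \<Longrightarrow> lie_derivative A X \<eta> p (Y p) = X p (\<lambda>q. \<eta> q (Y q)) - \<eta> p (lie_bracket X Y p)"
    by (auto simp: lie_derivative_def)
qed

text \<open>The Lie derivative of \<open>\<Sum> h\<^sub>i dx\<^sub>i\<close>, computed by the product rule and
\<open>L\<^sub>X dx\<^sub>i = d(X(x\<^sub>i))\<close>.\<close>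

lemma lie_derivative_local:
  assumes X: "X \<in> VF" and \<eta>: "\<eta> \<in> \<Omega>"
    and W: "open W" "p \<in> W" and h: "\<And>i. i \<in> I \<Longrightarrow> h i \<in> C" and x: "\<And>i. i \<in> I \<Longrightarrow> x i \<in> C"
    and rep: "\<And>q v. q \<in> W \<Longrightarrow> v \<in> T q \<Longrightarrow> \<eta> q v = (\<Sum>i\<in>I. h i q * v (x i))"
    and v: "v \<in> T p"
  shows "lie_derivative A X \<eta> p v = (\<Sum>i\<in>I. X p (h i) * v (x i) + h i p * v (\<lambda>q. X q (x i)))"
proof -
  obtain Y where Y: "Y \<in> VF" "Y p = v" using v by (rule tangent_extension)
  have "X p (\<lambda>q. \<eta> q (Y q)) - \<eta> p (lie_bracket X Y p)
      = (\<Sum>i\<in>I. X p (h i) * Y p (x i) + h i p * Y p (\<lambda>q. X q (x i)))"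
    by (rule lie_derivative_formula_local[OF X Y(1) \<eta> W h x rep])
  with lie_derivative(2)[OF X \<eta> Y(1), of p] show ?thesis unfolding Y(2) by (rule trans)
qed

section \<open>The sharp map of a bivector field\<close>

text \<open>Tangent spaces are reflexive: the vector is read off from the values of the functional on the
differentials of the coordinates of a frame.\<close>

lemma covec_functional_is_evaluation:
  assumes "\<And>\<alpha> \<beta> a b. \<alpha> \<in> CT p \<Longrightarrow> \<beta> \<in> CT p \<Longrightarrow> L (\<lambda>v. a * \<alpha> v + b * \<beta> v) = a * L \<alpha> + b * L \<beta>"
  obtains v where "v \<in> T p" "\<And>\<alpha>. \<alpha> \<in> CT p \<Longrightarrow> \<alpha> v = L \<alpha>"
proof -
  obtain W x E where f: "frame W x E" "p \<in> W" by (rule frame_at)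
  have E: "E i p \<in> T p" for i using f by (simp add: frame_def VF_tangent)
  define v where "v = (\<lambda>F. \<Sum>i\<in>Basis. L (d (x i) p) * E i p F)"
  have v: "v \<in> T p" unfolding v_def by (intro tangent_sum E)
  have L0: "L (\<lambda>v. 0) = 0" using assms[of "\<lambda>v. 0" "\<lambda>v. 0" 0 0] cot_zero by simp
  have Lsum: "L (\<lambda>v. \<Sum>i\<in>I. c i * \<alpha> i v) = (\<Sum>i\<in>I. c i * L (\<alpha> i))"
    if "\<And>i. i \<in> I \<Longrightarrow> \<alpha> i \<in> CT p" for I :: "'e set" and c \<alpha>
    using that
  proof (induction I rule: infinite_finite_induct)
    case (insert i I)
    then show ?case
      using assms[of "\<alpha> i" "\<lambda>v. \<Sum>i\<in>I. c i * \<alpha> i v" "c i" 1] cot_sum[of I \<alpha>] by simp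
  qed (auto simp: L0)
  have "\<alpha> v = L \<alpha>" if \<alpha>: "\<alpha> \<in> CT p" for \<alpha>
  proof -
    have "\<alpha> = (\<lambda>v. \<Sum>i\<in>Basis. \<alpha> (E i p) * d (x i) p v)"
    proof (rule covec_eqI[OF \<alpha> cot_sum[OF differential_covec]])
      fix v assume v: "v \<in> T p"
      show "\<alpha> v = (\<Sum>i\<in>Basis. \<alpha> (E i p) * d (x i) p v)"
        using covec_frame[OF f \<alpha> v] by (simp add: differential_apply[OF v] mult.commute)
    qed
    then have "L \<alpha> = (\<Sum>i\<in>Basis. \<alpha> (E i p) * L (d (x i) p))"
      using Lsum[of Basis "\<lambda>i. d (x i) p" "\<lambda>i. \<alpha> (E i p)"] differential_covec by metis
    then show ?thesis
      unfolding v_def using covec_sum[OF \<alpha>, of Basis "\<lambda>i. E i p"] E by (simp add: mult.commute[of "\<alpha> _"])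
  qed
  then show ?thesis using that v by blast
qed

lemma sharp_eqI:
  assumes "v \<in> T p" "\<And>\<eta>. \<eta> \<in> CT p \<Longrightarrow> \<eta> v = P p (\<omega> p) \<eta>"
  shows "sharp A P \<omega> p = v"
  unfolding sharp_def
proof (rule the_equality)
  fix u assume "u \<in> T p \<and> (\<forall>\<eta>\<in>CT p. \<eta> u = P p (\<omega> p) \<eta>)"
  then show "u = v" using assms by (intro tangent_separated[of u p v]) auto
qed (use assms in auto)

lemma bivector_alternating:
  assumes "bivector_field A P" "\<alpha> \<in> CT p" "\<beta> \<in> CT p"
  shows "P p \<alpha> \<beta> = - P p \<beta> \<alpha>"
  using assms unfolding bivector_field_def by blast

lemma bivector_lincomb_left:
  assumes "bivector_field A P" "\<alpha> \<in> CT p" "\<beta> \<in> CT p" "\<gamma> \<in> CT p"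
  shows "P p (\<lambda>v. a * \<alpha> v + b * \<beta> v) \<gamma> = a * P p \<alpha> \<gamma> + b * P p \<beta> \<gamma>"
  using assms unfolding bivector_field_def by blast

lemma bivector_lincomb_right:
  assumes "bivector_field A P" "\<alpha> \<in> CT p" "\<beta> \<in> CT p" "\<gamma> \<in> CT p"
  shows "P p \<gamma> (\<lambda>v. a * \<alpha> v + b * \<beta> v) = a * P p \<gamma> \<alpha> + b * P p \<gamma> \<beta>"
  using bivector_alternating[OF assms(1,4) cot_lincomb[OF assms(2,3), of a b]]
    bivector_alternating[OF assms(1,4,2)] bivector_alternating[OF assms(1,4,3)]
    bivector_lincomb_left[OF assms] by simp

lemma bivector_smooth:
  assumes "bivector_field A P" "\<omega> \<in> \<Omega>" "\<eta> \<in> \<Omega>"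
  shows "(\<lambda>p. P p (\<omega> p) (\<eta> p)) \<in> C"
  using assms unfolding bivector_field_def by blast

lemma sharp_tangent:
  assumes "bivector_field A P" "\<omega> p \<in> CT p"
  shows "sharp A P \<omega> p \<in> T p" "\<And>\<eta>. \<eta> \<in> CT p \<Longrightarrow> \<eta> (sharp A P \<omega> p) = P p (\<omega> p) \<eta>"
proof -
  obtain v where "v \<in> T p" "\<And>\<eta>. \<eta> \<in> CT p \<Longrightarrow> \<eta> v = P p (\<omega> p) \<eta>"
    by (rule covec_functional_is_evaluation[of p "P p (\<omega> p)"])
      (rule bivector_lincomb_right[OF assms(1) _ _ assms(2)], assumption, assumption, rule that)
  then show "sharp A P \<omega> p \<in> T p" "\<And>\<eta>. \<eta> \<in> CT p \<Longrightarrow> \<eta> (sharp A P \<omega> p) = P p (\<omega> p) \<eta>"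
    using sharp_eqI[of v p P \<omega>] by auto
qed

lemma sharp_fun:
  assumes "bivector_field A P" "\<omega> p \<in> CT p"
  shows "sharp A P \<omega> p F = P p (\<omega> p) (d F p)"
  using sharp_tangent[where P = P and \<omega> = \<omega> and p = p, OF assms] differential_covec differential_apply by metis

lemma sharp_VF:
  assumes "bivector_field A P" "\<omega> \<in> \<Omega>"
  shows "sharp A P \<omega> \<in> VF"
proof (rule VF_I)
  show "sharp A P \<omega> p \<in> T p" for p by (rule sharp_tangent(1)[OF assms(1) form_covec[OF assms(2)]])
  show "(\<lambda>p. sharp A P \<omega> p F) \<in> C" if "F \<in> C" for F
  proof -
    have "(\<lambda>p. sharp A P \<omega> p F) = (\<lambda>p. P p (\<omega> p) (d F p))"
      by (rule ext) (rule sharp_fun[where \<omega> = \<omega>, OF assms(1) form_covec[OF assms(2)]])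
    then show ?thesis using bivector_smooth[OF assms differential_form[OF that]] by simp
  qed
qed

lemma bivector_zero_right:
  assumes "bivector_field A P" "\<alpha> \<in> CT p"
  shows "P p \<alpha> (\<lambda>v. 0) = 0"
  using bivector_lincomb_right[OF assms(1) cot_zero cot_zero assms(2), of 0 0] by simp

lemma bivector_zero_left:
  assumes "bivector_field A P" "\<alpha> \<in> CT p"
  shows "P p (\<lambda>v. 0) \<alpha> = 0"
  using bivector_alternating[OF assms(1) cot_zero assms(2)] bivector_zero_right[OF assms] by simp

lemma form_eq_zero:
  assumes "\<theta> \<in> \<Omega>" "\<And>p v. v \<in> T p \<Longrightarrow> \<theta> p v = 0"
  shows "\<theta> = (\<lambda>p v. 0)"
proof
  fix p show "\<theta> p = (\<lambda>v. 0)"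
    by (rule covec_eqI[OF form_covec[OF assms(1)] cot_zero]) (rule assms(2))
qed

lemma tangent_power:
  assumes "v \<in> T p" "F \<in> C"
  shows "v (\<lambda>q. F q ^ n) = n * F p ^ (n - 1) * v F"
proof (induction n)
  case 0
  then show ?case by (simp add: tangent_const[OF assms(1)])
next
  case (Suc n)
  have "v (\<lambda>q. F q * F q ^ n) = F p * v (\<lambda>q. F q ^ n) + F p ^ n * v F"
    by (rule tangent_derivation(2)[OF assms smooth_power[OF assms(2)]])
  then show ?case using Suc by (cases n) (simp_all add: algebra_simps)
qed

lemma bracket_form:
  assumes "sharp A P \<omega> \<in> VF" "sharp A P \<eta> \<in> VF" "\<omega> \<in> \<Omega>" "\<eta> \<in> \<Omega>" "(\<lambda>p. P p (\<omega> p) (\<eta> p)) \<in> C"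
  shows "form_bracket A P \<omega> \<eta> \<in> \<Omega>"
  unfolding form_bracket_def using assms
  by (intro form_diff_closed lie_derivative(1) differential_form)

end

section \<open>Linear systems with smooth coefficients\<close>

text \<open>Gaussian elimination. The set \<open>R\<close> stands for a ring of functions in which every element that
does not vanish at \<open>p\<close> is invertible near \<open>p\<close>: the smooth functions, to show that solutions are
smooth, or the constant functions, for plain linear algebra at one point. As the system is
injective at \<open>p\<close>, every column has an entry that is invertible near \<open>p\<close> and can serve as
pivot.\<close>

lemma linear_system_germs:
  fixes R :: "('a::topological_space \<Rightarrow> real) set" and a :: "'i \<Rightarrow> 'j \<Rightarrow> 'a \<Rightarrow> real"
  assumes zero: "(\<lambda>x. 0) \<in> R" and add: "\<And>f g. f \<in> R \<Longrightarrow> g \<in> R \<Longrightarrow> (\<lambda>x. f x + g x) \<in> R"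
    and diff: "\<And>f g. f \<in> R \<Longrightarrow> g \<in> R \<Longrightarrow> (\<lambda>x. f x - g x) \<in> R"
    and mult: "\<And>f g. f \<in> R \<Longrightarrow> g \<in> R \<Longrightarrow> (\<lambda>x. f x * g x) \<in> R"
    and inv: "\<And>f. f \<in> R \<Longrightarrow> f p \<noteq> 0 \<Longrightarrow> \<exists>g\<in>R. \<forall>\<^sub>F x in nhds p. f x * g x = 1"
    and "finite J" "finite I" "card I = card J"
    and "\<And>i j. a i j \<in> R" "\<And>i. b i \<in> R"
    and "\<And>c. (\<And>i. i \<in> I \<Longrightarrow> (\<Sum>j\<in>J. a i j p * c j) = 0) \<Longrightarrow> (\<And>j. j \<in> J \<Longrightarrow> c j = 0)"
  shows "\<exists>c. (\<forall>j. c j \<in> R) \<and> (\<forall>\<^sub>F x in nhds p. \<forall>i\<in>I. (\<Sum>j\<in>J. a i j x * c j x) = b i x)"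
  using assms(6-)
proof (induction J arbitrary: I a b rule: finite_induct)
  case empty
  then have "I = {}" by simp
  then show ?case using zero by (intro exI[of _ "\<lambda>_ _. 0"]) auto
next
  case (insert j0 J)
  have "\<exists>i0\<in>I. a i0 j0 p \<noteq> 0"
  proof (rule ccontr)
    assume "\<not> (\<exists>i0\<in>I. a i0 j0 p \<noteq> 0)"
    then have "\<And>i. i \<in> I \<Longrightarrow> (\<Sum>j\<in>insert j0 J. a i j p * (if j = j0 then 1 else 0)) = 0"
      using insert.hyps by (auto intro!: sum.neutral)
    from insert.prems(5)[OF this, of j0] show False by simp
  qed
  then obtain i0 where i0: "i0 \<in> I" "a i0 j0 p \<noteq> 0" by blast
  obtain k where k: "k \<in> R" "\<forall>\<^sub>F x in nhds p. a i0 j0 x * k x = 1"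
    using inv[OF insert.prems(3) i0(2)] by blast
  have kp: "a i0 j0 p * k p = 1" using eventually_nhds_x_imp_x[OF k(2)] .
  define a' where "a' i j x = a i j x - a i j0 x * k x * a i0 j x" for i j x
  define b' where "b' i x = b i x - a i j0 x * k x * b i0 x" for i x
  have a': "a' i j \<in> R" for i j unfolding a'_def[abs_def] by (intro diff mult insert.prems k)
  have b': "b' i \<in> R" for i unfolding b'_def[abs_def] by (intro diff mult insert.prems k)
  have sum_a': "(\<Sum>j\<in>J. a' i j x * c j) = (\<Sum>j\<in>J. a i j x * c j) - a i j0 x * k x * (\<Sum>j\<in>J. a i0 j x * c j)"
    for i c x
    by (simp add: a'_def left_diff_distrib sum_subtractf sum_distrib_left mult.assoc)
  have card: "card (I - {i0}) = card J" using insert.prems(1,2) insert.hyps i0(1) by simp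
  have inj': "c j = 0" if c: "\<And>i. i \<in> I - {i0} \<Longrightarrow> (\<Sum>j\<in>J. a' i j p * c j) = 0" and j: "j \<in> J" for c j
  proof -
    \<comment> \<open>The value at \<open>j0\<close> is chosen so that the pivot equation holds.\<close>
    define e where "e = c(j0 := - k p * (\<Sum>j\<in>J. a i0 j p * c j))"
    have eJ: "(\<Sum>j\<in>J. a i j p * e j) = (\<Sum>j\<in>J. a i j p * c j)" for i
      by (rule sum.cong) (use insert.hyps in \<open>auto simp: e_def\<close>)
    have "(\<Sum>j\<in>insert j0 J. a i j p * e j) = 0" if "i \<in> I" for i
    proof -
      have "(\<Sum>j\<in>insert j0 J. a i j p * e j)
          = (\<Sum>j\<in>J. a i j p * c j) - a i j0 p * k p * (\<Sum>j\<in>J. a i0 j p * c j)"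
        using insert.hyps eJ by (simp add: e_def)
      also have "\<dots> = 0"
      proof (cases "i = i0")
        case True
        then show ?thesis using kp by simp
      next
        case False
        then show ?thesis using c[of i] that sum_a' by simp
      qed
      finally show ?thesis .
    qed
    then have "e j = 0" using insert.prems(5) j by blast
    then show ?thesis using j insert.hyps by (auto simp: e_def split: if_splits)
  qed
  have "\<exists>c. (\<forall>j. c j \<in> R) \<and> (\<forall>\<^sub>F x in nhds p. \<forall>i\<in>I - {i0}. (\<Sum>j\<in>J. a' i j x * c j x) = b' i x)"
  proof (rule insert.IH)
    show "c j = 0" if "\<And>i. i \<in> I - {i0} \<Longrightarrow> (\<Sum>j\<in>J. a' i j p * c j) = 0" "j \<in> J" for c j
      using that by (rule inj')
  qed (use card a' b' insert.prems(1) in simp_all)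
  then obtain c where c: "\<And>j. c j \<in> R" "\<forall>\<^sub>F x in nhds p. \<forall>i\<in>I - {i0}. (\<Sum>j\<in>J. a' i j x * c j x) = b' i x"
    by blast
  note aR = insert.prems(3)
  define s where "s x = b i0 x - (\<Sum>j\<in>J. a i0 j x * c j x)" for x
  have sumR: "(\<lambda>x. \<Sum>j\<in>K. a i0 j x * c j x) \<in> R" if "finite K" for K
    using that
  proof (induction K rule: finite_induct)
    case (insert j K)
    from add[OF mult[OF aR c(1)] insert.IH, of i0 j j] show ?case
      using insert.hyps by simp
  qed (simp add: zero)
  have s: "s \<in> R" unfolding s_def[abs_def] by (intro diff sumR insert)
  define e where "e = c(j0 := (\<lambda>x. k x * s x))"
  have "\<forall>j. e j \<in> R" using c k s by (auto simp: e_def intro: mult)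
  moreover have "\<forall>\<^sub>F x in nhds p. \<forall>i\<in>I. (\<Sum>j\<in>insert j0 J. a i j x * e j x) = b i x"
    using k(2) c(2)
  proof eventually_elim
    case (elim x)
    show ?case
    proof
      fix i assume i: "i \<in> I"
      have "(\<Sum>j\<in>J. a i j x * e j x) = (\<Sum>j\<in>J. a i j x * c j x)"
        by (rule sum.cong) (use insert.hyps in \<open>auto simp: e_def\<close>)
      then have *: "(\<Sum>j\<in>insert j0 J. a i j x * e j x) = a i j0 x * k x * s x + (\<Sum>j\<in>J. a i j x * c j x)"
        using insert.hyps by (simp add: e_def)
      show "(\<Sum>j\<in>insert j0 J. a i j x * e j x) = b i x"
      proof (cases "i = i0")
        case True
        then show ?thesis unfolding * using elim(1) by (simp add: s_def)
      next
        case False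
        then have "(\<Sum>j\<in>J. a' i j x * c j x) = b' i x" using elim(2) i by blast
        then show ?thesis
          unfolding * by (simp add: sum_a' b'_def s_def right_diff_distrib)
      qed
    qed
  qed
  ultimately show ?case by blast
qed

section \<open>Metrics and cometrics\<close>

text \<open>The pointwise properties of a metric. They give existence, symmetry and bilinearity of the
cometric, for a warped metric as well as for the metrics of its factors.\<close>

locale metric_manifold = smooth_manifold +
  fixes g :: "'a metric"
  assumes metric_lincomb: "\<And>p u v w a b. u \<in> tangent_space A p \<Longrightarrow> v \<in> tangent_space A p \<Longrightarrow> w \<in> tangent_space A p \<Longrightarrow>
      g p (\<lambda>f. a * u f + b * v f) w = a * g p u w + b * g p v w"
    and metric_sym: "\<And>p u v. u \<in> tangent_space A p \<Longrightarrow> v \<in> tangent_space A p \<Longrightarrow> g p u v = g p v u"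
    and metric_nondegenerate: "\<And>p u. u \<in> tangent_space A p \<Longrightarrow> (\<And>v. v \<in> tangent_space A p \<Longrightarrow> g p u v = 0)
      \<Longrightarrow> u = (\<lambda>f. 0)"
begin

definition flat :: "'a \<Rightarrow> 'a tvec \<Rightarrow> 'a covec" where
  "flat p u = (\<lambda>v. if v \<in> T p then g p u v else 0)"

lemma flat_covec:
  assumes "u \<in> T p" shows "flat p u \<in> CT p"
  by (rule cotI) (use assms metric_lincomb metric_sym tangent_lincomb in \<open>auto simp: flat_def\<close>)

text \<open>The Gram matrix of a frame is injective at a point because the metric is nondegenerate there.\<close>

lemma gram_system_solvable:
  assumes f: "frame W x E" "p \<in> W"
    and R: "(\<lambda>x. 0) \<in> R" "\<And>f g. f \<in> R \<Longrightarrow> g \<in> R \<Longrightarrow> (\<lambda>x. f x + g x) \<in> R"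
    "\<And>f g. f \<in> R \<Longrightarrow> g \<in> R \<Longrightarrow> (\<lambda>x. f x - g x) \<in> R"
    "\<And>f g. f \<in> R \<Longrightarrow> g \<in> R \<Longrightarrow> (\<lambda>x. f x * g x) \<in> R"
    "\<And>f. f \<in> R \<Longrightarrow> f p \<noteq> 0 \<Longrightarrow> \<exists>g\<in>R. \<forall>\<^sub>F x in nhds p. f x * g x = 1"
    and G: "\<And>i j. G i j \<in> R" "\<And>i j. G i j p = g p (E j p) (E i p)"
    and b: "\<And>i. b i \<in> R"
  shows "\<exists>c. (\<forall>j. c j \<in> R) \<and> (\<forall>\<^sub>F q in nhds p. \<forall>i\<in>Basis. (\<Sum>j\<in>Basis. G i j q * c j q) = b i q)"
proof (rule linear_system_germs[OF R])
  fix c j assume c: "\<And>i. i \<in> Basis \<Longrightarrow> (\<Sum>j\<in>Basis. G i j p * c j) = 0" and j: "j \<in> (Basis :: 'b set)"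
  have E: "E i p \<in> T p" for i using f by (simp add: frame_def VF_tangent)
  define u where "u = (\<lambda>F. \<Sum>j\<in>Basis. c j * E j p F)"
  have u: "u \<in> T p" unfolding u_def by (intro tangent_sum E)
  have gE: "g p u (E i p) = 0" if "i \<in> Basis" for i
  proof -
    have "g p u (E i p) = flat p (E i p) u" using u E metric_sym by (simp add: flat_def)
    also have "\<dots> = (\<Sum>j\<in>Basis. c j * flat p (E i p) (E j p))"
      unfolding u_def by (rule covec_sum[OF flat_covec[OF E] E])
    also have "\<dots> = 0" using c[OF that] E G(2) metric_sym by (simp add: flat_def mult.commute)
    finally show ?thesis .
  qed
  have "u = (\<lambda>f. 0)"
  proof (rule metric_nondegenerate[OF u])
    fix v assume v: "v \<in> T p"
    have "g p u v = (\<Sum>i\<in>Basis. v (x i) * flat p u (E i p))"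
      using covec_frame[OF f flat_covec[OF u] v] v by (simp add: flat_def)
    then show "g p u v = 0" using gE E by (simp add: flat_def)
  qed
  then have "0 = (\<Sum>i\<in>Basis. c i * E i p (x j))" unfolding u_def by metis
  also have "\<dots> = (\<Sum>i\<in>Basis. c i * (if i = j then 1 else 0))"
    by (rule sum.cong) (use f j in \<open>auto simp: frame_def\<close>)
  also have "\<dots> = c j" using j by (simp add: if_distrib cong: if_cong)
  finally show "c j = 0" by simp
qed (use G b in auto)

lemma metric_sharp_exists:
  assumes "\<alpha> \<in> CT p"
  shows "\<exists>u\<in>T p. \<forall>v\<in>T p. g p u v = \<alpha> v"
proof -
  obtain W x E where f: "frame W x E" "p \<in> W" by (rule frame_at)
  have E: "E i p \<in> T p" for i using f by (simp add: frame_def VF_tangent)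

  obtain c where c: "\<forall>\<^sub>F q in nhds p. \<forall>i\<in>Basis. (\<Sum>j\<in>Basis. g p (E j p) (E i p) * c j q) = \<alpha> (E i p)"
  proof -
    let ?R = "range (\<lambda>(k::real) (q::'a). k)"
    have "\<exists>c. (\<forall>j. c j \<in> ?R) \<and> (\<forall>\<^sub>F q in nhds p. \<forall>i\<in>Basis. (\<Sum>j\<in>Basis. g p (E j p) (E i p) * c j q) = \<alpha> (E i p))"
    proof (rule gram_system_solvable[OF f, where R = ?R and G = "\<lambda>i j q. g p (E j p) (E i p)" and b = "\<lambda>i q. \<alpha> (E i p)"])
      fix h assume h: "h \<in> ?R" "h p \<noteq> 0"
      then show "\<exists>k\<in>?R. \<forall>\<^sub>F x in nhds p. h x * k x = 1"
        by (intro bexI[of _ "\<lambda>q. inverse (h p)"]) auto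
    qed (auto simp: image_def)
    then show ?thesis using that by blast
  qed
  define u where "u = (\<lambda>F. \<Sum>j\<in>Basis. c j p * E j p F)"
  have u: "u \<in> T p" unfolding u_def by (intro tangent_sum E)
  have gE: "g p u (E i p) = \<alpha> (E i p)" if "i \<in> Basis" for i
  proof -
    have "g p u (E i p) = flat p (E i p) u" using u E metric_sym by (simp add: flat_def)
    also have "\<dots> = (\<Sum>j\<in>Basis. c j p * flat p (E i p) (E j p))"
      unfolding u_def by (rule covec_sum[OF flat_covec[OF E] E])
    also have "\<dots> = (\<Sum>j\<in>Basis. g p (E j p) (E i p) * c j p)"
      using E metric_sym by (simp add: flat_def mult.commute)
    also have "\<dots> = \<alpha> (E i p)" using eventually_nhds_x_imp_x[OF c] that by blast
    finally show ?thesis .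
  qed
  have "g p u v = \<alpha> v" if v: "v \<in> T p" for v
    using covec_frame[OF f flat_covec[OF u] v] covec_frame[OF f assms v] v gE E by (simp add: flat_def)
  then show ?thesis using u by blast
qed

lemma metric_sharp_eqI:
  assumes u: "u \<in> T p" and g: "\<And>v. v \<in> T p \<Longrightarrow> g p u v = \<alpha> v"
  shows "metric_sharp A g p \<alpha> = u"
  unfolding metric_sharp_def
proof (rule the_equality)
  fix w assume w: "w \<in> T p \<and> (\<forall>v\<in>T p. g p w v = \<alpha> v)"
  have "(\<lambda>f. 1 * w f + (-1) * u f) = (\<lambda>f. 0)"
    using w u g metric_lincomb[of w p u _ 1 "-1"] tangent_lincomb[of w p u 1 "-1"]
    by (intro metric_nondegenerate[of _ p]) auto
  then show "w = u" by (simp add: fun_eq_iff)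
qed (use assms in auto)

lemma metric_sharp:
  assumes "\<alpha> \<in> CT p"
  shows "metric_sharp A g p \<alpha> \<in> T p" "v \<in> T p \<Longrightarrow> g p (metric_sharp A g p \<alpha>) v = \<alpha> v"
  using metric_sharp_exists[OF assms] metric_sharp_eqI by metis+

lemma cometric_eq:
  assumes "\<alpha> \<in> CT p" "\<beta> \<in> CT p"
  shows "cometric A g p \<alpha> \<beta> = \<alpha> (metric_sharp A g p \<beta>)"
  using assms by (simp add: cometric_def metric_sharp)

lemma cometric_sym:
  assumes "\<alpha> \<in> CT p" "\<beta> \<in> CT p"
  shows "cometric A g p \<alpha> \<beta> = cometric A g p \<beta> \<alpha>"
  using assms metric_sym metric_sharp by (simp add: cometric_def)

lemma cometric_flat:
  assumes "\<alpha> \<in> CT p" "u \<in> T p"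
  shows "cometric A g p \<alpha> (flat p u) = \<alpha> u"
proof -
  have "metric_sharp A g p (flat p u) = u"
    by (rule metric_sharp_eqI) (use assms in \<open>auto simp: flat_def\<close>)
  then show ?thesis using assms flat_covec by (simp add: cometric_eq)
qed

lemma cometric_lincomb_left:
  assumes "\<alpha> \<in> CT p" "\<beta> \<in> CT p" "\<gamma> \<in> CT p"
  shows "cometric A g p (\<lambda>v. a * \<alpha> v + b * \<beta> v) \<gamma> = a * cometric A g p \<alpha> \<gamma> + b * cometric A g p \<beta> \<gamma>"
  using assms by (simp add: cometric_eq cot_lincomb)

lemma cometric_lincomb_right:
  assumes "\<alpha> \<in> CT p" "\<beta> \<in> CT p" "\<gamma> \<in> CT p"
  shows "cometric A g p \<gamma> (\<lambda>v. a * \<alpha> v + b * \<beta> v) = a * cometric A g p \<gamma> \<alpha> + b * cometric A g p \<gamma> \<beta>"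
  using assms by (simp add: cometric_sym[of \<gamma>] cot_lincomb cometric_lincomb_left)

lemma cometric_eqI:
  assumes "\<alpha> \<in> CT p" "\<beta> \<in> CT p" "\<And>\<gamma>. \<gamma> \<in> CT p \<Longrightarrow> cometric A g p \<alpha> \<gamma> = cometric A g p \<beta> \<gamma>"
  shows "\<alpha> = \<beta>"
  by (rule covec_eqI[OF assms(1,2)]) (metis assms cometric_flat flat_covec)

lemma endo_J_covec:
  assumes "bivector_field A P" "\<omega> p \<in> CT p"
  shows "endo_J A g P \<omega> p \<in> CT p"
    "\<And>\<eta>. \<eta> \<in> CT p \<Longrightarrow> cometric A g p (endo_J A g P \<omega> p) \<eta> = P p (\<omega> p) \<eta>"
proof -
  let ?Q = "\<lambda>\<beta>. \<beta> \<in> CT p \<and> (\<forall>\<eta>\<in>CT p. P p (\<omega> p) \<eta> = cometric A g p \<beta> \<eta>)"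
  have "?Q (flat p (sharp A P \<omega> p))"
    using sharp_tangent[where P = P and \<omega> = \<omega> and p = p, OF assms]
    by (simp add: flat_covec cometric_flat cometric_sym[OF flat_covec])
  moreover have "\<beta> = \<beta>'" if "?Q \<beta>" "?Q \<beta>'" for \<beta> \<beta>'
    using that by (intro cometric_eqI) auto
  ultimately have "\<exists>!\<beta>. ?Q \<beta>" by blast
  from theI'[OF this] show "endo_J A g P \<omega> p \<in> CT p"
    "\<And>\<eta>. \<eta> \<in> CT p \<Longrightarrow> cometric A g p (endo_J A g P \<omega> p) \<eta> = P p (\<omega> p) \<eta>"
    by (auto simp: endo_J_def)
qed

lemma metric_zero_left: "v \<in> T p \<Longrightarrow> g p (\<lambda>f. 0) v = 0"
  using metric_lincomb[of "\<lambda>f. 0" p "\<lambda>f. 0" v 0 0] tangent_zero by simp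

lemma metric_zero_right: "v \<in> T p \<Longrightarrow> g p v (\<lambda>f. 0) = 0"
  using metric_zero_left metric_sym tangent_zero by metis

lemma cometric_lincomb3_left:
  assumes "\<alpha> \<in> CT p" "\<beta> \<in> CT p" "\<gamma> \<in> CT p" "\<delta> \<in> CT p"
  shows "cometric A g p (\<lambda>v. a * \<alpha> v + (b * \<beta> v + c * \<gamma> v)) \<delta>
    = a * cometric A g p \<alpha> \<delta> + b * cometric A g p \<beta> \<delta> + c * cometric A g p \<gamma> \<delta>"
  using cometric_lincomb_left[OF assms(1) cot_lincomb[OF assms(2,3)] assms(4), of a 1 b c]
    cometric_lincomb_left[OF assms(2,3,4)] by simp

lemma cot_lincomb3:
  assumes "\<alpha> \<in> CT p" "\<beta> \<in> CT p" "\<gamma> \<in> CT p"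
  shows "(\<lambda>v. a * \<alpha> v + (b * \<beta> v + c * \<gamma> v)) \<in> CT p"
  using cot_lincomb[OF assms(1) cot_lincomb[OF assms(2,3)], of a 1 b c] by simp

lemma cometric_diff_left:
  assumes "\<alpha> \<in> CT p" "\<beta> \<in> CT p" "\<gamma> \<in> CT p"
  shows "cometric A g p (\<lambda>v. \<alpha> v - \<beta> v) \<gamma> = cometric A g p \<alpha> \<gamma> - cometric A g p \<beta> \<gamma>"
  using cometric_lincomb_left[OF assms, of 1 "-1"] by simp

lemma cometric_zero_left: "\<alpha> \<in> CT p \<Longrightarrow> cometric A g p (\<lambda>v. 0) \<alpha> = 0"
  using cometric_lincomb_left[of "\<lambda>v. 0" p "\<lambda>v. 0" \<alpha> 0 0] cot_zero by simp

lemma form_inner_sym: "\<omega> \<in> \<Omega> \<Longrightarrow> \<eta> \<in> \<Omega> \<Longrightarrow> form_inner A g \<omega> \<eta> p = form_inner A g \<eta> \<omega> p"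
  by (simp add: form_inner_def cometric_sym form_covec)

lemma form_inner_diff:
  "\<omega> \<in> \<Omega> \<Longrightarrow> \<eta> \<in> \<Omega> \<Longrightarrow> \<gamma> \<in> \<Omega> \<Longrightarrow>
   form_inner A g (form_diff \<omega> \<eta>) \<gamma> p = form_inner A g \<omega> \<gamma> p - form_inner A g \<eta> \<gamma> p"
  unfolding form_inner_def form_diff_def by (rule cometric_diff_left) (rule form_covec, assumption)+

end

locale smooth_metric_manifold = metric_manifold +
  assumes metric_smooth: "\<And>X Y. X \<in> vector_fields A \<Longrightarrow> Y \<in> vector_fields A \<Longrightarrow> (\<lambda>p. g p (X p) (Y p)) \<in> smooth_funs A"
begin

text \<open>The vector field dual to \<open>\<eta>\<close> has smooth coefficients with respect to a frame, because
they solve a linear system whose matrix is the Gram matrix of the frame.\<close>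

lemma form_inner_smooth:
  assumes \<omega>: "\<omega> \<in> \<Omega>" and \<eta>: "\<eta> \<in> \<Omega>"
  shows "form_inner A g \<omega> \<eta> \<in> C"
proof (rule smooth_funs_local)
  fix p
  obtain W x E where f: "frame W x E" "p \<in> W" by (rule frame_at)
  have E: "E i \<in> VF" for i using f by (simp add: frame_def)
  have "\<exists>c. (\<forall>j. c j \<in> C) \<and> (\<forall>\<^sub>F q in nhds p. \<forall>i\<in>Basis. (\<Sum>j\<in>Basis. g q (E j q) (E i q) * c j q) = \<eta> q (E i q))"
  proof (rule gram_system_solvable[OF f smooth_const smooth_add smooth_diff smooth_mult])
    show "\<exists>g\<in>C. \<forall>\<^sub>F x in nhds p. F x * g x = 1" if "F \<in> C" "F p \<noteq> 0" for F
      using smooth_local_inverse[OF that] by blast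
    show "(\<lambda>q. g q (E j q) (E i q)) \<in> C" for i j by (rule metric_smooth[OF E E])
    show "(\<lambda>q. \<eta> q (E i q)) \<in> C" for i by (rule form_smooth[OF \<eta> E])
  qed simp_all
  then obtain c where c: "\<And>j. c j \<in> C"
    "\<forall>\<^sub>F q in nhds p. \<forall>i\<in>Basis. (\<Sum>j\<in>Basis. g q (E j q) (E i q) * c j q) = \<eta> q (E i q)"
    by blast
  then obtain V where V: "open V" "p \<in> V"
    "\<And>q i. q \<in> V \<Longrightarrow> i \<in> Basis \<Longrightarrow> (\<Sum>j\<in>Basis. g q (E j q) (E i q) * c j q) = \<eta> q (E i q)"
    unfolding eventually_nhds by metis
  have "form_inner A g \<omega> \<eta> q = (\<Sum>j\<in>Basis. c j q * \<omega> q (E j q))" if q: "q \<in> V \<inter> W" for q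
  proof -
    have Eq: "E i q \<in> T q" for i using E VF_tangent by blast
    have \<eta>q: "\<eta> q \<in> CT q" and \<omega>q: "\<omega> q \<in> CT q" using \<omega> \<eta> form_covec by auto
    define u where "u = (\<lambda>F. \<Sum>j\<in>Basis. c j q * E j q F)"
    have u: "u \<in> T q" unfolding u_def by (intro tangent_sum Eq)
    have gE: "g q u (E i q) = \<eta> q (E i q)" if "i \<in> Basis" for i
    proof -
      have "g q u (E i q) = flat q (E i q) u" using u Eq metric_sym by (simp add: flat_def)
      also have "\<dots> = (\<Sum>j\<in>Basis. c j q * flat q (E i q) (E j q))"
        unfolding u_def by (rule covec_sum[OF flat_covec[OF Eq] Eq])
      also have "\<dots> = (\<Sum>j\<in>Basis. g q (E j q) (E i q) * c j q)"
        using Eq metric_sym by (simp add: flat_def mult.commute)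
      also have "\<dots> = \<eta> q (E i q)" using V(3) q that by blast
      finally show ?thesis .
    qed
    have "metric_sharp A g q (\<eta> q) = u"
    proof (rule metric_sharp_eqI[OF u])
      fix v assume v: "v \<in> T q"
      show "g q u v = \<eta> q v"
        using covec_frame[OF f(1) _ flat_covec[OF u] v] covec_frame[OF f(1) _ \<eta>q v] v gE Eq q by (simp add: flat_def)
    qed
    then have "form_inner A g \<omega> \<eta> q = \<omega> q u"
      by (simp add: form_inner_def cometric_eq \<omega>q \<eta>q)
    also have "\<dots> = (\<Sum>j\<in>Basis. c j q * \<omega> q (E j q))"
      unfolding u_def by (rule covec_sum[OF \<omega>q Eq])
    finally show ?thesis .
  qed
  moreover have "(\<lambda>q. \<Sum>j\<in>Basis. c j q * \<omega> q (E j q)) \<in> C"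
    by (rule smooth_sum[OF smooth_mult[OF c(1) form_smooth[OF \<omega> E]]])
  moreover have "open (V \<inter> W)" using V f by (auto simp: frame_def)
  ultimately show "\<exists>W G. open W \<and> p \<in> W \<and> G \<in> C \<and> (\<forall>q\<in>W. form_inner A g \<omega> \<eta> q = G q)"
    using V f by blast
qed

lemma flat_form:
  assumes "Y \<in> VF" shows "(\<lambda>p. flat p (Y p)) \<in> \<Omega>"
proof -
  have "(\<lambda>p. flat p (Y p) (X p)) \<in> C" if "X \<in> VF" for X
    using metric_smooth[OF assms that] VF_tangent[OF that] by (simp add: flat_def)
  then show ?thesis
    using flat_covec[OF VF_tangent[OF assms]] by (simp add: one_forms_def)
qed

text \<open>Evaluated on a vector field \<open>Y\<close>, the covector \<open>J \<omega>\<close> is the pairing of \<open>\<omega>\<close> with the one-form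
dual to \<open>Y\<close> under the bivector field.\<close>

lemma endo_J_form:
  assumes P: "bivector_field A P" and \<omega>: "\<omega> \<in> \<Omega>"
  shows "endo_J A g P \<omega> \<in> \<Omega>"
proof -
  have "endo_J A g P \<omega> p (Y p) = P p (\<omega> p) (flat p (Y p))" if "Y \<in> VF" for p Y
  proof -
    have Y: "Y p \<in> T p" by (rule VF_tangent[OF that])
    have J: "endo_J A g P \<omega> p \<in> CT p"
      "cometric A g p (endo_J A g P \<omega> p) (flat p (Y p)) = P p (\<omega> p) (flat p (Y p))"
      using endo_J_covec[where P = P and \<omega> = \<omega> and p = p, OF P form_covec[OF \<omega>]] flat_covec[OF Y] by auto
    then show ?thesis using cometric_flat[OF J(1) Y] by simp
  qed
  then show ?thesis
    using endo_J_covec(1)[where P = P and \<omega> = \<omega>, OF P form_covec[OF \<omega>]] bivector_smooth[OF P \<omega> flat_form]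
    by (simp add: one_forms_def)
qed

end

section \<open>Smooth maps and pull-backs\<close>

text \<open>The two projections of a product and the inclusions of its slices are treated together as
smooth maps.\<close>

locale smooth_map = dom: smooth_manifold A + cod: smooth_manifold B
  for A :: "('m::{t2_space,second_countable_topology}, 'e::euclidean_space) chart set"
    and B :: "('n::{t2_space,second_countable_topology}, 'f::euclidean_space) chart set" +
  fixes \<Phi> :: "'m \<Rightarrow> 'n"
  assumes continuous: "continuous_on UNIV \<Phi>"
    and smooth_comp: "\<And>F. F \<in> smooth_funs B \<Longrightarrow> F \<circ> \<Phi> \<in> smooth_funs A"
begin

abbreviation "push \<equiv> pushforward B \<Phi>"
abbreviation "pull \<equiv> pullback_form A B \<Phi>"

lemma push_apply: "F \<in> cod.C \<Longrightarrow> push v F = v (F \<circ> \<Phi>)"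
  by (simp add: pushforward_def)

text \<open>In charts, the coordinates of the pushed vector are its derivatives of the coordinates of the
target, pulled back to the domain. The chain rule needs a differentiable map between the charts,
which is obtained componentwise from the smoothness of these functions.\<close>

lemma push_tangent:
  assumes v: "v \<in> dom.T p"
  shows "push v \<in> cod.T (\<Phi> p)"
proof -
  obtain V \<psi> where V: "(V, \<psi>) \<in> B" "\<Phi> p \<in> V" by (rule cod.chart_at)
  obtain W y E where f: "cod.frame W y E" "\<Phi> p \<in> W" "W \<subseteq> V"
    and y: "\<And>i q. q \<in> W \<Longrightarrow> y i q = \<psi> q \<bullet> i"
    by (rule cod.frame_at_chart[OF V]) (rule that)
  note yC = cod.frame_parts(2)[OF f(1)]
  obtain U \<phi> where U: "(U, \<phi>) \<in> A" "p \<in> U" by (rule dom.chart_at)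
  obtain w where w: "v = dom.chart_vec U \<phi> p w" by (rule dom.tangent_chart_vec[OF v U])
  let ?i = "inv_into U \<phi>" and ?k = "inv_into V \<psi>"
  let ?\<Theta> = "\<psi> \<circ> \<Phi> \<circ> ?i"
  define \<Theta>' where "\<Theta>' h = (\<Sum>i\<in>Basis. frechet_derivative ((y i \<circ> \<Phi>) \<circ> ?i) (at (\<phi> p)) h *\<^sub>R i)" for h
  define O' where "O' = \<phi> ` (U \<inter> \<Phi> -` W)"
  have "open (\<Phi> -` W)"
    by (rule open_vimage[OF cod.frame_parts(1)[OF f(1)] continuous])
  then have O': "open O'" "\<phi> p \<in> O'"
    using dom.chart_image_open[OF U(1) open_Int[OF dom.chart(1)[OF U(1)]]] U f by (auto simp: O'_def)
  have "((\<lambda>x. ?\<Theta> x \<bullet> i) has_derivative (\<lambda>h. \<Theta>' h \<bullet> i)) (at (\<phi> p))" if i: "i \<in> Basis" for i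
  proof -
    have "(((y i \<circ> \<Phi>) \<circ> ?i) has_derivative (\<lambda>h. \<Theta>' h \<bullet> i)) (at (\<phi> p))"
      using dom.smooth_funs_has_derivative[OF smooth_comp[OF yC] U, of i] i
      by (simp add: \<Theta>'_def inner_sum_left inner_Basis if_distrib cong: if_cong)
    then show ?thesis
      by (rule has_derivative_transform_within_open[OF _ O'])
        (use y dom.chart(4)[OF U(1)] in \<open>auto simp: O'_def\<close>)
  qed
  then have \<Theta>: "(?\<Theta> has_derivative \<Theta>') (at (\<phi> p))"
    using has_derivative_componentwise_within[of ?\<Theta> \<Theta>' "\<phi> p" UNIV] by simp
  have "push v F = cod.chart_vec V \<psi> (\<Phi> p) (\<Theta>' w) F" for F
  proof (cases "F \<in> cod.C")
    case True
    let ?D = "frechet_derivative (F \<circ> ?k) (at (\<psi> (\<Phi> p)))"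
    have "((F \<circ> ?k) has_derivative ?D) (at (?\<Theta> (\<phi> p)))"
      using cod.smooth_funs_has_derivative[OF True V] dom.chart(4)[OF U] by simp
    from diff_chain_at[OF \<Theta> this]
    have "((F \<circ> \<Phi> \<circ> ?i) has_derivative (?D \<circ> \<Theta>')) (at (\<phi> p))"
      by (rule has_derivative_transform_within_open[OF _ O'])
        (use f(3) dom.chart(4)[OF U(1)] cod.chart(4)[OF V(1)] in \<open>auto simp: O'_def subset_iff\<close>)
    then have "frechet_derivative (F \<circ> \<Phi> \<circ> ?i) (at (\<phi> p)) w = ?D (\<Theta>' w)"
      using frechet_derivative_at by (metis comp_apply)
    then show ?thesis
      using True smooth_comp[OF True] by (simp add: push_apply w dom.chart_vec_def cod.chart_vec_def)
  qed (simp add: pushforward_def cod.chart_vec_def)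
  then have "push v = cod.chart_vec V \<psi> (\<Phi> p) (\<Theta>' w)" by blast
  then show ?thesis using cod.tangent_space_chart[OF V] by simp
qed

lemma push_lincomb: "push (\<lambda>F. a * u F + b * v F) = (\<lambda>F. a * push u F + b * push v F)"
  by (auto simp: pushforward_def)

lemma pull_covec_apply: "v \<in> dom.T p \<Longrightarrow> pullback_covec A B \<Phi> p \<beta> v = \<beta> (push v)"
  by (simp add: pullback_covec_def)

lemma pull_covec: "\<beta> \<in> cod.CT (\<Phi> p) \<Longrightarrow> pullback_covec A B \<Phi> p \<beta> \<in> dom.CT p"
  by (rule dom.cotI)
    (auto simp: pull_covec_apply dom.tangent_lincomb push_lincomb cod.covec_lincomb push_tangent,
      simp add: pullback_covec_def)

lemma pull_apply: "v \<in> dom.T p \<Longrightarrow> pull \<omega> p v = \<omega> (\<Phi> p) (push v)"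
  by (simp add: pullback_form_def pull_covec_apply)

lemma pull_local_rep:
  assumes "\<omega> \<in> cod.\<Omega>"
  obtains W and h x :: "'f \<Rightarrow> 'n \<Rightarrow> real" where "open W" "\<Phi> p \<in> W" "\<And>i. h i \<in> cod.C" "\<And>i. x i \<in> cod.C"
    "\<And>q v. q \<in> W \<Longrightarrow> v \<in> cod.T q \<Longrightarrow> \<omega> q v = (\<Sum>i\<in>(Basis::'f set). h i q * v (x i))"
    "open (\<Phi> -` W)" "p \<in> \<Phi> -` W"
    "\<And>q v. q \<in> \<Phi> -` W \<Longrightarrow> v \<in> dom.T q \<Longrightarrow> pull \<omega> q v = (\<Sum>i\<in>(Basis::'f set). (h i \<circ> \<Phi>) q * v (x i \<circ> \<Phi>))"
proof -
  obtain W and h x :: "'f \<Rightarrow> 'n \<Rightarrow> real" where W: "open W" "\<Phi> p \<in> W"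
    and h: "\<And>i. h i \<in> cod.C" and x: "\<And>i. x i \<in> cod.C"
    and rep: "\<And>q v. q \<in> W \<Longrightarrow> v \<in> cod.T q \<Longrightarrow> \<omega> q v = (\<Sum>i\<in>(Basis::'f set). h i q * v (x i))"
    by (rule cod.form_local_rep[OF assms]) (rule that)
  have o: "open (\<Phi> -` W)" "p \<in> \<Phi> -` W"
    using open_vimage[OF W(1) continuous] W(2) by auto
  have pull_rep: "pull \<omega> q v = (\<Sum>i\<in>(Basis::'f set). (h i \<circ> \<Phi>) q * v (x i \<circ> \<Phi>))"
    if "q \<in> \<Phi> -` W" "v \<in> dom.T q" for q v
    using rep[of "\<Phi> q" "push v"] that push_tangent[OF that(2)] by (simp add: pull_apply push_apply x)
  show ?thesis by (rule that[OF W h x rep o pull_rep])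
qed

lemma pull_form:
  assumes "\<omega> \<in> cod.\<Omega>" shows "pull \<omega> \<in> dom.\<Omega>"
proof -
  have "pull \<omega> p \<in> dom.CT p" for p
    unfolding pullback_form_def by (rule pull_covec[OF cod.form_covec[OF assms]])
  moreover have "(\<lambda>p. pull \<omega> p (Y p)) \<in> dom.C" if Y: "Y \<in> dom.VF" for Y
  proof (rule dom.smooth_funs_local)
    fix p
    obtain W and h x :: "'f \<Rightarrow> 'n \<Rightarrow> real" where h: "\<And>i. h i \<in> cod.C" and x: "\<And>i. x i \<in> cod.C"
      and W: "open (\<Phi> -` W)" "p \<in> \<Phi> -` W"
      and rep: "\<And>q v. q \<in> \<Phi> -` W \<Longrightarrow> v \<in> dom.T q \<Longrightarrow> pull \<omega> q v = (\<Sum>i\<in>(Basis::'f set). (h i \<circ> \<Phi>) q * v (x i \<circ> \<Phi>))"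
      by (rule pull_local_rep[OF assms, of p]) (rule that)
    have "(\<lambda>q. \<Sum>i\<in>Basis. (h i \<circ> \<Phi>) q * Y q (x i \<circ> \<Phi>)) \<in> dom.C"
      by (rule dom.smooth_sum[OF dom.smooth_mult[OF smooth_comp[OF h] dom.VF_smooth[OF Y smooth_comp[OF x]]]])
    then show "\<exists>W G. open W \<and> p \<in> W \<and> G \<in> dom.C \<and> (\<forall>q\<in>W. pull \<omega> q (Y q) = G q)"
      using W rep[OF _ dom.VF_tangent[OF Y]] by blast
  qed
  ultimately show ?thesis by (simp add: one_forms_def)
qed

text \<open>The vector field \<open>X\<close> is related to \<open>k\<close> times \<open>Y\<close> along the map. The function \<open>k\<close> lives on the
domain because the horizontal function \<open>\<nu>\<close> multiplies vertical vector fields in a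
warped product. Both sides are evaluated with the local formula for Lie derivatives, where
the pull-back of \<open>h\<^sub>i dx\<^sub>i\<close> is \<open>(h\<^sub>i \<circ> \<Phi>) d(x\<^sub>i \<circ> \<Phi>)\<close>; the last term comes from
differentiating \<open>k\<close>.\<close>

lemma lie_derivative_pull:
  assumes X: "X \<in> dom.VF" and Y: "Y \<in> cod.VF" and \<eta>: "\<eta> \<in> cod.\<Omega>" and k: "k \<in> dom.C"
    and XF: "\<And>F p. F \<in> cod.C \<Longrightarrow> X p (F \<circ> \<Phi>) = k p * Y (\<Phi> p) F"
    and v: "v \<in> dom.T p"
  shows "lie_derivative A X (pull \<eta>) p v
    = k p * lie_derivative B Y \<eta> (\<Phi> p) (push v) + v k * \<eta> (\<Phi> p) (Y (\<Phi> p))"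
proof -
  obtain W and h x :: "'f \<Rightarrow> 'n \<Rightarrow> real" where W: "open W" "\<Phi> p \<in> W"
    and h: "\<And>i. h i \<in> cod.C" and x: "\<And>i. x i \<in> cod.C"
    and rep_cod: "\<And>q v. q \<in> W \<Longrightarrow> v \<in> cod.T q \<Longrightarrow> \<eta> q v = (\<Sum>i\<in>(Basis::'f set). h i q * v (x i))"
    and WW: "open (\<Phi> -` W)" "p \<in> \<Phi> -` W"
    and rep: "\<And>q v. q \<in> \<Phi> -` W \<Longrightarrow> v \<in> dom.T q \<Longrightarrow> pull \<eta> q v = (\<Sum>i\<in>(Basis::'f set). (h i \<circ> \<Phi>) q * v (x i \<circ> \<Phi>))"
    by (rule pull_local_rep[OF \<eta>, of p]) (rule that)
  have d: "v (\<lambda>q. X q (x i \<circ> \<Phi>)) = k p * push v (\<lambda>q. Y q (x i)) + Y (\<Phi> p) (x i) * v k" for i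
    using dom.tangent_derivation(2)[OF v k smooth_comp[OF cod.VF_smooth[OF Y x]], of i]
    unfolding XF[OF x] push_apply[OF cod.VF_smooth[OF Y x]] unfolding comp_def by simp
  have "lie_derivative A X (pull \<eta>) p v = (\<Sum>i\<in>Basis. X p (h i \<circ> \<Phi>) * v (x i \<circ> \<Phi>)
      + (h i \<circ> \<Phi>) p * v (\<lambda>q. X q (x i \<circ> \<Phi>)))"
    by (rule dom.lie_derivative_local[OF X pull_form[OF \<eta>] WW smooth_comp[OF h] smooth_comp[OF x] rep v])
  also have "\<dots> = (\<Sum>i\<in>Basis. k p * (Y (\<Phi> p) (h i) * push v (x i) + h i (\<Phi> p) * push v (\<lambda>q. Y q (x i)))
      + v k * (h i (\<Phi> p) * Y (\<Phi> p) (x i)))"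
    unfolding d by (simp add: XF[OF h] push_apply[OF x] algebra_simps)
  also have "\<dots> = k p * (\<Sum>i\<in>Basis. Y (\<Phi> p) (h i) * push v (x i) + h i (\<Phi> p) * push v (\<lambda>q. Y q (x i)))
      + v k * (\<Sum>i\<in>Basis. h i (\<Phi> p) * Y (\<Phi> p) (x i))"
    unfolding sum_distrib_left by (rule sum.distrib)
  also have "(\<Sum>i\<in>Basis. Y (\<Phi> p) (h i) * push v (x i) + h i (\<Phi> p) * push v (\<lambda>q. Y q (x i)))
      = lie_derivative B Y \<eta> (\<Phi> p) (push v)"
    by (rule cod.lie_derivative_local[OF Y \<eta> W h x rep_cod push_tangent[OF v], symmetric])
  also have "(\<Sum>i\<in>Basis. h i (\<Phi> p) * Y (\<Phi> p) (x i)) = \<eta> (\<Phi> p) (Y (\<Phi> p))"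
    by (rule rep_cod[OF W(2) cod.VF_tangent[OF Y], symmetric])
  finally show ?thesis .
qed

end

lemma smooth_mapI:
  assumes A: "smooth_manifold A" and B: "smooth_manifold B" and cont: "continuous_on UNIV \<Phi>"
    and charts: "\<And>p. \<exists>U \<phi> V \<psi>. (U, \<phi>) \<in> A \<and> p \<in> U \<and> (V, \<psi>) \<in> B \<and> \<Phi> ` U \<subseteq> V \<and>
      smooth_on (\<phi> ` U) (\<psi> \<circ> \<Phi> \<circ> inv_into U \<phi>)"
  shows "smooth_map A B \<Phi>"
proof -
  interpret dom: smooth_manifold A by (rule A)
  interpret cod: smooth_manifold B by (rule B)
  show ?thesis
  proof
    fix F assume F: "F \<in> cod.C"
    show "F \<circ> \<Phi> \<in> dom.C"
    proof (rule dom.smooth_funsI_chart_at)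
      fix p
      obtain U \<phi> V \<psi> where U: "(U, \<phi>) \<in> A" "p \<in> U" and V: "(V, \<psi>) \<in> B" and UV: "\<Phi> ` U \<subseteq> V"
        and s: "smooth_on (\<phi> ` U) (\<psi> \<circ> \<Phi> \<circ> inv_into U \<phi>)"
        using charts[of p] by auto
      note o = dom.chart(2)[OF U(1)]
      have "smooth_on (\<phi> ` U) (\<lambda>x. (F \<circ> inv_into V \<psi>) ((\<psi> \<circ> \<Phi> \<circ> inv_into U \<phi>) x))"
        by (rule smooth_on_compose[OF o cod.chart(2)[OF V] _ s cod.smooth_funs_chart[OF F V]])
          (use UV dom.chart(4)[OF U(1)] in auto)
      then have "smooth_on (\<phi> ` U) (F \<circ> \<Phi> \<circ> inv_into U \<phi>)"
        by (rule smooth_on_cong[OF o]) (use UV dom.chart(4)[OF U(1)] cod.chart(4)[OF V] in auto)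
      then show "\<exists>U \<phi> W. (U, \<phi>) \<in> A \<and> open W \<and> p \<in> W \<and> W \<subseteq> U \<and> smooth_on (\<phi> ` W) (F \<circ> \<Phi> \<circ> inv_into U \<phi>)"
        using U dom.chart(1)[OF U(1)] by blast
    qed
  qed (rule cont)
qed

section \<open>Products of manifolds\<close>

locale product_manifold = M1: smooth_manifold A1 + M2: smooth_manifold A2
  for A1 :: "('m::{t2_space,second_countable_topology}, 'e::euclidean_space) chart set"
    and A2 :: "('n::{t2_space,second_countable_topology}, 'f::euclidean_space) chart set"
begin

abbreviation "A \<equiv> product_atlas A1 A2"

lemma product_chart: "(U, \<phi>) \<in> A1 \<Longrightarrow> (V, \<psi>) \<in> A2 \<Longrightarrow> (U \<times> V, map_prod \<phi> \<psi>) \<in> A"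
  unfolding product_atlas_def by blast

lemma inv_map_prod:
  assumes "(U, \<phi>) \<in> A1" "(V, \<psi>) \<in> A2" "z \<in> \<phi> ` U \<times> \<psi> ` V"
  shows "inv_into (U \<times> V) (map_prod \<phi> \<psi>) z = (inv_into U \<phi> (fst z), inv_into V \<psi> (snd z))"
proof (rule inv_into_f_eq)
  show "inj_on (map_prod \<phi> \<psi>) (U \<times> V)"
    using M1.chart(4)[OF assms(1)] M2.chart(4)[OF assms(2)]
    by (intro map_prod_inj_on) (auto intro: inj_on_inverseI)
qed (use assms in \<open>auto simp: inv_into_into f_inv_into_f\<close>)

lemma map_prod_image: "map_prod \<phi> \<psi> ` (U \<times> V) = \<phi> ` U \<times> \<psi> ` V"
  by (rule map_prod_surj_on) auto

lemma is_chart_product: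
  assumes "(U, \<phi>) \<in> A1" "(V, \<psi>) \<in> A2"
  shows "is_chart (U \<times> V, map_prod \<phi> \<psi>)"
proof -
  let ?i = "inv_into (U \<times> V) (map_prod \<phi> \<psi>)"
  have "homeomorphism (U \<times> V) (\<phi> ` U \<times> \<psi> ` V) (map_prod \<phi> \<psi>) ?i"
    unfolding homeomorphism_def
  proof (intro conjI ballI)
    show "map_prod \<phi> \<psi> ` (U \<times> V) = \<phi> ` U \<times> \<psi> ` V" by (rule map_prod_image)
    show "?i ` (\<phi> ` U \<times> \<psi> ` V) = U \<times> V"
    proof
      show "?i ` (\<phi> ` U \<times> \<psi> ` V) \<subseteq> U \<times> V"
        using inv_map_prod[OF assms] by (auto simp: inv_into_into)
      show "U \<times> V \<subseteq> ?i ` (\<phi> ` U \<times> \<psi> ` V)"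
      proof
        fix z assume z: "z \<in> U \<times> V"
        then have "z = ?i (map_prod \<phi> \<psi> z)"
          using inv_map_prod[OF assms, of "map_prod \<phi> \<psi> z"] M1.chart(4)[OF assms(1)] M2.chart(4)[OF assms(2)]
          by (auto simp: map_prod_def split: prod.splits)
        then show "z \<in> ?i ` (\<phi> ` U \<times> \<psi> ` V)" using z by (metis imageI map_prod_image)
      qed
    qed
    show "?i (map_prod \<phi> \<psi> z) = z" if "z \<in> U \<times> V" for z
      using that inv_map_prod[OF assms, of "map_prod \<phi> \<psi> z"] M1.chart(4)[OF assms(1)] M2.chart(4)[OF assms(2)]
      by auto
    show "map_prod \<phi> \<psi> (?i z) = z" if "z \<in> \<phi> ` U \<times> \<psi> ` V" for z
      using that inv_map_prod[OF assms that] by (auto simp: f_inv_into_f)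
    have "continuous_on (U \<times> V) (\<lambda>z. (\<phi> (fst z), \<psi> (snd z)))"
      by (intro continuous_on_Pair continuous_on_compose2[OF M1.chart_continuous[OF assms(1)]]
          continuous_on_compose2[OF M2.chart_continuous[OF assms(2)]] continuous_on_fst continuous_on_snd
          continuous_on_id) auto
    then show "continuous_on (U \<times> V) (map_prod \<phi> \<psi>)" by (simp add: map_prod_def split_beta')
    have "continuous_on (\<phi> ` U \<times> \<psi> ` V) (\<lambda>z. (inv_into U \<phi> (fst z), inv_into V \<psi> (snd z)))"
      by (intro continuous_on_Pair continuous_on_compose2[OF M1.chart_inv_continuous[OF assms(1)]]
          continuous_on_compose2[OF M2.chart_inv_continuous[OF assms(2)]] continuous_on_fst continuous_on_snd
          continuous_on_id) auto
    then show "continuous_on (\<phi> ` U \<times> \<psi> ` V) ?i"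
      by (rule continuous_on_eq) (simp add: inv_map_prod[OF assms])
  qed
  then show ?thesis
    using M1.chart(1,2)[OF assms(1)] M2.chart(1,2)[OF assms(2)]
    by (simp add: is_chart_def map_prod_image open_Times)
qed

lemma product_smooth_atlas: "smooth_atlas A"
  unfolding smooth_atlas_def
proof (intro conjI)
  show "\<forall>\<kappa>\<in>A. is_chart \<kappa>" unfolding product_atlas_def using is_chart_product by blast
  show "(\<Union>\<kappa>\<in>A. fst \<kappa>) = UNIV"
  proof (intro set_eqI iffI UNIV_I)
    fix z :: "'m \<times> 'n"
    obtain U \<phi> where U: "(U, \<phi>) \<in> A1" "fst z \<in> U" by (rule M1.chart_at)
    obtain V \<psi> where V: "(V, \<psi>) \<in> A2" "snd z \<in> V" by (rule M2.chart_at)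
    show "z \<in> (\<Union>\<kappa>\<in>A. fst \<kappa>)"
      using product_chart[OF U(1) V(1)] U V by (intro UN_I) (auto simp: mem_Times_iff)
  qed
  have "smooth_on (map_prod \<phi> \<psi> ` (U \<times> V \<inter> U' \<times> V')) (map_prod \<phi>' \<psi>' \<circ> inv_into (U \<times> V) (map_prod \<phi> \<psi>))"
    if U: "(U, \<phi>) \<in> A1" "(V, \<psi>) \<in> A2" and U': "(U', \<phi>') \<in> A1" "(V', \<psi>') \<in> A2" for U V \<phi> \<psi> U' V' \<phi>' \<psi>'
  proof -
    let ?S1 = "\<phi> ` (U \<inter> U')" and ?S2 = "\<psi> ` (V \<inter> V')"
    have o: "open ?S1" "open ?S2"
      using M1.chart_image_open[OF U(1) open_Int[OF M1.chart(1)[OF U(1)] M1.chart(1)[OF U'(1)]]]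
        M2.chart_image_open[OF U(2) open_Int[OF M2.chart(1)[OF U(2)] M2.chart(1)[OF U'(2)]]] by auto
    then have oS: "open (?S1 \<times> ?S2)" by (rule open_Times)
    have S: "map_prod \<phi> \<psi> ` (U \<times> V \<inter> U' \<times> V') = ?S1 \<times> ?S2"
      by (simp add: Times_Int_Times map_prod_image)
    have "smooth_on (?S1 \<times> ?S2) (\<lambda>z. (\<phi>' \<circ> inv_into U \<phi>) (fst z))"
      by (rule smooth_on_compose[OF oS o(1) _ smooth_on_linear[OF oS bounded_linear_fst]
            M1.chart_transition[OF U(1) U'(1)]]) auto
    from smooth_on_bounded_linear[OF oS bounded_linear_Pair[OF bounded_linear_ident bounded_linear_zero] this]
    have 1: "smooth_on (?S1 \<times> ?S2) (\<lambda>z. ((\<phi>' \<circ> inv_into U \<phi>) (fst z), 0 :: 'f))" .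
    have "smooth_on (?S1 \<times> ?S2) (\<lambda>z. (\<psi>' \<circ> inv_into V \<psi>) (snd z))"
      by (rule smooth_on_compose[OF oS o(2) _ smooth_on_linear[OF oS bounded_linear_snd]
            M2.chart_transition[OF U(2) U'(2)]]) auto
    from smooth_on_bounded_linear[OF oS bounded_linear_Pair[OF bounded_linear_zero bounded_linear_ident] this]
    have 2: "smooth_on (?S1 \<times> ?S2) (\<lambda>z. (0 :: 'e, (\<psi>' \<circ> inv_into V \<psi>) (snd z)))" .
    show ?thesis unfolding S
      by (rule smooth_on_cong[OF oS smooth_on_add[OF oS 1 2]])
        (use inv_map_prod[OF U] in auto)
  qed
  then show "\<forall>(U, \<phi>)\<in>A. \<forall>(V, \<psi>)\<in>A. smooth_on (\<phi> ` (U \<inter> V)) (\<psi> \<circ> inv_into U \<phi>)"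
    unfolding product_atlas_def by blast
qed

sublocale M: smooth_manifold A
  by unfold_locales (rule product_smooth_atlas)

lemma charts_at:
  obtains U \<phi> V \<psi> where "(U, \<phi>) \<in> A1" "p \<in> U" "(V, \<psi>) \<in> A2" "q \<in> V"
  using M1.chart_at M2.chart_at by metis

lemma smooth_map_fst: "smooth_map A A1 fst"
proof (rule smooth_mapI)
  fix z :: "'m \<times> 'n"
  obtain U \<phi> V \<psi> where U: "(U, \<phi>) \<in> A1" "fst z \<in> U" and V: "(V, \<psi>) \<in> A2" "snd z \<in> V" by (rule charts_at)
  note UV = product_chart[OF U(1) V(1)] and o = M.chart(2)[OF product_chart[OF U(1) V(1)]]
  have "smooth_on (map_prod \<phi> \<psi> ` (U \<times> V)) (\<phi> \<circ> fst \<circ> inv_into (U \<times> V) (map_prod \<phi> \<psi>))"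
    by (rule smooth_on_cong[OF o smooth_on_linear[OF o bounded_linear_fst]])
      (use M.chart(4)[OF UV] in auto)
  then show "\<exists>U \<phi> V \<psi>. (U, \<phi>) \<in> A \<and> z \<in> U \<and> (V, \<psi>) \<in> A1 \<and> fst ` U \<subseteq> V \<and> smooth_on (\<phi> ` U) (\<psi> \<circ> fst \<circ> inv_into U \<phi>)"
    using U V by (intro exI conjI) (rule UV, auto simp: mem_Times_iff)
qed (simp_all add: M.smooth_manifold_axioms M1.smooth_manifold_axioms continuous_on_fst)

lemma smooth_map_snd: "smooth_map A A2 snd"
proof (rule smooth_mapI)
  fix z :: "'m \<times> 'n"
  obtain U \<phi> V \<psi> where U: "(U, \<phi>) \<in> A1" "fst z \<in> U" and V: "(V, \<psi>) \<in> A2" "snd z \<in> V" by (rule charts_at)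
  note UV = product_chart[OF U(1) V(1)] and o = M.chart(2)[OF product_chart[OF U(1) V(1)]]
  have "smooth_on (map_prod \<phi> \<psi> ` (U \<times> V)) (\<psi> \<circ> snd \<circ> inv_into (U \<times> V) (map_prod \<phi> \<psi>))"
    by (rule smooth_on_cong[OF o smooth_on_linear[OF o bounded_linear_snd]])
      (use M.chart(4)[OF UV] in auto)
  then show "\<exists>U \<phi> V \<psi>. (U, \<phi>) \<in> A \<and> z \<in> U \<and> (V, \<psi>) \<in> A2 \<and> snd ` U \<subseteq> V \<and> smooth_on (\<phi> ` U) (\<psi> \<circ> snd \<circ> inv_into U \<phi>)"
    using U V by (intro exI conjI) (rule UV, auto simp: mem_Times_iff)
qed (simp_all add: M.smooth_manifold_axioms M2.smooth_manifold_axioms continuous_on_snd)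

lemma smooth_map_inc1: "smooth_map A1 A (\<lambda>x. (x, q))"
proof (rule smooth_mapI)
  fix p
  obtain U \<phi> V \<psi> where U: "(U, \<phi>) \<in> A1" "p \<in> U" and V: "(V, \<psi>) \<in> A2" "q \<in> V" by (rule charts_at)
  note o = M1.chart(2)[OF U(1)]
  have "smooth_on (\<phi> ` U) (\<lambda>x. (x, 0) + (0, \<psi> q))"
    by (intro smooth_on_add smooth_on_linear smooth_on_const bounded_linear_Pair
        bounded_linear_ident bounded_linear_zero o)
  then have "smooth_on (\<phi> ` U) (map_prod \<phi> \<psi> \<circ> (\<lambda>x. (x, q)) \<circ> inv_into U \<phi>)"
    by (rule smooth_on_cong[OF o]) (auto simp: f_inv_into_f)
  then show "\<exists>U \<phi> V \<psi>. (U, \<phi>) \<in> A1 \<and> p \<in> U \<and> (V, \<psi>) \<in> A \<and> (\<lambda>x. (x, q)) ` U \<subseteq> V \<and>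
      smooth_on (\<phi> ` U) (\<psi> \<circ> (\<lambda>x. (x, q)) \<circ> inv_into U \<phi>)"
    using U V product_chart[OF U(1) V(1)] by (intro exI conjI) auto
qed (auto simp: M.smooth_manifold_axioms M1.smooth_manifold_axioms intro!: continuous_intros)

lemma smooth_map_inc2: "smooth_map A2 A (\<lambda>y. (p, y))"
proof (rule smooth_mapI)
  fix q
  obtain U \<phi> V \<psi> where U: "(U, \<phi>) \<in> A1" "p \<in> U" and V: "(V, \<psi>) \<in> A2" "q \<in> V" by (rule charts_at)
  note o = M2.chart(2)[OF V(1)]
  have "smooth_on (\<psi> ` V) (\<lambda>y. (0, y) + (\<phi> p, 0))"
    by (intro smooth_on_add smooth_on_linear smooth_on_const bounded_linear_Pair
        bounded_linear_ident bounded_linear_zero o)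
  then have "smooth_on (\<psi> ` V) (map_prod \<phi> \<psi> \<circ> (\<lambda>y. (p, y)) \<circ> inv_into V \<psi>)"
    by (rule smooth_on_cong[OF o]) (auto simp: f_inv_into_f)
  then show "\<exists>U \<phi> V \<psi>. (U, \<phi>) \<in> A2 \<and> q \<in> U \<and> (V, \<psi>) \<in> A \<and> (\<lambda>y. (p, y)) ` U \<subseteq> V \<and>
      smooth_on (\<phi> ` U) (\<psi> \<circ> (\<lambda>y. (p, y)) \<circ> inv_into U \<phi>)"
    using U V product_chart[OF U(1) V(1)] by (intro exI conjI) auto
qed (auto simp: M.smooth_manifold_axioms M2.smooth_manifold_axioms intro!: continuous_intros)

lemmas smooth_fst = smooth_map.smooth_comp[OF smooth_map_fst]
  and smooth_snd = smooth_map.smooth_comp[OF smooth_map_snd]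

text \<open>The coordinates of a product chart are functions of one factor each. As the basis of the
product of two Euclidean spaces is indexed by pairs, a coordinate is written as a sum of two
lifted functions, one of which is zero for a basis vector.\<close>

lemma product_frame:
  obtains W x E x1 x2 where "M.frame W x E" "z \<in> W"
    "\<And>k. x1 k \<in> M1.C" "\<And>k. x2 k \<in> M2.C"
    "\<And>v k y. y \<in> W \<Longrightarrow> v \<in> M.T y \<Longrightarrow> v (x k) = v (x1 k \<circ> fst) + v (x2 k \<circ> snd)"
proof -
  obtain U \<phi> V \<psi> where U: "(U, \<phi>) \<in> A1" "fst z \<in> U" and V: "(V, \<psi>) \<in> A2" "snd z \<in> V"
    by (rule charts_at)
  have zUV: "z \<in> U \<times> V" using U V by (simp add: mem_Times_iff)
  obtain W x E where f: "M.frame W x E" "z \<in> W" and x: "\<And>i z. z \<in> W \<Longrightarrow> x i z = map_prod \<phi> \<psi> z \<bullet> i"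
    by (rule M.frame_at_chart[OF product_chart[OF U(1) V(1)] zUV]) (rule that)
  obtain W1 x1 E1 where f1: "M1.frame W1 x1 E1" "fst z \<in> W1" and x1: "\<And>i q. q \<in> W1 \<Longrightarrow> x1 i q = \<phi> q \<bullet> i"
    by (rule M1.frame_at_chart[OF U]) (rule that)
  obtain W2 x2 E2 where f2: "M2.frame W2 x2 E2" "snd z \<in> W2" and x2: "\<And>i q. q \<in> W2 \<Longrightarrow> x2 i q = \<psi> q \<bullet> i"
    by (rule M2.frame_at_chart[OF V]) (rule that)
  define W' where "W' = W \<inter> W1 \<times> W2"
  have W': "open W'" "z \<in> W'" "W' \<subseteq> W"
    using f(2) f1(2) f2(2) M.frame_parts(1)[OF f(1)] M1.frame_parts(1)[OF f1(1)] M2.frame_parts(1)[OF f2(1)]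
    by (auto simp: W'_def mem_Times_iff intro: open_Times)
  have xC: "x k \<in> M.C" "x1 i \<in> M1.C" "x2 j \<in> M2.C" for k i j
    by (rule M.frame_parts[OF f(1)] M1.frame_parts[OF f1(1)] M2.frame_parts[OF f2(1)])+
  have "v (x k) = v (x1 (fst k) \<circ> fst) + v (x2 (snd k) \<circ> snd)" if y: "y \<in> W'" and v: "v \<in> M.T y" for y v k
  proof -
    have "v (x k) = v (\<lambda>y. (x1 (fst k) \<circ> fst) y + (x2 (snd k) \<circ> snd) y)"
      by (rule M.tangent_local[OF v xC(1) M.smooth_add[OF smooth_fst[OF xC(2)] smooth_snd[OF xC(3)]] W'(1) y])
        (auto simp: W'_def x x1 x2 inner_prod_def)
    also have "\<dots> = v (x1 (fst k) \<circ> fst) + v (x2 (snd k) \<circ> snd)"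
      by (rule M.tangent_derivation(1)[OF v smooth_fst[OF xC(2)] smooth_snd[OF xC(3)]])
    finally show ?thesis .
  qed
  then show ?thesis
    using that[OF M.frame_subset[OF f(1) W'(1,3)] W'(2) xC(2,3)] by blast
qed

abbreviation "push1 \<equiv> pushforward A1 (fst :: 'm \<times> 'n \<Rightarrow> 'm)"
abbreviation "push2 \<equiv> pushforward A2 (snd :: 'm \<times> 'n \<Rightarrow> 'n)"
abbreviation "inc1 q \<equiv> pushforward A (\<lambda>x. (x, q))"
abbreviation "inc2 p \<equiv> pushforward A (\<lambda>y. (p, y))"

lemmas push1_apply = smooth_map.push_apply[OF smooth_map_fst]
  and push2_apply = smooth_map.push_apply[OF smooth_map_snd]

lemma pushforward_lincomb:
  "pushforward B \<Phi> (\<lambda>F. a * u F + b * v F) = (\<lambda>F. a * pushforward B \<Phi> u F + b * pushforward B \<Phi> v F)"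
  by (auto simp: pushforward_def)

lemma inc1_fst: "F \<in> M1.C \<Longrightarrow> inc1 q u (F \<circ> fst) = u F"
  and inc2_snd: "G \<in> M2.C \<Longrightarrow> inc2 p w (G \<circ> snd) = w G"
  and inc1_snd: "u \<in> M1.T p \<Longrightarrow> inc1 q u (G \<circ> snd) = 0"
  and inc2_fst: "w \<in> M2.T q \<Longrightarrow> inc2 p w (F \<circ> fst) = 0"
  using smooth_fst smooth_snd M1.tangent_const M2.tangent_const by (simp_all add: pushforward_def o_def)

text \<open>Functions lifted from the factors are enough to separate tangent vectors, as the coordinates
of a product chart are sums of such functions.\<close>

lemma product_tangent_eqI:
  assumes u: "u \<in> M.T z" and v: "v \<in> M.T z"
    and "\<And>F. F \<in> M1.C \<Longrightarrow> u (F \<circ> fst) = v (F \<circ> fst)" "\<And>F. F \<in> M2.C \<Longrightarrow> u (F \<circ> snd) = v (F \<circ> snd)"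
  shows "u = v"
proof -
  obtain W x E x1 x2 where f: "M.frame W x E" "z \<in> W"
    and x: "\<And>k. x1 k \<in> M1.C" "\<And>k. x2 k \<in> M2.C"
      "\<And>v k y. y \<in> W \<Longrightarrow> v \<in> M.T y \<Longrightarrow> v (x k) = v (x1 k \<circ> fst) + v (x2 k \<circ> snd)"
    by (rule product_frame[of z]) (rule that)
  have "u (x k) = v (x k)" for k using x(3)[OF f(2) u, of k] x(3)[OF f(2) v, of k] assms(3,4) x(1,2) by simp
  then show ?thesis
    using M.frame_expand[OF f u] M.frame_expand[OF f v] by simp
qed

lemma push_tangent:
  assumes v: "v \<in> M.T (p, q)"
  shows "push1 v \<in> M1.T p" "push2 v \<in> M2.T q"
    and push_decompose: "v = (\<lambda>F. 1 * inc1 q (push1 v) F + 1 * inc2 p (push2 v) F)"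
proof -
  show p: "push1 v \<in> M1.T p" "push2 v \<in> M2.T q"
    using smooth_map.push_tangent[OF smooth_map_fst v] smooth_map.push_tangent[OF smooth_map_snd v] by simp_all
  show "v = (\<lambda>F. 1 * inc1 q (push1 v) F + 1 * inc2 p (push2 v) F)"
    by (rule product_tangent_eqI[OF v M.tangent_lincomb[OF smooth_map.push_tangent[OF smooth_map_inc1 p(1)]
            smooth_map.push_tangent[OF smooth_map_inc2 p(2)]]])
      (simp_all add: inc1_fst inc2_snd inc1_snd[OF p(1)] inc2_fst[OF p(2)] push1_apply push2_apply)
qed

lemma inc1_tangent:
  assumes u: "u \<in> M1.T p"
  shows "inc1 q u \<in> M.T (p, q)" "push1 (inc1 q u) = u" "push2 (inc1 q u) = (\<lambda>F. 0)"
proof -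
  show T: "inc1 q u \<in> M.T (p, q)" by (rule smooth_map.push_tangent[OF smooth_map_inc1 u])
  show "push1 (inc1 q u) = u"
    by (rule M1.tangent_eqI[OF push_tangent(1)[OF T] u]) (simp add: push1_apply inc1_fst)
  show "push2 (inc1 q u) = (\<lambda>F. 0)"
    by (rule M2.tangent_eqI[OF push_tangent(2)[OF T] M2.tangent_zero]) (simp add: push2_apply inc1_snd[OF u])
qed

lemma inc2_tangent:
  assumes u: "u \<in> M2.T q"
  shows "inc2 p u \<in> M.T (p, q)" "push2 (inc2 p u) = u" "push1 (inc2 p u) = (\<lambda>F. 0)"
proof -
  show T: "inc2 p u \<in> M.T (p, q)" by (rule smooth_map.push_tangent[OF smooth_map_inc2 u])
  show "push2 (inc2 p u) = u"
    by (rule M2.tangent_eqI[OF push_tangent(2)[OF T] u]) (simp add: push2_apply inc2_snd)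
  show "push1 (inc2 p u) = (\<lambda>F. 0)"
    by (rule M1.tangent_eqI[OF push_tangent(1)[OF T] M1.tangent_zero]) (simp add: push1_apply inc2_fst[OF u])
qed

text \<open>Smoothness of a vector field on the product, too, can be tested on lifted functions:
its coefficients with respect to a product frame are its derivatives of the coordinates.\<close>

lemma product_VF_I:
  assumes T: "\<And>z. X z \<in> M.T z"
    and X1: "\<And>F. F \<in> M1.C \<Longrightarrow> (\<lambda>z. X z (F \<circ> fst)) \<in> M.C"
    and X2: "\<And>F. F \<in> M2.C \<Longrightarrow> (\<lambda>z. X z (F \<circ> snd)) \<in> M.C"
  shows "X \<in> M.VF"
proof (rule M.VF_I[OF T])
  fix F assume F: "F \<in> M.C"
  show "(\<lambda>z. X z F) \<in> M.C"
  proof (rule M.smooth_funs_local)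
    fix z :: "'m \<times> 'n"
    obtain W x E x1 x2 where f: "M.frame W x E" "z \<in> W"
      and x: "\<And>k. x1 k \<in> M1.C" "\<And>k. x2 k \<in> M2.C"
        "\<And>v k y. y \<in> W \<Longrightarrow> v \<in> M.T y \<Longrightarrow> v (x k) = v (x1 k \<circ> fst) + v (x2 k \<circ> snd)"
      by (rule product_frame[of z]) (rule that)
    define G where "G y = (\<Sum>k\<in>Basis. (X y (x1 k \<circ> fst) + X y (x2 k \<circ> snd)) * E k y F)" for y
    have "G \<in> M.C" unfolding G_def[abs_def]
      by (rule M.smooth_sum[OF M.smooth_mult[OF M.smooth_add[OF X1[OF x(1)] X2[OF x(2)]]
              M.VF_smooth[OF M.frame_parts(3)[OF f(1)] F]]])
    moreover have "X y F = G y" if "y \<in> W" for y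
      unfolding G_def x(3)[OF that T, symmetric] by (rule fun_cong[OF M.frame_expand[OF f(1) that T]])
    ultimately show "\<exists>W G. open W \<and> z \<in> W \<and> G \<in> M.C \<and> (\<forall>q\<in>W. X q F = G q)"
      using f M.frame_parts(1)[OF f(1)] by blast
  qed
qed

abbreviation "H \<equiv> horizontal_lift A1 A2"
abbreviation "V \<equiv> vertical_lift A1 A2"
abbreviation "hl p q \<equiv> pullback_covec A A1 fst (p, q)"
abbreviation "vl p q \<equiv> pullback_covec A A2 snd (p, q)"
abbreviation "hr p q \<equiv> pullback_covec A1 A (\<lambda>x. (x, q)) p"
abbreviation "vr p q \<equiv> pullback_covec A2 A (\<lambda>y. (p, y)) q"

lemma H_point: "H \<omega> (p, q) = hl p q (\<omega> p)"
  and V_point: "V \<eta> (p, q) = vl p q (\<eta> q)"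
  by (simp_all add: horizontal_lift_def vertical_lift_def pullback_form_def)

lemma hl_apply: "v \<in> M.T (p, q) \<Longrightarrow> hl p q \<alpha> v = \<alpha> (push1 v)"
  and vl_apply: "v \<in> M.T (p, q) \<Longrightarrow> vl p q \<beta> v = \<beta> (push2 v)"
  and hr_apply: "u \<in> M1.T p \<Longrightarrow> hr p q \<gamma> u = \<gamma> (inc1 q u)"
  and vr_apply: "w \<in> M2.T q \<Longrightarrow> vr p q \<gamma> w = \<gamma> (inc2 p w)"
  by (simp_all add: pullback_covec_def)

lemma hl_covec: "\<alpha> \<in> M1.CT p \<Longrightarrow> hl p q \<alpha> \<in> M.CT (p, q)"
  and vl_covec: "\<beta> \<in> M2.CT q \<Longrightarrow> vl p q \<beta> \<in> M.CT (p, q)"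
  and hr_covec: "\<gamma> \<in> M.CT (p, q) \<Longrightarrow> hr p q \<gamma> \<in> M1.CT p"
  and vr_covec: "\<gamma> \<in> M.CT (p, q) \<Longrightarrow> vr p q \<gamma> \<in> M2.CT q"
  by (simp_all add: smooth_map.pull_covec[OF smooth_map_fst] smooth_map.pull_covec[OF smooth_map_snd]
      smooth_map.pull_covec[OF smooth_map_inc1] smooth_map.pull_covec[OF smooth_map_inc2])

text \<open>The two restrictions of a covector to the slices determine it: this is the decomposition
\<open>\<omega>\<^sub>1\<^sup>h + \<omega>\<^sub>2\<^sup>v\<close> that underlies the definition of the warped bivector field.\<close>

lemma covec_decompose:
  assumes "\<gamma> \<in> M.CT (p, q)"
  shows "\<gamma> = (\<lambda>v. 1 * hl p q (hr p q \<gamma>) v + 1 * vl p q (vr p q \<gamma>) v)"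
proof (rule M.covec_eqI[OF assms])
  show "(\<lambda>v. 1 * hl p q (hr p q \<gamma>) v + 1 * vl p q (vr p q \<gamma>) v) \<in> M.CT (p, q)"
    by (intro M.cot_lincomb hl_covec vl_covec hr_covec vr_covec assms)
  fix v assume v: "v \<in> M.T (p, q)"
  have "\<gamma> v = \<gamma> (\<lambda>F. 1 * inc1 q (push1 v) F + 1 * inc2 p (push2 v) F)"
    by (rule arg_cong[OF push_decompose[OF v]])
  also have "\<dots> = 1 * \<gamma> (inc1 q (push1 v)) + 1 * \<gamma> (inc2 p (push2 v))"
    by (rule M.covec_lincomb[OF assms inc1_tangent(1)[OF push_tangent(1)[OF v]] inc2_tangent(1)[OF push_tangent(2)[OF v]]])
  finally show "\<gamma> v = 1 * hl p q (hr p q \<gamma>) v + 1 * vl p q (vr p q \<gamma>) v"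
    using push_tangent[OF v] by (simp add: hl_apply[OF v] vl_apply[OF v] hr_apply vr_apply)
qed

lemma hr_hl: "\<alpha> \<in> M1.CT p \<Longrightarrow> hr p q (hl p q \<alpha>) = \<alpha>"
  by (rule M1.covec_eqI[of _ p]) (auto simp: hr_covec hl_covec hr_apply hl_apply inc1_tangent)

lemma vr_vl: "\<alpha> \<in> M2.CT q \<Longrightarrow> vr p q (vl p q \<alpha>) = \<alpha>"
  by (rule M2.covec_eqI[of _ q]) (auto simp: vr_covec vl_covec vr_apply vl_apply inc2_tangent)

lemma vr_hl: "\<alpha> \<in> M1.CT p \<Longrightarrow> vr p q (hl p q \<alpha>) = (\<lambda>v. 0)"
  by (rule M2.covec_eqI[of _ q])
    (auto simp: vr_covec hl_covec vr_apply hl_apply inc2_tangent M1.covec_zero M2.cot_zero)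

lemma hr_vl: "\<alpha> \<in> M2.CT q \<Longrightarrow> hr p q (vl p q \<alpha>) = (\<lambda>v. 0)"
  by (rule M1.covec_eqI[of _ p])
    (auto simp: hr_covec vl_covec hr_apply vl_apply inc1_tangent M2.covec_zero M1.cot_zero)

lemma H_form: "\<omega> \<in> M1.\<Omega> \<Longrightarrow> H \<omega> \<in> M.\<Omega>"
  unfolding horizontal_lift_def by (rule smooth_map.pull_form[OF smooth_map_fst])

lemma V_form: "\<omega> \<in> M2.\<Omega> \<Longrightarrow> V \<omega> \<in> M.\<Omega>"
  unfolding vertical_lift_def by (rule smooth_map.pull_form[OF smooth_map_snd])

lemma lie_derivative_H:
  assumes "X \<in> M.VF" "Y \<in> M1.VF" "\<eta> \<in> M1.\<Omega>" "k \<in> M.C"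
    "\<And>F z. F \<in> M1.C \<Longrightarrow> X z (F \<circ> fst) = k z * Y (fst z) F" "v \<in> M.T (p, q)"
  shows "lie_derivative A X (H \<eta>) (p, q) v
    = k (p, q) * lie_derivative A1 Y \<eta> p (push1 v) + v k * \<eta> p (Y p)"
  using smooth_map.lie_derivative_pull[OF smooth_map_fst assms] by (simp add: horizontal_lift_def)

lemma lie_derivative_V:
  assumes "X \<in> M.VF" "Y \<in> M2.VF" "\<eta> \<in> M2.\<Omega>" "k \<in> M.C"
    "\<And>F z. F \<in> M2.C \<Longrightarrow> X z (F \<circ> snd) = k z * Y (snd z) F" "v \<in> M.T (p, q)"
  shows "lie_derivative A X (V \<eta>) (p, q) v
    = k (p, q) * lie_derivative A2 Y \<eta> q (push2 v) + v k * \<eta> q (Y q)"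
  using smooth_map.lie_derivative_pull[OF smooth_map_snd assms] by (simp add: vertical_lift_def)

end

section \<open>Contravariant Levi-Civita connections\<close>

locale levi_civita_manifold = metric_manifold +
  fixes P :: "'a bivec" and D :: "'a form \<Rightarrow> 'a form \<Rightarrow> 'a form"
  assumes levi_civita: "contravariant_levi_civita A g P D"
begin

abbreviation "G \<equiv> form_inner A g"

lemma D_form: "\<omega> \<in> \<Omega> \<Longrightarrow> \<eta> \<in> \<Omega> \<Longrightarrow> D \<omega> \<eta> \<in> \<Omega>"
  using levi_civita by (simp add: contravariant_levi_civita_def contravariant_connection_def)

lemma torsion_free: "\<omega> \<in> \<Omega> \<Longrightarrow> \<eta> \<in> \<Omega> \<Longrightarrow> form_bracket A P \<omega> \<eta> = form_diff (D \<omega> \<eta>) (D \<eta> \<omega>)"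
  using levi_civita by (simp add: contravariant_levi_civita_def)

lemma metric_compatible:
  "\<omega> \<in> \<Omega> \<Longrightarrow> \<eta> \<in> \<Omega> \<Longrightarrow> \<gamma> \<in> \<Omega> \<Longrightarrow> sharp A P \<omega> p (G \<eta> \<gamma>) = G (D \<omega> \<eta>) \<gamma> p + G \<eta> (D \<omega> \<gamma>) p"
  using levi_civita by (simp add: contravariant_levi_civita_def)

lemma D_mult_left: "F \<in> C \<Longrightarrow> \<omega> \<in> \<Omega> \<Longrightarrow> \<eta> \<in> \<Omega> \<Longrightarrow> D (form_mult F \<omega>) \<eta> = form_mult F (D \<omega> \<eta>)"
  using levi_civita by (simp add: contravariant_levi_civita_def contravariant_connection_def)

lemma D_add_left: "\<omega> \<in> \<Omega> \<Longrightarrow> \<eta> \<in> \<Omega> \<Longrightarrow> \<gamma> \<in> \<Omega> \<Longrightarrow> D (form_add \<omega> \<eta>) \<gamma> = form_add (D \<omega> \<gamma>) (D \<eta> \<gamma>)"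
  using levi_civita by (simp add: contravariant_levi_civita_def contravariant_connection_def)

lemma D_zero_left:
  assumes "\<eta> \<in> \<Omega>" shows "D (\<lambda>p v. 0) \<eta> = (\<lambda>p v. 0)"
  using D_mult_left[OF smooth_const form_zero assms, of 0] by (simp add: form_mult_def)

lemma bracket_closed: "\<omega> \<in> \<Omega> \<Longrightarrow> \<eta> \<in> \<Omega> \<Longrightarrow> form_bracket A P \<omega> \<eta> \<in> \<Omega>"
  by (simp add: torsion_free form_diff_closed D_form)

text \<open>The six metric compatibility and torsion conditions for \<open>\<omega>\<close>, \<open>\<eta>\<close>, \<open>\<gamma>\<close>, solved for the
inner product on the left.\<close>

lemma koszul:
  assumes \<omega>: "\<omega> \<in> \<Omega>" and \<eta>: "\<eta> \<in> \<Omega>" and \<gamma>: "\<gamma> \<in> \<Omega>"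
  shows "2 * G (D \<omega> \<eta>) \<gamma> p =
    sharp A P \<omega> p (G \<eta> \<gamma>) + sharp A P \<eta> p (G \<omega> \<gamma>) - sharp A P \<gamma> p (G \<omega> \<eta>)
    + G (form_bracket A P \<omega> \<eta>) \<gamma> p - G (form_bracket A P \<omega> \<gamma>) \<eta> p - G (form_bracket A P \<eta> \<gamma>) \<omega> p"
  using metric_compatible[OF \<omega> \<eta> \<gamma>, of p] metric_compatible[OF \<eta> \<omega> \<gamma>, of p] metric_compatible[OF \<gamma> \<omega> \<eta>, of p]
  by (simp add: torsion_free form_inner_diff D_form \<omega> \<eta> \<gamma>
      form_inner_sym[OF \<eta> D_form[OF \<omega> \<gamma>]] form_inner_sym[OF \<omega> D_form[OF \<eta> \<gamma>]]
      form_inner_sym[OF \<omega> D_form[OF \<gamma> \<eta>]])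

text \<open>Metric compatibility moves the outer derivative in \<open>g(D \<omega> (D \<eta> \<eta>), \<omega>)\<close> to the outside, and
likewise in the second term of the curvature. Only inner products of the forms
\<open>D \<omega> \<eta>\<close> with each other and with \<open>\<omega>\<close>, and derivatives of such functions, remain.\<close>

lemma curvature_pairing:
  assumes \<omega>: "\<omega> \<in> \<Omega>" and \<eta>: "\<eta> \<in> \<Omega>"
  shows "G (contravariant_curvature A P D \<omega> \<eta> \<eta>) \<omega> p =
    sharp A P \<omega> p (G (D \<eta> \<eta>) \<omega>) - G (D \<eta> \<eta>) (D \<omega> \<omega>) p
    - sharp A P \<eta> p (G (D \<omega> \<eta>) \<omega>) + G (D \<omega> \<eta>) (D \<eta> \<omega>) p
    - G (D (form_bracket A P \<omega> \<eta>) \<eta>) \<omega> p"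
  using metric_compatible[OF \<omega> D_form[OF \<eta> \<eta>] \<omega>, of p] metric_compatible[OF \<eta> D_form[OF \<omega> \<eta>] \<omega>, of p]
  by (simp add: contravariant_curvature_def form_inner_diff D_form form_diff_closed bracket_closed \<omega> \<eta>)

end

section \<open>The metric, the sharp map and the bracket of a warped product\<close>

locale warped_product = product_manifold A1 A2
    + M1: smooth_metric_manifold A1 g1 + M2: smooth_metric_manifold A2 g2
  for A1 :: "('m::{t2_space,second_countable_topology}, 'e::euclidean_space) chart set"
    and A2 :: "('n::{t2_space,second_countable_topology}, 'f::euclidean_space) chart set"
    and g1 g2 +
  fixes P1 :: "'m bivec" and P2 :: "'n bivec" and f nu :: "'m \<Rightarrow> real"
  assumes P1: "bivector_field A1 P1" and P2: "bivector_field A2 P2"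
    and f: "f \<in> smooth_funs A1" and f_pos: "\<And>x. 0 < f x" and nu: "nu \<in> smooth_funs A1"
begin

abbreviation "g \<equiv> warped_metric A1 A2 f g1 g2"
abbreviation "P \<equiv> warped_bivector A1 A2 nu P1 P2"

lemma metric_point:
  "g (p, q) u v = g1 p (push1 u) (push1 v) + (f p)\<^sup>2 * g2 q (push2 u) (push2 v)"
  by (simp add: warped_metric_def)

lemma bivector_point:
  "P (p, q) \<alpha> \<beta> = P1 p (hr p q \<alpha>) (hr p q \<beta>) + nu p * P2 q (vr p q \<alpha>) (vr p q \<beta>)"
  by (simp add: warped_bivector_def Let_def)

lemma metric_inc1:
  assumes "u \<in> M1.T p" "v \<in> M.T (p, q)"
  shows "g (p, q) (inc1 q u) v = g1 p u (push1 v)"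
  using assms push_tangent[OF assms(2)] by (simp add: metric_point inc1_tangent M2.metric_zero_left)

lemma metric_inc2:
  assumes "u \<in> M2.T q" "v \<in> M.T (p, q)"
  shows "g (p, q) (inc2 p u) v = (f p)\<^sup>2 * g2 q u (push2 v)"
  using assms push_tangent[OF assms(2)] by (simp add: metric_point inc2_tangent M1.metric_zero_left)

lemma pushforward_zero: "pushforward B \<Phi> (\<lambda>F. 0) = (\<lambda>F. 0)"
  by (auto simp: pushforward_def)

lemma metric_manifold_warped: "metric_manifold A g"
proof
  fix z :: "'m \<times> 'n" and u v w a b
  obtain p q where z: "z = (p, q)" by fastforce
  assume u: "u \<in> M.T z"
  note pu = push_tangent[OF u[unfolded z]]
  {
    assume v: "v \<in> M.T z"
    note pv = push_tangent[OF v[unfolded z]]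
    show "g z u v = g z v u"
      using pu pv by (simp add: z metric_point M1.metric_sym[of _ p] M2.metric_sym[of _ q])
    assume w: "w \<in> M.T z"
    show "g z (\<lambda>f. a * u f + b * v f) w = a * g z u w + b * g z v w"
      using pu pv push_tangent[OF w[unfolded z]]
      by (simp add: z metric_point pushforward_lincomb M1.metric_lincomb M2.metric_lincomb algebra_simps)
  }
  assume 0: "\<And>v. v \<in> M.T z \<Longrightarrow> g z u v = 0"
  have "push1 u = (\<lambda>F. 0)"
  proof (rule M1.metric_nondegenerate[OF pu(1)])
    fix v assume v: "v \<in> M1.T p"
    have "g z u (inc1 q v) = 0" using 0 inc1_tangent[OF v] by (simp add: z)
    then show "g1 p (push1 u) v = 0"
      using inc1_tangent[OF v] pu by (simp add: z metric_point M2.metric_zero_right)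
  qed
  moreover have "push2 u = (\<lambda>F. 0)"
  proof (rule M2.metric_nondegenerate[OF pu(2)])
    fix v assume v: "v \<in> M2.T q"
    have "g z u (inc2 p v) = 0" using 0 inc2_tangent[OF v] by (simp add: z)
    then show "g2 q (push2 u) v = 0"
      using inc2_tangent[OF v] pu f_pos[of p] by (simp add: z metric_point M1.metric_zero_right)
  qed
  ultimately show "u = (\<lambda>f. 0)" using pu(3) by (simp add: pushforward_zero)
qed

sublocale M: metric_manifold A g
  by (rule metric_manifold_warped)

text \<open>The dual vector of a horizontal covector is the included dual vector in the first factor.\<close>

lemma cometric_hl:
  assumes "\<alpha> \<in> M1.CT p" "\<gamma> \<in> M.CT (p, q)"
  shows "cometric A g (p, q) \<gamma> (hl p q \<alpha>) = \<gamma> (inc1 q (metric_sharp A1 g1 p \<alpha>))"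
proof -
  note s = M1.metric_sharp[OF assms(1)]
  have "metric_sharp A g (p, q) (hl p q \<alpha>) = inc1 q (metric_sharp A1 g1 p \<alpha>)"
    using s by (intro M.metric_sharp_eqI inc1_tangent) (simp_all add: metric_inc1 push_tangent hl_apply)
  then show ?thesis by (simp add: M.cometric_eq assms hl_covec)
qed

text \<open>The dual vector of a vertical covector carries the factor \<open>1/f\<^sup>2\<close>, since the metric carries
\<open>f\<^sup>2\<close> on vertical vectors.\<close>

lemma cometric_vl:
  assumes "\<beta> \<in> M2.CT q" "\<gamma> \<in> M.CT (p, q)"
  shows "cometric A g (p, q) \<gamma> (vl p q \<beta>) = \<gamma> (inc2 p (metric_sharp A2 g2 q \<beta>)) / (f p)\<^sup>2"
proof -
  note s = M2.metric_sharp[OF assms(1)]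
  note i = inc2_tangent(1)[OF s(1), of p]
  have "metric_sharp A g (p, q) (vl p q \<beta>) = (\<lambda>F. inverse ((f p)\<^sup>2) * inc2 p (metric_sharp A2 g2 q \<beta>) F)"
  proof (rule M.metric_sharp_eqI[OF M.tangent_scale[OF i]])
    fix v assume v: "v \<in> M.T (p, q)"
    have "g (p, q) (\<lambda>F. inverse ((f p)\<^sup>2) * inc2 p (metric_sharp A2 g2 q \<beta>) F) v
        = inverse ((f p)\<^sup>2) * g (p, q) (inc2 p (metric_sharp A2 g2 q \<beta>)) v"
      using M.metric_lincomb[OF i i v, of "inverse ((f p)\<^sup>2)" 0] by simp
    also have "\<dots> = vl p q \<beta> v"
      using f_pos[of p] s v push_tangent(2)[OF v] by (simp add: metric_inc2 vl_apply)
    finally show "g (p, q) (\<lambda>F. inverse ((f p)\<^sup>2) * inc2 p (metric_sharp A2 g2 q \<beta>) F) v = vl p q \<beta> v" .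
  qed
  then show ?thesis
    using M.covec_scale[OF assms(2) i] by (simp add: M.cometric_eq assms vl_covec divide_inverse mult.commute)
qed

abbreviation "G \<equiv> form_inner A g"
abbreviation "G1 \<equiv> form_inner A1 g1"
abbreviation "G2 \<equiv> form_inner A2 g2"

lemma inner_HH:
  assumes \<alpha>: "\<alpha> \<in> M1.\<Omega>" and \<alpha>': "\<alpha>' \<in> M1.\<Omega>"
  shows "G (H \<alpha>) (H \<alpha>') = G1 \<alpha> \<alpha>' \<circ> fst"
proof
  fix z :: "'m \<times> 'n"
  obtain p q where z: "z = (p, q)" by fastforce
  note c = M1.form_covec[OF \<alpha>, of p] M1.form_covec[OF \<alpha>', of p]
  show "G (H \<alpha>) (H \<alpha>') z = (G1 \<alpha> \<alpha>' \<circ> fst) z"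
    using c M1.metric_sharp(1)[OF c(2)]
    by (simp add: z form_inner_def H_point cometric_hl hl_covec hl_apply inc1_tangent M1.cometric_eq)
qed

lemma inner_VH:
  assumes \<alpha>: "\<alpha> \<in> M1.\<Omega>" and \<beta>: "\<beta> \<in> M2.\<Omega>"
  shows "G (V \<beta>) (H \<alpha>) = (\<lambda>z. 0)"
proof
  fix z :: "'m \<times> 'n"
  obtain p q where z: "z = (p, q)" by fastforce
  note c = M1.form_covec[OF \<alpha>, of p] M2.form_covec[OF \<beta>, of q]
  show "G (V \<beta>) (H \<alpha>) z = 0"
    using c M1.metric_sharp(1)[OF c(1)]
    by (simp add: z form_inner_def H_point V_point cometric_hl vl_covec vl_apply inc1_tangent M2.covec_zero)
qed

lemma inner_HV: "\<alpha> \<in> M1.\<Omega> \<Longrightarrow> \<beta> \<in> M2.\<Omega> \<Longrightarrow> G (H \<alpha>) (V \<beta>) = (\<lambda>z. 0)"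
  using inner_VH M.form_inner_sym[OF H_form V_form] by (simp add: fun_eq_iff)

lemma inner_VV:
  assumes \<beta>: "\<beta> \<in> M2.\<Omega>" and \<beta>': "\<beta>' \<in> M2.\<Omega>"
  shows "G (V \<beta>) (V \<beta>') = (\<lambda>z. inverse (f (fst z) ^ 2) * G2 \<beta> \<beta>' (snd z))"
proof
  fix z :: "'m \<times> 'n"
  obtain p q where z: "z = (p, q)" by fastforce
  note c = M2.form_covec[OF \<beta>, of q] M2.form_covec[OF \<beta>', of q]
  show "G (V \<beta>) (V \<beta>') z = inverse (f (fst z) ^ 2) * G2 \<beta> \<beta>' (snd z)"
    using c M2.metric_sharp(1)[OF c(2)]
    by (simp add: z form_inner_def V_point cometric_vl vl_covec vl_apply inc2_tangent M2.cometric_eq divide_inverse)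
qed

text \<open>The cometric is nondegenerate and every covector is the sum of a horizontal and a
vertical one. The tests use lifts of one-forms rather than of covectors, because the Koszul formula
speaks about one-forms.\<close>

lemma covec_eq_on_lifts:
  assumes "\<gamma> \<in> M.CT (p, q)" "\<delta> \<in> M.CT (p, q)"
    and H: "\<And>\<alpha>. \<alpha> \<in> M1.\<Omega> \<Longrightarrow> cometric A g (p, q) \<gamma> (H \<alpha> (p, q)) = cometric A g (p, q) \<delta> (H \<alpha> (p, q))"
    and V: "\<And>\<beta>. \<beta> \<in> M2.\<Omega> \<Longrightarrow> cometric A g (p, q) \<gamma> (V \<beta> (p, q)) = cometric A g (p, q) \<delta> (V \<beta> (p, q))"
  shows "\<gamma> = \<delta>"
proof (rule M.cometric_eqI[OF assms(1,2)])
  fix \<theta> assume t: "\<theta> \<in> M.CT (p, q)"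
  obtain F1 where F1: "F1 \<in> M1.C" "M1.d F1 p = hr p q \<theta>"
    using M1.covec_is_differential[OF hr_covec[OF t]] .
  obtain F2 where F2: "F2 \<in> M2.C" "M2.d F2 q = vr p q \<theta>"
    using M2.covec_is_differential[OF vr_covec[OF t]] .
  have eq: "\<theta> = (\<lambda>v. 1 * H (M1.d F1) (p, q) v + 1 * V (M2.d F2) (p, q) v)"
    using covec_decompose[OF t] by (simp add: H_point V_point F1 F2)
  have c: "H (M1.d F1) (p, q) \<in> M.CT (p, q)" "V (M2.d F2) (p, q) \<in> M.CT (p, q)"
    using M.form_covec H_form V_form M1.differential_form M2.differential_form F1 F2 by blast+
  show "cometric A g (p, q) \<gamma> \<theta> = cometric A g (p, q) \<delta> \<theta>"
    unfolding eq M.cometric_lincomb_right[OF c assms(1)] M.cometric_lincomb_right[OF c assms(2)]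
    using H[OF M1.differential_form[OF F1(1)]] V[OF M2.differential_form[OF F2(1)]] by simp
qed

lemma bivector_H:
  assumes "\<omega> \<in> M1.\<Omega>" "\<eta> \<in> M.CT (p, q)"
  shows "P (p, q) (H \<omega> (p, q)) \<eta> = P1 p (\<omega> p) (hr p q \<eta>)"
  using M1.form_covec[OF assms(1)] assms(2) P2
  by (simp add: bivector_point H_point hr_hl vr_hl M2.bivector_zero_left vr_covec)

lemma bivector_V:
  assumes "\<omega> \<in> M2.\<Omega>" "\<eta> \<in> M.CT (p, q)"
  shows "P (p, q) (V \<omega> (p, q)) \<eta> = nu p * P2 q (\<omega> q) (vr p q \<eta>)"
  using M2.form_covec[OF assms(1)] assms(2) P1
  by (simp add: bivector_point V_point vr_vl hr_vl M1.bivector_zero_left hr_covec)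

lemma sharp_H:
  assumes "\<omega> \<in> M1.\<Omega>"
  shows "sharp A P (H \<omega>) (p, q) = inc1 q (sharp A1 P1 \<omega> p)"
proof (rule M.sharp_eqI)
  note s = M1.sharp_tangent[where P = P1 and \<omega> = \<omega> and p = p, OF P1 M1.form_covec[OF assms]]
  show "inc1 q (sharp A1 P1 \<omega> p) \<in> M.T (p, q)" by (rule inc1_tangent(1)[OF s(1)])
  fix \<eta> assume e: "\<eta> \<in> M.CT (p, q)"
  show "\<eta> (inc1 q (sharp A1 P1 \<omega> p)) = P (p, q) (H \<omega> (p, q)) \<eta>"
    using s(2)[OF hr_covec[OF e]] by (simp add: bivector_H[OF assms e] hr_apply[OF s(1)])
qed

lemma sharp_V:
  assumes "\<omega> \<in> M2.\<Omega>"
  shows "sharp A P (V \<omega>) (p, q) = (\<lambda>F. nu p * inc2 p (sharp A2 P2 \<omega> q) F)"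
proof (rule M.sharp_eqI)
  note s = M2.sharp_tangent[where P = P2 and \<omega> = \<omega> and p = q, OF P2 M2.form_covec[OF assms]]
  show "(\<lambda>F. nu p * inc2 p (sharp A2 P2 \<omega> q) F) \<in> M.T (p, q)"
    by (rule M.tangent_scale[OF inc2_tangent(1)[OF s(1)]])
  fix \<eta> assume e: "\<eta> \<in> M.CT (p, q)"
  show "\<eta> (\<lambda>F. nu p * inc2 p (sharp A2 P2 \<omega> q) F) = P (p, q) (V \<omega> (p, q)) \<eta>"
    using s(2)[OF vr_covec[OF e]] M.covec_scale[OF e inc2_tangent(1)[OF s(1)]]
    by (simp add: bivector_V[OF assms e] vr_apply[OF s(1)])
qed

lemma sharp_H_fst: "\<omega> \<in> M1.\<Omega> \<Longrightarrow> F \<in> M1.C \<Longrightarrow> sharp A P (H \<omega>) z (F \<circ> fst) = sharp A1 P1 \<omega> (fst z) F"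
  by (cases z) (simp add: sharp_H inc1_fst)

lemma sharp_H_snd: "\<omega> \<in> M1.\<Omega> \<Longrightarrow> sharp A P (H \<omega>) z (F \<circ> snd) = 0"
  by (cases z) (simp add: sharp_H inc1_snd[OF M1.VF_tangent[OF M1.sharp_VF[OF P1]]])

lemma sharp_V_snd: "\<omega> \<in> M2.\<Omega> \<Longrightarrow> F \<in> M2.C \<Longrightarrow> sharp A P (V \<omega>) z (F \<circ> snd) = nu (fst z) * sharp A2 P2 \<omega> (snd z) F"
  by (cases z) (simp add: sharp_V inc2_snd)

lemma sharp_V_fst: "\<omega> \<in> M2.\<Omega> \<Longrightarrow> sharp A P (V \<omega>) z (F \<circ> fst) = 0"
  by (cases z) (simp add: sharp_V inc2_fst[OF M2.VF_tangent[OF M2.sharp_VF[OF P2]]])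

lemma sharp_H_VF:
  assumes "\<omega> \<in> M1.\<Omega>" shows "sharp A P (H \<omega>) \<in> M.VF"
proof (rule product_VF_I)
  have X: "sharp A1 P1 \<omega> \<in> M1.VF" by (rule M1.sharp_VF[OF P1 assms])
  show "sharp A P (H \<omega>) z \<in> M.T z" for z
    using inc1_tangent(1)[OF M1.VF_tangent[OF X]] by (cases z) (simp add: sharp_H[OF assms])
  show "(\<lambda>z. sharp A P (H \<omega>) z (F \<circ> fst)) \<in> M.C" if "F \<in> M1.C" for F
    using smooth_fst[OF M1.VF_smooth[OF X that]] unfolding sharp_H_fst[OF assms that] unfolding comp_def .
  show "(\<lambda>z. sharp A P (H \<omega>) z (F \<circ> snd)) \<in> M.C" for F
    by (simp add: sharp_H_snd[OF assms] M.smooth_const)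
qed

lemma sharp_V_VF:
  assumes "\<omega> \<in> M2.\<Omega>" shows "sharp A P (V \<omega>) \<in> M.VF"
proof (rule product_VF_I)
  have X: "sharp A2 P2 \<omega> \<in> M2.VF" by (rule M2.sharp_VF[OF P2 assms])
  show "sharp A P (V \<omega>) z \<in> M.T z" for z
    using M.tangent_scale[OF inc2_tangent(1)[OF M2.VF_tangent[OF X]]] by (cases z) (simp add: sharp_V[OF assms])
  show "(\<lambda>z. sharp A P (V \<omega>) z (F \<circ> snd)) \<in> M.C" if "F \<in> M2.C" for F
    using M.smooth_mult[OF smooth_fst[OF nu] smooth_snd[OF M2.VF_smooth[OF X that]]]
    unfolding sharp_V_snd[OF assms that] unfolding comp_def .
  show "(\<lambda>z. sharp A P (V \<omega>) z (F \<circ> fst)) \<in> M.C" for F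
    by (simp add: sharp_V_fst[OF assms] M.smooth_const)
qed

lemma bivector_HH:
  assumes "\<omega> \<in> M1.\<Omega>" "\<omega>' \<in> M1.\<Omega>"
  shows "P (p, q) (H \<omega> (p, q)) (H \<omega>' (p, q)) = P1 p (\<omega> p) (\<omega>' p)"
  unfolding bivector_H[OF assms(1) M.form_covec[OF H_form[OF assms(2)]]]
  by (simp add: H_point hr_hl M1.form_covec assms)

lemma bivector_HV:
  assumes "\<omega> \<in> M1.\<Omega>" "\<eta> \<in> M2.\<Omega>"
  shows "P (p, q) (H \<omega> (p, q)) (V \<eta> (p, q)) = 0"
  unfolding bivector_H[OF assms(1) M.form_covec[OF V_form[OF assms(2)]]]
  by (simp add: V_point hr_vl M1.form_covec M2.form_covec assms M1.bivector_zero_right P1)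

lemma bivector_VH:
  assumes "\<omega> \<in> M1.\<Omega>" "\<eta> \<in> M2.\<Omega>"
  shows "P (p, q) (V \<eta> (p, q)) (H \<omega> (p, q)) = 0"
  unfolding bivector_V[OF assms(2) M.form_covec[OF H_form[OF assms(1)]]]
  by (simp add: H_point vr_hl M1.form_covec M2.form_covec assms M2.bivector_zero_right P2)

lemma bivector_VV:
  assumes "\<eta> \<in> M2.\<Omega>" "\<eta>' \<in> M2.\<Omega>"
  shows "P (p, q) (V \<eta> (p, q)) (V \<eta>' (p, q)) = nu p * P2 q (\<eta> q) (\<eta>' q)"
  unfolding bivector_V[OF assms(1) M.form_covec[OF V_form[OF assms(2)]]]
  by (simp add: V_point vr_vl M2.form_covec assms)

lemma differential_zero: "M.d (\<lambda>z. 0) = (\<lambda>z v. 0)"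
  by (auto simp: differential_def M.tangent_const fun_eq_iff)

lemma bracket_HH:
  assumes \<omega>: "\<omega> \<in> M1.\<Omega>" and \<eta>: "\<eta> \<in> M1.\<Omega>"
  shows "form_bracket A P (H \<omega>) (H \<eta>) = H (form_bracket A1 P1 \<omega> \<eta>)"
proof
  fix z :: "'m \<times> 'n"
  obtain p q where z: "z = (p, q)" by fastforce
  have X: "sharp A1 P1 \<omega> \<in> M1.VF" "sharp A1 P1 \<eta> \<in> M1.VF" using M1.sharp_VF[OF P1] \<omega> \<eta> by auto
  have pc: "(\<lambda>p. P1 p (\<omega> p) (\<eta> p)) \<in> M1.C" by (rule M1.bivector_smooth[OF P1 \<omega> \<eta>])
  have P: "(\<lambda>z. P z (H \<omega> z) (H \<eta> z)) = (\<lambda>p. P1 p (\<omega> p) (\<eta> p)) \<circ> fst"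
    using bivector_HH[OF \<omega> \<eta>] by (auto simp: fun_eq_iff)
  have b: "form_bracket A P (H \<omega>) (H \<eta>) \<in> M.\<Omega>"
    by (rule M.bracket_form[where \<omega> = "H \<omega>" and \<eta> = "H \<eta>", OF sharp_H_VF[OF \<omega>] sharp_H_VF[OF \<eta>] H_form[OF \<omega>] H_form[OF \<eta>]])
      (simp add: P smooth_fst[OF pc])
  have b1: "form_bracket A1 P1 \<omega> \<eta> \<in> M1.\<Omega>" by (rule M1.bracket_form[where P = P1 and \<omega> = \<omega> and \<eta> = \<eta>, OF X \<omega> \<eta> pc])
  show "form_bracket A P (H \<omega>) (H \<eta>) z = H (form_bracket A1 P1 \<omega> \<eta>) z"
  proof (rule M.covec_eqI[OF M.form_covec[OF b] M.form_covec[OF H_form[OF b1]]])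
    fix v assume v': "v \<in> M.T z"
    then have v: "v \<in> M.T (p, q)" by (simp add: z)
    show "form_bracket A P (H \<omega>) (H \<eta>) z v = H (form_bracket A1 P1 \<omega> \<eta>) z v"
      unfolding z H_point hl_apply[OF v]
      unfolding form_bracket_def form_diff_def P
      by (simp add: lie_derivative_H[OF sharp_H_VF[OF \<omega>] X(1) \<eta> M.smooth_const[of 1] _ v] sharp_H_fst \<omega> \<eta> M.tangent_const[OF v]
          lie_derivative_H[OF sharp_H_VF[OF \<eta>] X(2) \<omega> M.smooth_const[of 1] _ v] M.differential_apply[OF v] M1.differential_apply[OF push_tangent(1)[OF v]] push1_apply[OF pc])
  qed
qed

text \<open>The derivatives of lifted functions along fields of the other factor vanish, so both Lie
derivatives are zero.\<close>

lemma bracket_HV: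
  assumes \<omega>: "\<omega> \<in> M1.\<Omega>" and \<eta>: "\<eta> \<in> M2.\<Omega>"
  shows "form_bracket A P (H \<omega>) (V \<eta>) = (\<lambda>z v. 0)" "form_bracket A P (V \<eta>) (H \<omega>) = (\<lambda>z v. 0)"
proof -
  have P: "(\<lambda>z. P z (H \<omega> z) (V \<eta> z)) = (\<lambda>z. 0)" "(\<lambda>z. P z (V \<eta> z) (H \<omega> z)) = (\<lambda>z. 0)"
    using bivector_HV[OF \<omega> \<eta>] bivector_VH[OF \<omega> \<eta>] by (auto simp: fun_eq_iff)
  have l1: "lie_derivative A (sharp A P (H \<omega>)) (V \<eta>) z v = 0" if v: "v \<in> M.T z" for z v
    using v lie_derivative_V[OF sharp_H_VF[OF \<omega>] M2.VF_I[OF M2.tangent_zero M2.smooth_const] \<eta> M.smooth_const[of 0]]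
    by (cases z) (simp add: sharp_H_snd[OF \<omega>] M.tangent_const)
  have l2: "lie_derivative A (sharp A P (V \<eta>)) (H \<omega>) z v = 0" if v: "v \<in> M.T z" for z v
    using v lie_derivative_H[OF sharp_V_VF[OF \<eta>] M1.VF_I[OF M1.tangent_zero M1.smooth_const] \<omega> M.smooth_const[of 0]]
    by (cases z) (simp add: sharp_V_fst[OF \<eta>] M.tangent_const)
  have l: "lie_derivative A (sharp A P (H \<omega>)) (V \<eta>) = (\<lambda>z v. 0)"
    "lie_derivative A (sharp A P (V \<eta>)) (H \<omega>) = (\<lambda>z v. 0)"
    by (rule M.form_eq_zero[OF M.lie_derivative(1)[OF sharp_H_VF[OF \<omega>] V_form[OF \<eta>]] l1]
          M.form_eq_zero[OF M.lie_derivative(1)[OF sharp_V_VF[OF \<eta>] H_form[OF \<omega>]] l2], assumption)+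
  show "form_bracket A P (H \<omega>) (V \<eta>) = (\<lambda>z v. 0)" "form_bracket A P (V \<eta>) (H \<omega>) = (\<lambda>z v. 0)"
    by (simp_all add: form_bracket_def form_diff_def P l differential_zero)
qed

text \<open>Differentiating the factor \<open>\<nu>\<close> in the sharp map of a vertical form produces
\<open>\<Pi>\<^sub>2(\<omega>, \<eta>) d\<nu>\<close> in each of the two Lie derivatives, with opposite signs before they are
subtracted, and once more in the differential of \<open>\<nu> \<Pi>\<^sub>2(\<omega>, \<eta>)\<close>, which is subtracted; one copy
remains.\<close>

lemma bracket_VV:
  assumes \<omega>: "\<omega> \<in> M2.\<Omega>" and \<eta>: "\<eta> \<in> M2.\<Omega>"
  shows "form_bracket A P (V \<omega>) (V \<eta>) = form_add (form_mult (nu \<circ> fst) (V (form_bracket A2 P2 \<omega> \<eta>)))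
    (form_mult ((\<lambda>q. P2 q (\<omega> q) (\<eta> q)) \<circ> snd) (H (M1.d nu)))"
proof
  fix z :: "'m \<times> 'n"
  obtain p q where z: "z = (p, q)" by fastforce
  have X: "sharp A2 P2 \<omega> \<in> M2.VF" "sharp A2 P2 \<eta> \<in> M2.VF" using M2.sharp_VF[OF P2] \<omega> \<eta> by auto
  let ?p = "\<lambda>q. P2 q (\<omega> q) (\<eta> q)"
  have pc: "?p \<in> M2.C" by (rule M2.bivector_smooth[OF P2 \<omega> \<eta>])
  have P: "(\<lambda>z. P z (V \<omega> z) (V \<eta> z)) = (\<lambda>z. (nu \<circ> fst) z * (?p \<circ> snd) z)"
    using bivector_VV[OF \<omega> \<eta>] by (auto simp: fun_eq_iff)
  have b: "form_bracket A P (V \<omega>) (V \<eta>) \<in> M.\<Omega>"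
    by (rule M.bracket_form[where \<omega> = "V \<omega>" and \<eta> = "V \<eta>", OF sharp_V_VF[OF \<omega>] sharp_V_VF[OF \<eta>] V_form[OF \<omega>] V_form[OF \<eta>]])
      (unfold P, rule M.smooth_mult[OF smooth_fst[OF nu] smooth_snd[OF pc]])
  have b2: "form_bracket A2 P2 \<omega> \<eta> \<in> M2.\<Omega>" by (rule M2.bracket_form[where P = P2 and \<omega> = \<omega> and \<eta> = \<eta>, OF X \<omega> \<eta> pc])
  have rhs: "form_add (form_mult (nu \<circ> fst) (V (form_bracket A2 P2 \<omega> \<eta>))) (form_mult (?p \<circ> snd) (H (M1.d nu))) \<in> M.\<Omega>"
    by (intro M.form_add_closed M.form_mult_closed smooth_fst smooth_snd nu pc V_form H_form b2 M1.differential_form)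
  show "form_bracket A P (V \<omega>) (V \<eta>) z = form_add (form_mult (nu \<circ> fst) (V (form_bracket A2 P2 \<omega> \<eta>)))
    (form_mult (?p \<circ> snd) (H (M1.d nu))) z"
  proof (rule M.covec_eqI[OF M.form_covec[OF b] M.form_covec[OF rhs]])
    fix v assume v': "v \<in> M.T z"
    then have v: "v \<in> M.T (p, q)" by (simp add: z)
    have e: "\<eta> q (sharp A2 P2 \<omega> q) = ?p q" "\<omega> q (sharp A2 P2 \<eta> q) = - ?p q"
      using M2.sharp_tangent(2)[where P = P2 and \<omega> = \<omega> and p = q, OF P2 M2.form_covec[OF \<omega>] M2.form_covec[OF \<eta>]]
        M2.sharp_tangent(2)[where P = P2 and \<omega> = \<eta> and p = q, OF P2 M2.form_covec[OF \<eta>] M2.form_covec[OF \<omega>]]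
        M2.bivector_alternating[OF P2 M2.form_covec[OF \<omega>] M2.form_covec[OF \<eta>], of q] by auto
    have l: "lie_derivative A (sharp A P (V \<omega>)) (V \<eta>) (p, q) v
        = nu p * lie_derivative A2 (sharp A2 P2 \<omega>) \<eta> q (push2 v) + v (nu \<circ> fst) * ?p q"
      "lie_derivative A (sharp A P (V \<eta>)) (V \<omega>) (p, q) v
        = nu p * lie_derivative A2 (sharp A2 P2 \<eta>) \<omega> q (push2 v) - v (nu \<circ> fst) * ?p q"
      using lie_derivative_V[OF sharp_V_VF[OF \<omega>] X(1) \<eta> smooth_fst[OF nu] _ v]
        lie_derivative_V[OF sharp_V_VF[OF \<eta>] X(2) \<omega> smooth_fst[OF nu] _ v]
      by (simp_all add: e sharp_V_snd \<omega> \<eta>)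
    have dp: "v (\<lambda>z. (nu \<circ> fst) z * (?p \<circ> snd) z) = nu p * push2 v ?p + ?p q * v (nu \<circ> fst)"
      using M.tangent_derivation(2)[OF v smooth_fst[OF nu] smooth_snd[OF pc]] by (simp add: push2_apply[OF pc])
    have "form_bracket A P (V \<omega>) (V \<eta>) (p, q) v = nu p * lie_derivative A2 (sharp A2 P2 \<omega>) \<eta> q (push2 v) + v (nu \<circ> fst) * ?p q
      - (nu p * lie_derivative A2 (sharp A2 P2 \<eta>) \<omega> q (push2 v) - v (nu \<circ> fst) * ?p q)
      - (nu p * push2 v ?p + ?p q * v (nu \<circ> fst))"
      by (simp only: form_bracket_def form_diff_def P M.differential_apply[OF v] l dp)
    also have "\<dots> = nu p * form_bracket A2 P2 \<omega> \<eta> q (push2 v) + ?p q * push1 v nu"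
      by (simp add: form_bracket_def form_diff_def M2.differential_apply[OF push_tangent(2)[OF v]]
          push1_apply[OF nu] algebra_simps)
    finally show "form_bracket A P (V \<omega>) (V \<eta>) z v = form_add (form_mult (nu \<circ> fst) (V (form_bracket A2 P2 \<omega> \<eta>)))
        (form_mult (?p \<circ> snd) (H (M1.d nu))) z v"
      by (simp add: z form_add_def form_mult_def H_point V_point hl_apply[OF v] vl_apply[OF v]
          M1.differential_apply[OF push_tangent(1)[OF v]])
  qed
qed

lemma sharp_H_product:
  assumes "\<omega> \<in> M1.\<Omega>" "F \<in> M1.C" "K \<in> M2.C"
  shows "sharp A P (H \<omega>) (p, q) (\<lambda>z. F (fst z) * K (snd z)) = sharp A1 P1 \<omega> p F * K q"
  using M.tangent_derivation(2)[OF M.VF_tangent[OF sharp_H_VF[OF assms(1)]] smooth_fst[OF assms(2)] smooth_snd[OF assms(3)], of "(p, q)"]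
    sharp_H_fst[OF assms(1,2), of "(p, q)"] sharp_H_snd[OF assms(1), of "(p, q)" K]
  by (simp add: mult.commute)

lemma sharp_V_product:
  assumes "\<omega> \<in> M2.\<Omega>" "F \<in> M1.C" "K \<in> M2.C"
  shows "sharp A P (V \<omega>) (p, q) (\<lambda>z. F (fst z) * K (snd z)) = F p * nu p * sharp A2 P2 \<omega> q K"
  using M.tangent_derivation(2)[OF M.VF_tangent[OF sharp_V_VF[OF assms(1)]] smooth_fst[OF assms(2)] smooth_snd[OF assms(3)], of "(p, q)"]
    sharp_V_snd[OF assms(1,3), of "(p, q)"] sharp_V_fst[OF assms(1), of "(p, q)" F]
  by simp

lemma sharp_zero: "\<omega> \<in> M1.\<Omega> \<Longrightarrow> sharp A P (H \<omega>) z (\<lambda>z. 0) = 0" "\<eta> \<in> M2.\<Omega> \<Longrightarrow> sharp A P (V \<eta>) z (\<lambda>z. 0) = 0"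
  using M.tangent_const M.VF_tangent sharp_H_VF sharp_V_VF by blast+

abbreviation "j \<equiv> endo_J A1 g1 P1 (M1.d f)"
abbreviation "J2 \<equiv> endo_J A2 g2 P2"

lemma j_form: "j \<in> M1.\<Omega>" by (rule M1.endo_J_form[OF P1 M1.differential_form[OF f]])
lemma J2_form: "\<eta> \<in> M2.\<Omega> \<Longrightarrow> J2 \<eta> \<in> M2.\<Omega>" by (rule M2.endo_J_form[OF P2])
lemma dnu_form: "M1.d nu \<in> M1.\<Omega>" by (rule M1.differential_form[OF nu])

lemma inner_J2: "\<eta> \<in> M2.\<Omega> \<Longrightarrow> \<gamma> \<in> M2.\<Omega> \<Longrightarrow> G2 (J2 \<eta>) \<gamma> q = P2 q (\<eta> q) (\<gamma> q)"
  unfolding form_inner_def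
  by (rule M2.endo_J_covec(2)[where \<omega> = \<eta>, OF P2 M2.form_covec M2.form_covec])

lemma inner_J2_swap:
  assumes "\<eta> \<in> M2.\<Omega>" "\<gamma> \<in> M2.\<Omega>"
  shows "G2 (J2 \<eta>) \<gamma> q = - G2 (J2 \<gamma>) \<eta> q"
  unfolding inner_J2[OF assms] inner_J2[OF assms(2,1)]
  by (rule M2.bivector_alternating[OF P2 M2.form_covec[OF assms(1)] M2.form_covec[OF assms(2)]])

lemma inner_J2_self: "\<eta> \<in> M2.\<Omega> \<Longrightarrow> G2 (J2 \<eta>) \<eta> q = 0"
  using inner_J2_swap[of \<eta> \<eta> q] by simp

text \<open>The sign comes from \<open>\<sharp>\<omega>(f) = \<Pi>\<^sub>1(\<omega>, df) = - \<Pi>\<^sub>1(df, \<omega>)\<close>.\<close>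

lemma sharp_f: "\<omega> \<in> M1.\<Omega> \<Longrightarrow> sharp A1 P1 \<omega> p f = - G1 j \<omega> p"
proof -
  assume \<omega>: "\<omega> \<in> M1.\<Omega>"
  have "G1 j \<omega> p = P1 p (M1.d f p) (\<omega> p)"
    unfolding form_inner_def
    by (rule M1.endo_J_covec(2)[where \<omega> = "M1.d f", OF P1 M1.differential_covec M1.form_covec[OF \<omega>]])
  then show ?thesis
    using M1.sharp_fun[where \<omega> = \<omega>, OF P1 M1.form_covec[OF \<omega>], of p f]
      M1.bivector_alternating[OF P1 M1.form_covec[OF \<omega>] M1.differential_covec, of p f] by simp
qed

lemma f_nonzero: "f p \<noteq> 0" using f_pos[of p] by simp

lemma smooth_inverse_power: "(\<lambda>p. inverse (f p ^ n)) \<in> M1.C"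
  using f_nonzero by (intro M1.smooth_inverse M1.smooth_power f) simp

lemma sharp_inverse_power:
  assumes \<omega>: "\<omega> \<in> M1.\<Omega>"
  shows "sharp A1 P1 \<omega> p (\<lambda>p. inverse (f p ^ n)) = n * G1 j \<omega> p / f p ^ Suc n"
proof -
  have T: "sharp A1 P1 \<omega> p \<in> M1.T p" by (rule M1.VF_tangent[OF M1.sharp_VF[OF P1 \<omega>]])
  have "sharp A1 P1 \<omega> p (\<lambda>p. inverse (f p ^ n)) = - (n * f p ^ (n - 1) * (- G1 j \<omega> p)) / (f p ^ n)\<^sup>2"
    using M1.tangent_inverse[OF T M1.smooth_power[OF f]] f_nonzero
    by (simp add: M1.tangent_power[OF T f] sharp_f[OF \<omega>])
  also have "\<dots> = n * G1 j \<omega> p / f p ^ Suc n"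
    using f_nonzero[of p] by (cases n) (simp_all add: field_simps power2_eq_square)
  finally show ?thesis .
qed

end

section \<open>The connection and the sectional curvature of a warped product\<close>

locale warped_levi_civita = warped_product A1 A2 g1 g2 P1 P2 f nu
    + M1: levi_civita_manifold A1 g1 P1 D1 + M2: levi_civita_manifold A2 g2 P2 D2
  for A1 :: "('m::{t2_space,second_countable_topology}, 'e::euclidean_space) chart set"
    and A2 :: "('n::{t2_space,second_countable_topology}, 'f::euclidean_space) chart set"
    and g1 g2 P1 P2 f nu D1 D2 +
  fixes D :: "('m \<times> 'n) form \<Rightarrow> ('m \<times> 'n) form \<Rightarrow> ('m \<times> 'n) form"
  assumes product_levi_civita: "contravariant_levi_civita A g P D"
begin

sublocale M: levi_civita_manifold A g P D
  by unfold_locales (rule product_levi_civita)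

lemma inner_zero_form: "\<theta> \<in> M.\<Omega> \<Longrightarrow> G (\<lambda>z v. 0) \<theta> z = 0"
  unfolding form_inner_def by (rule M.cometric_zero_left[OF M.form_covec])

lemma sharp_inverse_square: "\<omega> \<in> M1.\<Omega> \<Longrightarrow> sharp A1 P1 \<omega> p (\<lambda>p. inverse (f p ^ 2)) = 2 * G1 j \<omega> p / f p ^ 3"
  using sharp_inverse_power[of \<omega> p 2] by (simp only: Suc_numeral add_num_simps of_nat_numeral)

lemma sharp_inverse_cube: "\<omega> \<in> M1.\<Omega> \<Longrightarrow> sharp A1 P1 \<omega> p (\<lambda>p. inverse (f p ^ 3)) = 3 * G1 j \<omega> p / f p ^ 4"
  using sharp_inverse_power[of \<omega> p 3] by (simp only: Suc_numeral add_num_simps of_nat_numeral)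

lemma inner_bracket_VV:
  assumes "\<omega> \<in> M2.\<Omega>" "\<eta> \<in> M2.\<Omega>" "\<theta> \<in> M.\<Omega>"
  shows "G (form_bracket A P (V \<omega>) (V \<eta>)) \<theta> (p, q) =
    nu p * G (V (form_bracket A2 P2 \<omega> \<eta>)) \<theta> (p, q) + P2 q (\<omega> q) (\<eta> q) * G (H (M1.d nu)) \<theta> (p, q)"
  using M.cometric_lincomb_left[OF M.form_covec[OF V_form[OF M2.bracket_closed[OF assms(1,2)]]]
      M.form_covec[OF H_form[OF dnu_form]] M.form_covec[OF assms(3)]]
  by (simp add: bracket_VV[OF assms(1,2)] form_inner_def form_add_def form_mult_def)

text \<open>Tested against horizontal lifts, the Koszul formula of the product becomes the one of the first
factor; tested against vertical lifts, each of its terms vanishes.\<close>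

lemma D_HH:
  assumes \<omega>: "\<omega> \<in> M1.\<Omega>" and \<eta>: "\<eta> \<in> M1.\<Omega>"
  shows "D (H \<omega>) (H \<eta>) = H (D1 \<omega> \<eta>)"
proof
  fix z :: "'m \<times> 'n"
  obtain p q where z: "z = (p, q)" by fastforce
  note D = M.D_form[OF H_form[OF \<omega>] H_form[OF \<eta>]] and D1 = M1.D_form[OF \<omega> \<eta>]
  show "D (H \<omega>) (H \<eta>) z = H (D1 \<omega> \<eta>) z"
    unfolding z
  proof (rule covec_eq_on_lifts[OF M.form_covec[OF D] M.form_covec[OF H_form[OF D1]]],
      unfold form_inner_def[symmetric, where p = "(p, q)"])
    fix \<alpha> assume \<alpha>: "\<alpha> \<in> M1.\<Omega>"
    have "2 * G (D (H \<omega>) (H \<eta>)) (H \<alpha>) (p, q) = 2 * G1 (D1 \<omega> \<eta>) \<alpha> p"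
      unfolding M.koszul[OF H_form[OF \<omega>] H_form[OF \<eta>] H_form[OF \<alpha>]] M1.koszul[OF \<omega> \<eta> \<alpha>]
      by (simp add: bracket_HH inner_HH sharp_H_fst M1.form_inner_smooth M1.bracket_closed \<omega> \<eta> \<alpha> del: comp_apply)
        (simp add: comp_def)
    then show "G (D (H \<omega>) (H \<eta>)) (H \<alpha>) (p, q) = G (H (D1 \<omega> \<eta>)) (H \<alpha>) (p, q)"
      by (simp add: inner_HH D1 \<alpha>)
  next
    fix \<beta> assume \<beta>: "\<beta> \<in> M2.\<Omega>"
    have "2 * G (D (H \<omega>) (H \<eta>)) (V \<beta>) (p, q) = 0"
      unfolding M.koszul[OF H_form[OF \<omega>] H_form[OF \<eta>] V_form[OF \<beta>]]
      by (simp add: bracket_HH bracket_HV inner_HH inner_HV sharp_V_fst sharp_zero inner_zero_form H_form M1.bracket_closed \<omega> \<eta> \<beta>)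
    then show "G (D (H \<omega>) (H \<eta>)) (V \<beta>) (p, q) = G (H (D1 \<omega> \<eta>)) (V \<beta>) (p, q)"
      by (simp add: inner_HV D1 \<beta>)
  qed
qed

text \<open>In the Koszul formula only the derivative of the factor \<open>1/f\<^sup>2\<close> of the vertical
cometric and the horizontal part of the bracket \<open>[\<eta>\<^sup>v, \<beta>\<^sup>v]\<close> survive.\<close>

lemma inner_D_HV:
  assumes \<omega>: "\<omega> \<in> M1.\<Omega>" and \<eta>: "\<eta> \<in> M2.\<Omega>"
  shows "\<alpha> \<in> M1.\<Omega> \<Longrightarrow> G (D (H \<omega>) (V \<eta>)) (H \<alpha>) = (\<lambda>z. 0)"
    and "\<beta> \<in> M2.\<Omega> \<Longrightarrow> G (D (H \<omega>) (V \<eta>)) (V \<beta>) (p, q) =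
      G1 j \<omega> p / f p ^ 3 * G2 \<eta> \<beta> q - G1 (M1.d nu) \<omega> p / 2 * G2 (J2 \<eta>) \<beta> q"
proof -
  show "G (D (H \<omega>) (V \<eta>)) (H \<alpha>) = (\<lambda>z. 0)" if \<alpha>: "\<alpha> \<in> M1.\<Omega>"
  proof
    fix z
    have "2 * G (D (H \<omega>) (V \<eta>)) (H \<alpha>) z = 0"
      unfolding M.koszul[OF H_form[OF \<omega>] V_form[OF \<eta>] H_form[OF \<alpha>]]
      by (simp add: bracket_HH bracket_HV inner_HH inner_HV inner_VH sharp_V_fst sharp_zero inner_zero_form
          H_form V_form M1.bracket_closed \<omega> \<eta> \<alpha>)
    then show "G (D (H \<omega>) (V \<eta>)) (H \<alpha>) z = 0" by simp
  qed
  show "G (D (H \<omega>) (V \<eta>)) (V \<beta>) (p, q) =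
      G1 j \<omega> p / f p ^ 3 * G2 \<eta> \<beta> q - G1 (M1.d nu) \<omega> p / 2 * G2 (J2 \<eta>) \<beta> q" if \<beta>: "\<beta> \<in> M2.\<Omega>"
  proof -
    have "2 * G (D (H \<omega>) (V \<eta>)) (V \<beta>) (p, q)
        = sharp A1 P1 \<omega> p (\<lambda>p. inverse (f p ^ 2)) * G2 \<eta> \<beta> q - P2 q (\<eta> q) (\<beta> q) * G1 (M1.d nu) \<omega> p"
      unfolding M.koszul[OF H_form[OF \<omega>] V_form[OF \<eta>] V_form[OF \<beta>]]
        inner_bracket_VV[OF \<eta> \<beta> H_form[OF \<omega>]]
      by (simp add: bracket_HV inner_HH inner_HV inner_VH inner_VV sharp_zero inner_zero_form V_form
          sharp_H_product[OF \<omega> smooth_inverse_power] M2.form_inner_smooth M2.bracket_closed dnu_form \<omega> \<eta> \<beta>)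
    also have "\<dots> = 2 * (G1 j \<omega> p / f p ^ 3 * G2 \<eta> \<beta> q - G1 (M1.d nu) \<omega> p / 2 * G2 (J2 \<eta>) \<beta> q)"
      unfolding sharp_inverse_square[OF \<omega>] inner_J2[OF \<eta> \<beta>] by (simp add: algebra_simps)
    finally show ?thesis by simp
  qed
qed

text \<open>The bracket of a horizontal and a vertical lift is zero, so torsion-freeness makes the two
derivatives equal.\<close>

lemma D_VH:
  assumes "\<omega> \<in> M1.\<Omega>" "\<eta> \<in> M2.\<Omega>"
  shows "D (V \<eta>) (H \<omega>) = D (H \<omega>) (V \<eta>)"
  using M.torsion_free[OF H_form[OF assms(1)] V_form[OF assms(2)]] bracket_HV(1)[OF assms]
  by (auto simp: form_diff_def fun_eq_iff)

lemma D_HV: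
  assumes \<omega>: "\<omega> \<in> M1.\<Omega>" and \<eta>: "\<eta> \<in> M2.\<Omega>"
  shows "D (H \<omega>) (V \<eta>) (p, q) = (\<lambda>v. (G1 j \<omega> p / f p) * V \<eta> (p, q) v
    + (- ((f p)\<^sup>2 * G1 (M1.d nu) \<omega> p / 2)) * V (J2 \<eta>) (p, q) v)" (is "_ = ?rhs")
proof -
  note c = M.form_covec[OF V_form[OF \<eta>], of "(p, q)"] M.form_covec[OF V_form[OF J2_form[OF \<eta>]], of "(p, q)"]
  note Dc = M.form_covec[OF M.D_form[OF H_form[OF \<omega>] V_form[OF \<eta>]], of "(p, q)"]
  note fi = form_inner_def[symmetric, where p = "(p, q)"]
  show ?thesis
  proof (rule covec_eq_on_lifts[OF Dc M.cot_lincomb[OF c]])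
    fix \<alpha> assume \<alpha>: "\<alpha> \<in> M1.\<Omega>"
    show "cometric A g (p, q) (D (H \<omega>) (V \<eta>) (p, q)) (H \<alpha> (p, q)) = cometric A g (p, q) ?rhs (H \<alpha> (p, q))"
      unfolding M.cometric_lincomb_left[OF c M.form_covec[OF H_form[OF \<alpha>]]] fi
      by (simp add: inner_D_HV(1)[OF \<omega> \<eta> \<alpha>] inner_VH \<alpha> \<eta> J2_form)
  next
    fix \<beta> assume \<beta>: "\<beta> \<in> M2.\<Omega>"
    show "cometric A g (p, q) (D (H \<omega>) (V \<eta>) (p, q)) (V \<beta> (p, q)) = cometric A g (p, q) ?rhs (V \<beta> (p, q))"
      unfolding M.cometric_lincomb_left[OF c M.form_covec[OF V_form[OF \<beta>]]] fi
      using f_nonzero[of p]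
      by (simp add: inner_D_HV(2)[OF \<omega> \<eta> \<beta>] inner_VV \<beta> \<eta> J2_form field_simps power2_eq_square power3_eq_cube)
  qed
qed

text \<open>The horizontal part has the same two sources as for the mixed derivative. In the vertical part
every term of the Koszul formula is \<open>\<nu>/f\<^sup>2\<close> times the one of the second factor.\<close>

lemma inner_D_VV:
  assumes \<omega>: "\<omega> \<in> M2.\<Omega>" and \<eta>: "\<eta> \<in> M2.\<Omega>"
  shows "\<alpha> \<in> M1.\<Omega> \<Longrightarrow> G (D (V \<omega>) (V \<eta>)) (H \<alpha>) (p, q) =
      - (G2 \<omega> \<eta> q / f p ^ 3) * G1 j \<alpha> p + G2 (J2 \<omega>) \<eta> q / 2 * G1 (M1.d nu) \<alpha> p"
    and "\<beta> \<in> M2.\<Omega> \<Longrightarrow> G (D (V \<omega>) (V \<eta>)) (V \<beta>) (p, q) = nu p / (f p)\<^sup>2 * G2 (D2 \<omega> \<eta>) \<beta> q"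
proof -
  show "G (D (V \<omega>) (V \<eta>)) (H \<alpha>) (p, q) =
      - (G2 \<omega> \<eta> q / f p ^ 3) * G1 j \<alpha> p + G2 (J2 \<omega>) \<eta> q / 2 * G1 (M1.d nu) \<alpha> p" if \<alpha>: "\<alpha> \<in> M1.\<Omega>"
  proof -
    have "2 * G (D (V \<omega>) (V \<eta>)) (H \<alpha>) (p, q)
        = - (sharp A1 P1 \<alpha> p (\<lambda>p. inverse (f p ^ 2)) * G2 \<omega> \<eta> q) + P2 q (\<omega> q) (\<eta> q) * G1 (M1.d nu) \<alpha> p"
      unfolding M.koszul[OF V_form[OF \<omega>] V_form[OF \<eta>] H_form[OF \<alpha>]]
        inner_bracket_VV[OF \<omega> \<eta> H_form[OF \<alpha>]]
      by (simp add: bracket_HV inner_HH inner_HV inner_VH inner_VV sharp_zero inner_zero_form V_form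
          sharp_H_product[OF \<alpha> smooth_inverse_power] M2.form_inner_smooth M2.bracket_closed dnu_form \<omega> \<eta> \<alpha>)
    also have "\<dots> = 2 * (- (G2 \<omega> \<eta> q / f p ^ 3) * G1 j \<alpha> p + G2 (J2 \<omega>) \<eta> q / 2 * G1 (M1.d nu) \<alpha> p)"
      unfolding sharp_inverse_square[OF \<alpha>] inner_J2[OF \<omega> \<eta>] by (simp add: algebra_simps)
    finally show ?thesis by simp
  qed
  show "G (D (V \<omega>) (V \<eta>)) (V \<beta>) (p, q) = nu p / (f p)\<^sup>2 * G2 (D2 \<omega> \<eta>) \<beta> q" if \<beta>: "\<beta> \<in> M2.\<Omega>"
  proof -
    have *: "2 * G (D (V \<omega>) (V \<eta>)) (V \<beta>) (p, q) = nu p / (f p)\<^sup>2 * (2 * G2 (D2 \<omega> \<eta>) \<beta> q)"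
      unfolding M.koszul[OF V_form[OF \<omega>] V_form[OF \<eta>] V_form[OF \<beta>]] M2.koszul[OF \<omega> \<eta> \<beta>]
        inner_bracket_VV[OF \<omega> \<eta> V_form[OF \<beta>]] inner_bracket_VV[OF \<omega> \<beta> V_form[OF \<eta>]]
        inner_bracket_VV[OF \<eta> \<beta> V_form[OF \<omega>]]
      by (simp add: inner_HV inner_VV sharp_V_product[OF _ smooth_inverse_power] M2.form_inner_smooth
          M2.bracket_closed dnu_form \<omega> \<eta> \<beta>)
        (simp add: divide_inverse algebra_simps)
    show ?thesis by (rule mult_left_cancel[THEN iffD1, of 2], simp, subst *, simp)
  qed
qed

lemma D_VV:
  assumes \<omega>: "\<omega> \<in> M2.\<Omega>" and \<eta>: "\<eta> \<in> M2.\<Omega>"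
  shows "D (V \<omega>) (V \<eta>) (p, q) = (\<lambda>v. (- (G2 \<omega> \<eta> q / f p ^ 3)) * H j (p, q) v
    + ((G2 (J2 \<omega>) \<eta> q / 2) * H (M1.d nu) (p, q) v + nu p * V (D2 \<omega> \<eta>) (p, q) v))" (is "_ = ?rhs")
proof -
  note D2 = M2.D_form[OF \<omega> \<eta>]
  note c = M.form_covec[OF H_form[OF j_form], of "(p, q)"] M.form_covec[OF H_form[OF dnu_form], of "(p, q)"]
    M.form_covec[OF V_form[OF D2], of "(p, q)"]
  note Dc = M.form_covec[OF M.D_form[OF V_form[OF \<omega>] V_form[OF \<eta>]], of "(p, q)"]
  note fi = form_inner_def[symmetric, where p = "(p, q)"]
  show ?thesis
  proof (rule covec_eq_on_lifts[OF Dc M.cot_lincomb3[OF c]])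
    fix \<alpha> assume \<alpha>: "\<alpha> \<in> M1.\<Omega>"
    show "cometric A g (p, q) (D (V \<omega>) (V \<eta>) (p, q)) (H \<alpha> (p, q)) = cometric A g (p, q) ?rhs (H \<alpha> (p, q))"
      unfolding M.cometric_lincomb3_left[OF c M.form_covec[OF H_form[OF \<alpha>]]] fi inner_D_VV(1)[OF \<omega> \<eta> \<alpha>]
      by (simp add: inner_HH inner_VH \<alpha> j_form dnu_form D2)
  next
    fix \<beta> assume \<beta>: "\<beta> \<in> M2.\<Omega>"
    show "cometric A g (p, q) (D (V \<omega>) (V \<eta>) (p, q)) (V \<beta> (p, q)) = cometric A g (p, q) ?rhs (V \<beta> (p, q))"
      unfolding M.cometric_lincomb3_left[OF c M.form_covec[OF V_form[OF \<beta>]]] fi inner_D_VV(2)[OF \<omega> \<eta> \<beta>]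
      by (simp add: inner_HV inner_VV \<beta> j_form dnu_form D2 inverse_eq_divide)
  qed
qed

text \<open>Connection, bracket and inner products of horizontal lifts are the lifts of those
of the first factor, and therefore so is the curvature.\<close>

lemma sectional_curvature_HH:
  assumes \<omega>: "\<omega> \<in> M1.\<Omega>" and \<eta>: "\<eta> \<in> M1.\<Omega>"
  shows "sectional_curvature A g P D (H \<omega>) (H \<eta>) (p, q) = sectional_curvature A1 g1 P1 D1 \<omega> \<eta> p"
proof -
  have H_diff: "form_diff (H \<alpha>) (H \<beta>) = H (form_diff \<alpha> \<beta>)" for \<alpha> \<beta>
    by (auto simp: form_diff_def horizontal_lift_def pullback_form_def pullback_covec_def fun_eq_iff)
  have R: "contravariant_curvature A P D (H \<omega>) (H \<eta>) (H \<eta>) = H (contravariant_curvature A1 P1 D1 \<omega> \<eta> \<eta>)"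
    by (simp add: contravariant_curvature_def D_HH bracket_HH H_diff M1.D_form M1.bracket_closed \<omega> \<eta>)
  have R1: "contravariant_curvature A1 P1 D1 \<omega> \<eta> \<eta> \<in> M1.\<Omega>"
    by (simp add: contravariant_curvature_def M1.D_form M1.bracket_closed M1.form_diff_closed \<omega> \<eta>)
  show ?thesis
    by (simp add: sectional_curvature_def gram_det_def R inner_HH R1 \<omega> \<eta>)
qed

text \<open>The facts \<open>t1\<close> to \<open>t5\<close> are the five terms of the curvature pairing. The derivative
\<open>D\<^sub>1 \<omega> j\<close> of the result comes from differentiating \<open>g\<^sub>1(j, \<omega>)\<close> in \<open>t1\<close>, where the companion
term \<open>g\<^sub>1(j, D\<^sub>1 \<omega> \<omega>)\<close> cancels against \<open>t2\<close>.\<close>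

lemma sectional_curvature_HV:
  assumes \<omega>: "\<omega> \<in> M1.\<Omega>" and \<eta>: "\<eta> \<in> M2.\<Omega>"
    and nz: "G1 \<omega> \<omega> p \<noteq> 0" "G2 \<eta> \<eta> q \<noteq> 0"
  shows "sectional_curvature A g P D (H \<omega>) (V \<eta>) (p, q) =
    - (G1 (D1 \<omega> j) \<omega> p / (f p * G1 \<omega> \<omega> p)) - 2 * (G1 j \<omega> p)\<^sup>2 / ((f p)\<^sup>2 * G1 \<omega> \<omega> p)
    + G2 (J2 \<eta>) (J2 \<eta>) q * ((f p)\<^sup>2 * G1 (M1.d nu) \<omega> p)\<^sup>2 / (4 * G1 \<omega> \<omega> p * G2 \<eta> \<eta> q)"
proof -
  define u where "u = G1 j \<omega> p"
  define w where "w = G1 (M1.d nu) \<omega> p"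
  define k where "k = G2 \<eta> \<eta> q"
  define \<kappa> where "\<kappa> = G2 (J2 \<eta>) (J2 \<eta>) q"
  note T = M1.VF_tangent[OF M1.sharp_VF[OF P1 \<omega>], of p]
  note fi = form_inner_def[symmetric, where p = "(p, q)"]
  have t1: "sharp A P (H \<omega>) (p, q) (G (D (V \<eta>) (V \<eta>)) (H \<omega>))
      = - k * (G1 (D1 \<omega> j) \<omega> p + G1 j (D1 \<omega> \<omega>) p) / f p ^ 3 - 3 * k * u\<^sup>2 / f p ^ 4"
  proof -
    have "G (D (V \<eta>) (V \<eta>)) (H \<omega>) = (\<lambda>z. (\<lambda>p. inverse (f p ^ 3) * G1 j \<omega> p) (fst z) * (\<lambda>q. - G2 \<eta> \<eta> q) (snd z))"
      using inner_D_VV(1)[OF \<eta> \<eta> \<omega>] by (auto simp: inner_J2_self[OF \<eta>] inverse_eq_divide)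
    then have "sharp A P (H \<omega>) (p, q) (G (D (V \<eta>) (V \<eta>)) (H \<omega>))
        = sharp A1 P1 \<omega> p (\<lambda>p. inverse (f p ^ 3) * G1 j \<omega> p) * (- k)"
      using sharp_H_product[OF \<omega> M1.smooth_mult[OF smooth_inverse_power M1.form_inner_smooth[OF j_form \<omega>]]
          M2.smooth_uminus[OF M2.form_inner_smooth[OF \<eta> \<eta>]]] by (simp add: k_def)
    also have "sharp A1 P1 \<omega> p (\<lambda>p. inverse (f p ^ 3) * G1 j \<omega> p)
        = inverse (f p ^ 3) * (G1 (D1 \<omega> j) \<omega> p + G1 j (D1 \<omega> \<omega>) p) + u * (3 * u / f p ^ 4)"
      using M1.tangent_derivation(2)[OF T smooth_inverse_power M1.form_inner_smooth[OF j_form \<omega>], of 3]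
      by (simp add: sharp_inverse_cube[OF \<omega>] M1.metric_compatible[OF \<omega> j_form \<omega>] u_def)
    finally show ?thesis
      by (simp add: inverse_eq_divide add_divide_distrib diff_divide_distrib power2_eq_square algebra_simps)
  qed
  have t2: "G (D (V \<eta>) (V \<eta>)) (D (H \<omega>) (H \<omega>)) (p, q) = - k * G1 j (D1 \<omega> \<omega>) p / f p ^ 3"
    using inner_D_VV(1)[OF \<eta> \<eta> M1.D_form[OF \<omega> \<omega>]]
    by (simp add: D_HH[OF \<omega> \<omega>] inner_J2_self[OF \<eta>] k_def)
  have t3: "sharp A P (V \<eta>) (p, q) (G (D (H \<omega>) (V \<eta>)) (H \<omega>)) = 0"
    by (simp add: inner_D_HV(1)[OF \<omega> \<eta> \<omega>] sharp_zero \<eta>)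
  have t4: "G (D (H \<omega>) (V \<eta>)) (D (V \<eta>) (H \<omega>)) (p, q) = u\<^sup>2 * k / f p ^ 4 + (f p)\<^sup>2 * w\<^sup>2 * \<kappa> / 4"
  proof -
    note c = M.form_covec[OF V_form[OF \<eta>], of "(p, q)"] M.form_covec[OF V_form[OF J2_form[OF \<eta>]], of "(p, q)"]
    note Dc = M.form_covec[OF M.D_form[OF H_form[OF \<omega>] V_form[OF \<eta>]], of "(p, q)"]
    have "G (D (H \<omega>) (V \<eta>)) (D (V \<eta>) (H \<omega>)) (p, q)
        = cometric A g (p, q) (D (H \<omega>) (V \<eta>) (p, q)) (\<lambda>v. (G1 j \<omega> p / f p) * V \<eta> (p, q) v
          + (- ((f p)\<^sup>2 * G1 (M1.d nu) \<omega> p / 2)) * V (J2 \<eta>) (p, q) v)"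
      by (simp only: D_VH[OF \<omega> \<eta>] form_inner_def D_HV[OF \<omega> \<eta>])
    also have "\<dots> = (G1 j \<omega> p / f p) * G (D (H \<omega>) (V \<eta>)) (V \<eta>) (p, q)
          + (- ((f p)\<^sup>2 * G1 (M1.d nu) \<omega> p / 2)) * G (D (H \<omega>) (V \<eta>)) (V (J2 \<eta>)) (p, q)"
      unfolding M.cometric_lincomb_right[OF c Dc] fi ..
    also have "\<dots> = (u / f p) * (u / f p ^ 3 * k) + (- ((f p)\<^sup>2 * w / 2)) * (- (w / 2 * \<kappa>))"
      unfolding inner_D_HV(2)[OF \<omega> \<eta> \<eta>] inner_D_HV(2)[OF \<omega> \<eta> J2_form[OF \<eta>]]
      using inner_J2_self[OF \<eta>] M2.form_inner_sym[OF \<eta> J2_form[OF \<eta>]]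
      by (simp add: u_def w_def k_def \<kappa>_def)
    also have "\<dots> = u\<^sup>2 * k / f p ^ 4 + (f p)\<^sup>2 * w\<^sup>2 * \<kappa> / 4"
      using f_nonzero[of p] by (simp add: field_simps eval_nat_numeral)
    finally show ?thesis .
  qed
  have t5: "G (D (form_bracket A P (H \<omega>) (V \<eta>)) (V \<eta>)) (H \<omega>) (p, q) = 0"
    by (simp add: bracket_HV[OF \<omega> \<eta>] M.D_zero_left V_form \<eta> inner_zero_form H_form \<omega>)
  have R: "G (contravariant_curvature A P D (H \<omega>) (V \<eta>) (V \<eta>)) (H \<omega>) (p, q)
      = - k * G1 (D1 \<omega> j) \<omega> p / f p ^ 3 - 2 * k * u\<^sup>2 / f p ^ 4 + (f p)\<^sup>2 * w\<^sup>2 * \<kappa> / 4"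
    unfolding M.curvature_pairing[OF H_form[OF \<omega>] V_form[OF \<eta>]] t1 t2 t3 t4 t5
    by (simp add: add_divide_distrib diff_divide_distrib algebra_simps)
  have Gd: "gram_det A g (H \<omega>) (V \<eta>) (p, q) = G1 \<omega> \<omega> p * k / (f p)\<^sup>2"
    by (simp add: gram_det_def inner_HH inner_HV inner_VV \<omega> \<eta> k_def inverse_eq_divide)
  show ?thesis
    unfolding sectional_curvature_def R Gd u_def[symmetric] w_def[symmetric] k_def[symmetric] \<kappa>_def[symmetric]
    using nz(1) nz(2)[folded k_def] f_nonzero[of p]
    by (simp add: field_simps eval_nat_numeral)
qed

text \<open>The parts with \<open>D\<^sub>2\<close> in the five terms of the curvature pairing assemble to
\<open>\<nu>\<^sup>2/f\<^sup>2\<close> times the pairing of the second factor. The products of the horizontal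
parts contribute the term with \<open>g\<^sub>1(j, j)\<close> and one quarter of \<open>\<Pi>\<^sub>2(\<omega>, \<eta>)\<^sup>2 g\<^sub>1(d\<nu>, d\<nu>)\<close>; the
part \<open>\<Pi>\<^sub>2(\<omega>, \<eta>) (d\<nu>)\<^sup>h\<close> of the bracket contributes two more quarters, and the mixed term with
\<open>g\<^sub>1(d\<nu>, j)\<close>.\<close>

lemma sectional_curvature_VV:
  assumes \<omega>: "\<omega> \<in> M2.\<Omega>" and \<eta>: "\<eta> \<in> M2.\<Omega>"
    and nz: "gram_det A2 g2 \<omega> \<eta> q \<noteq> 0"
  shows "sectional_curvature A g P D (V \<omega>) (V \<eta>) (p, q) =
    (nu p)\<^sup>2 * (f p)\<^sup>2 * sectional_curvature A2 g2 P2 D2 \<omega> \<eta> q - G1 j j p / (f p)\<^sup>2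
    - (3 * (f p)^4 * G1 (M1.d nu) (M1.d nu) p * (G2 (J2 \<omega>) \<eta> q)\<^sup>2
       + 4 * (f p * G1 (M1.d nu) j p) * G2 \<omega> \<eta> q * G2 (J2 \<omega>) \<eta> q) / (4 * gram_det A2 g2 \<omega> \<eta> q)"
proof -
  define x where "x = G2 \<omega> \<omega> q"
  define y where "y = G2 \<eta> \<eta> q"
  define s where "s = G2 \<omega> \<eta> q"
  define \<pi> where "\<pi> = G2 (J2 \<omega>) \<eta> q"
  define a where "a = G1 j j p"
  define b where "b = G1 (M1.d nu) (M1.d nu) p"
  define c where "c = G1 (M1.d nu) j p"
  have c': "G1 j (M1.d nu) p = c" unfolding c_def by (rule M1.form_inner_sym[OF j_form dnu_form])
  have s': "G2 \<eta> \<omega> q = s" unfolding s_def by (rule M2.form_inner_sym[OF \<eta> \<omega>])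
  have \<pi>': "G2 (J2 \<eta>) \<omega> q = - \<pi>" unfolding \<pi>_def by (rule inner_J2_swap[OF \<eta> \<omega>])
  note fi = form_inner_def[symmetric, where p = "(p, q)"]
  have smooth: "(\<lambda>p. nu p * inverse (f p ^ 2)) \<in> M1.C"
    by (rule M1.smooth_mult[OF nu smooth_inverse_power])
  \<comment> \<open>The coefficient \<open>\<nu>/f\<^sup>2\<close> is horizontal, so a vertical field does not differentiate it;
    the second factor \<open>\<nu>\<close> comes from the sharp map.\<close>
  have t_der: "sharp A P (V \<alpha>) (p, q) (G (D (V \<beta>) (V \<gamma>)) (V \<delta>))
      = (nu p)\<^sup>2 / (f p)\<^sup>2 * sharp A2 P2 \<alpha> q (G2 (D2 \<beta> \<gamma>) \<delta>)"
    if forms: "\<alpha> \<in> M2.\<Omega>" "\<beta> \<in> M2.\<Omega>" "\<gamma> \<in> M2.\<Omega>" "\<delta> \<in> M2.\<Omega>" for \<alpha> \<beta> \<gamma> \<delta>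
  proof -
    have "G (D (V \<beta>) (V \<gamma>)) (V \<delta>) = (\<lambda>z. (\<lambda>p. nu p * inverse (f p ^ 2)) (fst z) * G2 (D2 \<beta> \<gamma>) \<delta> (snd z))"
      using inner_D_VV(2)[OF forms(2,3,4)] by (auto simp: inverse_eq_divide)
    then show ?thesis
      using sharp_V_product[OF forms(1) smooth M2.form_inner_smooth[OF M2.D_form[OF forms(2,3)] forms(4)]]
      by (simp add: inverse_eq_divide power2_eq_square mult.commute mult.left_commute)
  qed
  have t_prod: "G (D (V \<alpha>) (V \<beta>)) (D (V \<gamma>) (V \<delta>)) (p, q)
      = G2 \<alpha> \<beta> q * G2 \<gamma> \<delta> q * a / f p ^ 6
      - (G2 \<alpha> \<beta> q * G2 (J2 \<gamma>) \<delta> q + G2 (J2 \<alpha>) \<beta> q * G2 \<gamma> \<delta> q) * c / (2 * f p ^ 3)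
      + G2 (J2 \<alpha>) \<beta> q * G2 (J2 \<gamma>) \<delta> q * b / 4
      + (nu p)\<^sup>2 / (f p)\<^sup>2 * G2 (D2 \<alpha> \<beta>) (D2 \<gamma> \<delta>) q"
    if forms: "\<alpha> \<in> M2.\<Omega>" "\<beta> \<in> M2.\<Omega>" "\<gamma> \<in> M2.\<Omega>" "\<delta> \<in> M2.\<Omega>" for \<alpha> \<beta> \<gamma> \<delta>
  proof -
    note D2 = M2.D_form[OF forms(3,4)]
    note cc = M.form_covec[OF H_form[OF j_form], of "(p, q)"] M.form_covec[OF H_form[OF dnu_form], of "(p, q)"]
      M.form_covec[OF V_form[OF D2], of "(p, q)"]
    note E = M.D_form[OF V_form[OF forms(1)] V_form[OF forms(2)]]
    have F: "D (V \<gamma>) (V \<delta>) \<in> M.\<Omega>" by (rule M.D_form[OF V_form[OF forms(3)] V_form[OF forms(4)]])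
    have "G (D (V \<alpha>) (V \<beta>)) (D (V \<gamma>) (V \<delta>)) (p, q) = G (D (V \<gamma>) (V \<delta>)) (D (V \<alpha>) (V \<beta>)) (p, q)"
      by (rule M.form_inner_sym[OF E F])
    also have "\<dots> = - (G2 \<gamma> \<delta> q / f p ^ 3) * G (H j) (D (V \<alpha>) (V \<beta>)) (p, q)
        + (G2 (J2 \<gamma>) \<delta> q / 2) * G (H (M1.d nu)) (D (V \<alpha>) (V \<beta>)) (p, q)
        + nu p * G (V (D2 \<gamma> \<delta>)) (D (V \<alpha>) (V \<beta>)) (p, q)"
      unfolding form_inner_def[of _ _ "D (V \<gamma>) (V \<delta>)"] D_VV[OF forms(3,4)]
        M.cometric_lincomb3_left[OF cc M.form_covec[OF E]] fi ..
    also have "\<dots> = - (G2 \<gamma> \<delta> q / f p ^ 3) * G (D (V \<alpha>) (V \<beta>)) (H j) (p, q)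
        + (G2 (J2 \<gamma>) \<delta> q / 2) * G (D (V \<alpha>) (V \<beta>)) (H (M1.d nu)) (p, q)
        + nu p * G (D (V \<alpha>) (V \<beta>)) (V (D2 \<gamma> \<delta>)) (p, q)"
      by (simp only: M.form_inner_sym[OF E H_form[OF j_form]] M.form_inner_sym[OF E H_form[OF dnu_form]]
          M.form_inner_sym[OF E V_form[OF D2]])
    also have "\<dots> = - (G2 \<gamma> \<delta> q / f p ^ 3) * (- (G2 \<alpha> \<beta> q / f p ^ 3) * a + G2 (J2 \<alpha>) \<beta> q / 2 * c)
        + (G2 (J2 \<gamma>) \<delta> q / 2) * (- (G2 \<alpha> \<beta> q / f p ^ 3) * c + G2 (J2 \<alpha>) \<beta> q / 2 * b)
        + nu p * (nu p / (f p)\<^sup>2 * G2 (D2 \<alpha> \<beta>) (D2 \<gamma> \<delta>) q)"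
      unfolding inner_D_VV(1)[OF forms(1,2) j_form] inner_D_VV(1)[OF forms(1,2) dnu_form] inner_D_VV(2)[OF forms(1,2) D2]
      by (simp add: a_def b_def c_def c')
    also have "\<dots> = G2 \<alpha> \<beta> q * G2 \<gamma> \<delta> q * a / f p ^ 6
      - (G2 \<alpha> \<beta> q * G2 (J2 \<gamma>) \<delta> q + G2 (J2 \<alpha>) \<beta> q * G2 \<gamma> \<delta> q) * c / (2 * f p ^ 3)
      + G2 (J2 \<alpha>) \<beta> q * G2 (J2 \<gamma>) \<delta> q * b / 4
      + (nu p)\<^sup>2 / (f p)\<^sup>2 * G2 (D2 \<alpha> \<beta>) (D2 \<gamma> \<delta>) q"
      using f_nonzero[of p] by (simp add: field_simps eval_nat_numeral)
    finally show ?thesis .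
  qed
  have t5: "G (D (form_bracket A P (V \<omega>) (V \<eta>)) (V \<eta>)) (V \<omega>) (p, q)
      = (nu p)\<^sup>2 / (f p)\<^sup>2 * G2 (D2 (form_bracket A2 P2 \<omega> \<eta>) \<eta>) \<omega> q
        + \<pi> * (c / f p ^ 3 * s + b / 2 * \<pi>)"
  proof -
    let ?B = "form_bracket A2 P2 \<omega> \<eta>"
    let ?p = "\<lambda>q. P2 q (\<omega> q) (\<eta> q)"
    have B: "?B \<in> M2.\<Omega>" by (rule M2.bracket_closed[OF \<omega> \<eta>])
    have pc: "?p \<in> M2.C" by (rule M2.bivector_smooth[OF P2 \<omega> \<eta>])
    have n: "nu \<circ> fst \<in> M.C" "?p \<circ> snd \<in> M.C" using smooth_fst[OF nu] smooth_snd[OF pc] by auto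
    have "D (form_bracket A P (V \<omega>) (V \<eta>)) (V \<eta>)
        = form_add (form_mult (nu \<circ> fst) (D (V ?B) (V \<eta>))) (form_mult (?p \<circ> snd) (D (H (M1.d nu)) (V \<eta>)))"
      unfolding bracket_VV[OF \<omega> \<eta>]
      by (simp only: M.D_add_left M.D_mult_left M.form_mult_closed n V_form[OF B] H_form[OF dnu_form] V_form[OF \<eta>])
    then have "G (D (form_bracket A P (V \<omega>) (V \<eta>)) (V \<eta>)) (V \<omega>) (p, q)
        = nu p * G (D (V ?B) (V \<eta>)) (V \<omega>) (p, q) + ?p q * G (D (H (M1.d nu)) (V \<eta>)) (V \<omega>) (p, q)"
      using M.cometric_lincomb_left[OF M.form_covec[OF M.D_form[OF V_form[OF B] V_form[OF \<eta>]]]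
          M.form_covec[OF M.D_form[OF H_form[OF dnu_form] V_form[OF \<eta>]]] M.form_covec[OF V_form[OF \<omega>]]]
      by (simp add: form_inner_def form_add_def form_mult_def)
    then show ?thesis
      unfolding inner_D_VV(2)[OF B \<eta> \<omega>] inner_D_HV(2)[OF dnu_form \<eta> \<omega>] inner_J2[OF \<omega> \<eta>, symmetric]
      by (simp add: c' s' \<pi>' \<pi>_def[symmetric] b_def[symmetric] power2_eq_square)
  qed
  have R: "G (contravariant_curvature A P D (V \<omega>) (V \<eta>) (V \<eta>)) (V \<omega>) (p, q)
      = (nu p)\<^sup>2 / (f p)\<^sup>2 * G2 (contravariant_curvature A2 P2 D2 \<omega> \<eta> \<eta>) \<omega> q
        - (x * y - s\<^sup>2) * a / f p ^ 6 - 3 * b * \<pi>\<^sup>2 / 4 - c * s * \<pi> / f p ^ 3"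
    unfolding M.curvature_pairing[OF V_form[OF \<omega>] V_form[OF \<eta>]] M2.curvature_pairing[OF \<omega> \<eta>]
      t_der[OF \<omega> \<eta> \<eta> \<omega>] t_der[OF \<eta> \<omega> \<eta> \<omega>] t_prod[OF \<eta> \<eta> \<omega> \<omega>] t_prod[OF \<omega> \<eta> \<eta> \<omega>] t5
      s' \<pi>' inner_J2_self[OF \<omega>] inner_J2_self[OF \<eta>]
      x_def[symmetric] y_def[symmetric] s_def[symmetric] \<pi>_def[symmetric]
    by (simp add: add_divide_distrib diff_divide_distrib power2_eq_square algebra_simps)
  have Gd: "gram_det A g (V \<omega>) (V \<eta>) (p, q) = gram_det A2 g2 \<omega> \<eta> q / f p ^ 4"
    by (simp add: gram_det_def inner_VV \<omega> \<eta> divide_inverse power2_eq_square eval_nat_numeral algebra_simps)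
  have Gd2: "gram_det A2 g2 \<omega> \<eta> q = x * y - s\<^sup>2"
    by (simp add: gram_det_def x_def y_def s_def)
  have nz': "x * y - s\<^sup>2 \<noteq> 0" using nz Gd2 by simp
  show ?thesis
    unfolding sectional_curvature_def R Gd Gd2 a_def[symmetric] b_def[symmetric] c_def[symmetric]
      \<pi>_def[symmetric] s_def[symmetric]
    using nz' f_nonzero[of p]
    by (simp add: divide_simps eval_nat_numeral) (simp add: algebra_simps)
qed

end

section \<open>The sectional curvatures of contravariant warped products\<close>

lemma smooth_metric_manifold_of_semi_riemannian:
  assumes "smooth_atlas A" "semi_riemannian_metric A g"
  shows "smooth_metric_manifold A g"
  using assms
  by (intro smooth_metric_manifold.intro metric_manifold.intro metric_manifold_axioms.intro
      smooth_metric_manifold_axioms.intro smooth_manifold.intro)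
    (simp_all add: semi_riemannian_metric_def)

theorem lemma3p1:
  fixes A1 :: "('m::{t2_space,second_countable_topology}, 'e::euclidean_space) chart set"
    and A2 :: "('n::{t2_space,second_countable_topology}, 'f::euclidean_space) chart set"
    and A :: "('m \<times> 'n, 'e \<times> 'f) chart set"
    and g1 :: "'m metric" and g2 :: "'n metric" and g :: "('m \<times> 'n) metric"
    and P1 :: "'m bivec" and P2 :: "'n bivec" and P :: "('m \<times> 'n) bivec"
    and f1 nu1 :: "'m \<Rightarrow> real"
    and D1 :: "'m form \<Rightarrow> 'm form \<Rightarrow> 'm form"
    and D2 :: "'n form \<Rightarrow> 'n form \<Rightarrow> 'n form"
    and D :: "('m \<times> 'n) form \<Rightarrow> ('m \<times> 'n) form \<Rightarrow> ('m \<times> 'n) form"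
    and J1 :: "'m form \<Rightarrow> 'm form" and J2 :: "'n form \<Rightarrow> 'n form"
    and G1 :: "'m form \<Rightarrow> 'm form \<Rightarrow> 'm \<Rightarrow> real"
    and G2 :: "'n form \<Rightarrow> 'n form \<Rightarrow> 'n \<Rightarrow> real"
    and d1 :: "('m \<Rightarrow> real) \<Rightarrow> 'm form"
    and H :: "'m form \<Rightarrow> ('m \<times> 'n) form" and V :: "'n form \<Rightarrow> ('m \<times> 'n) form"
    and K :: "('m \<times> 'n) form \<Rightarrow> ('m \<times> 'n) form \<Rightarrow> 'm \<times> 'n \<Rightarrow> real"
    and K1 :: "'m form \<Rightarrow> 'm form \<Rightarrow> 'm \<Rightarrow> real"
    and K2 :: "'n form \<Rightarrow> 'n form \<Rightarrow> 'n \<Rightarrow> real"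
    and \<omega>1 \<eta>1 :: "'m form" and \<omega>2 \<eta>2 :: "'n form"
    and p :: 'm and q :: 'n
  assumes "smooth_atlas A1" and "smooth_atlas A2"
    and "poisson_structure A1 P1" and "poisson_structure A2 P2"
    and "semi_riemannian_metric A1 g1" and "semi_riemannian_metric A2 g2"
    and "contravariant_levi_civita A1 g1 P1 D1"
    and "contravariant_levi_civita A2 g2 P2 D2"
    and "f1 \<in> smooth_funs A1" and "\<forall>x. 0 < f1 x" and "nu1 \<in> smooth_funs A1"
    and "A = product_atlas A1 A2"
    and "g = warped_metric A1 A2 f1 g1 g2"
    and "P = warped_bivector A1 A2 nu1 P1 P2"
    and "contravariant_levi_civita A g P D"
    and "J1 = endo_J A1 g1 P1" and "J2 = endo_J A2 g2 P2"
    and "G1 = form_inner A1 g1" and "G2 = form_inner A2 g2"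
    and "d1 = differential A1"
    and "H = horizontal_lift A1 A2" and "V = vertical_lift A1 A2"
    and "K = sectional_curvature A g P D"
    and "K1 = sectional_curvature A1 g1 P1 D1"
    and "K2 = sectional_curvature A2 g2 P2 D2"
    and "\<omega>1 \<in> one_forms A1" and "\<eta>1 \<in> one_forms A1"
    and "\<omega>2 \<in> one_forms A2" and "\<eta>2 \<in> one_forms A2"
  shows "(nondegenerate_independent A1 g1 \<omega>1 \<eta>1 p \<longrightarrow>
           K (H \<omega>1) (H \<eta>1) (p, q) = K1 \<omega>1 \<eta>1 p) \<and>
         (G1 \<omega>1 \<omega>1 p \<noteq> 0 \<and> G2 \<eta>2 \<eta>2 q \<noteq> 0 \<longrightarrow>
           K (H \<omega>1) (V \<eta>2) (p, q) =
             - (G1 (D1 \<omega>1 (J1 (d1 f1))) \<omega>1 p / (f1 p * G1 \<omega>1 \<omega>1 p))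
             - 2 * \<bar>G1 (J1 (d1 f1)) \<omega>1 p\<bar>\<^sup>2 / ((f1 p)\<^sup>2 * G1 \<omega>1 \<omega>1 p)
             + G2 (J2 \<eta>2) (J2 \<eta>2) q * \<bar>(f1 p)\<^sup>2 * G1 (d1 nu1) \<omega>1 p\<bar>\<^sup>2
                 / (4 * G1 \<omega>1 \<omega>1 p * G2 \<eta>2 \<eta>2 q)) \<and>
         (nondegenerate_independent A2 g2 \<omega>2 \<eta>2 q \<longrightarrow>
           K (V \<omega>2) (V \<eta>2) (p, q) =
             (nu1 p)\<^sup>2 * (f1 p)\<^sup>2 * K2 \<omega>2 \<eta>2 q
             - G1 (J1 (d1 f1)) (J1 (d1 f1)) p / (f1 p)\<^sup>2
             - (3 * (f1 p)^4 * G1 (d1 nu1) (d1 nu1) p * \<bar>G2 (J2 \<omega>2) \<eta>2 q\<bar>\<^sup>2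
                 + 4 * (f1 p * G1 (d1 nu1) (J1 (d1 f1)) p) * G2 \<omega>2 \<eta>2 q * G2 (J2 \<omega>2) \<eta>2 q)
               / (4 * (G2 \<omega>2 \<omega>2 q * G2 \<eta>2 \<eta>2 q - \<bar>G2 \<omega>2 \<eta>2 q\<bar>\<^sup>2)))"
proof -
  interpret M1: smooth_metric_manifold A1 g1
    using assms(1,5) by (rule smooth_metric_manifold_of_semi_riemannian)
  interpret M2: smooth_metric_manifold A2 g2
    using assms(2,6) by (rule smooth_metric_manifold_of_semi_riemannian)
  interpret M1: levi_civita_manifold A1 g1 P1 D1 by unfold_locales (rule assms(7))
  interpret M2: levi_civita_manifold A2 g2 P2 D2 by unfold_locales (rule assms(8))
  interpret warped_product A1 A2 g1 g2 P1 P2 f1 nu1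
    using assms(3,4,9-11) by unfold_locales (auto simp: poisson_structure_def)
  interpret warped_levi_civita A1 A2 g1 g2 P1 P2 f1 nu1 D1 D2 D
    by unfold_locales (use assms(12-15) in simp)
  note [simp] = assms(12-14,16-25)
  show ?thesis
    using sectional_curvature_HH[OF assms(26,27), of p q] sectional_curvature_HV[OF assms(26,29), of p q]
      sectional_curvature_VV[OF assms(28,29), of q p]
    by (simp add: nondegenerate_independent_def gram_det_def)
qed

end
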